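(* Any sphere of revolution in $\mathbb{R}^3$ without branch points is uniquely defined (up to homotheties of the sphere and rigid motions in $\mathbb{R}^3$) by the potential of any of its Weierstrass representations. That is, if two spheres of revolution without branch points have Weierstrass representations with the same potential, then one of them is obtained from the other by a homothety and a rigid motion of $\mathbb{R}^3$.
   Context: Notation: $\partial=\partial/\partial z=\frac12(\partial_x-i\partial_y)$, $\bar\partial=\partial/\partial\bar z$. For a real-valued potential $U$ the Dirac operator is $$\mathcal{D}=\begin{pmatrix}0&\partial\\-\bar\partial&0\end{pmatrix}+\begin{pmatrix}U&0\\0&U\end{pmatrix}.$$ A vector function $\psi=(\psi_1,\psi_2)$ with $\mathcal{D}\psi=0$ defines, up to translations, a map into $\mathbb{R}^3$ by the formulas (W): $$X^1=\frac i2\int\left((\bar\psi_2^2+\psi_1^2)\,dz-(\bar\psi_1^2+\psi_2^2)\,d\bar z\right),\quad X^2=\frac12\int\left((\bar\psi_2^2-\psi_1^2)\,dz-(\bar\psi_1^2-\psi_2^2)\,d\bar z\right),$$ $$X^3=\int\left(\psi_1\bar\psi_2\,dz+\bar\psi_1\psi_2\,d\bar z\right).$$ Weierstrass representations of an immersed sphere $\Sigma$ are of two kinds. Plane representation: real potentials $U(z,\bar z)$, $\tilde U(u,\bar u)$ and vector functions $\psi(z,\bar z)$, $\tilde\psi(u,\bar u)$ on a pair of conformal charts $z\in\mathbb{C}\approx\Sigma\setminus\{\infty_+\}$, $u=-1/z\in\mathbb{C}\approx\Sigma\setminus\{\infty_-\}$ covering $\Sigma$, with $\tilde U=|z|^2U$,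 $\tilde\psi_1=z\psi_1$, $\tilde\psi_2=\bar z\psi_2$, such that $\psi$ and $\tilde\psi$ satisfy the Dirac equations with potentials $U$ and $\tilde U$ respectively and define by (W), for a suitable choice of coordinates in $\mathbb{R}^3$, the immersion of $\Sigma$. The potential of the representation is $U$. Cylindric representation: with $z'=\log z=x'+iy'$ on the cylinder $\mathcal{Z}=\mathbb{C}/2\pi i\mathbb{Z}\approx\Sigma\setminus\{\infty_\pm\}$, it is given by $\hat U=|z|U$, $\hat\psi_1=\sqrt z\,\psi_1$, $\hat\psi_2=\sqrt{\bar z}\,\psi_2$; these satisfy the Dirac equation in the variable $z'$ with potential $\hat U$, $\hat\psi(x',y'+2\pi)=-\hat\psi(x',y')$, and as $x'\to\pm\infty$: $\hat U=U_\pm e^{-|x'|}+O(e^{-2|x'|})$, $|\hat\psi|^2=C_\pm e^{-|x'|}+O(e^{-2|x'|})$ with constants $U_\pm$, $C_\pm\ne0$. The potential of the representation is $\hat U$. *)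

theory Defs
  imports "HOL-Analysis.Analysis" "HOL-Library.Landau_Symbols"
begin

primrec Ck_on :: "nat \<Rightarrow> ('a::real_normed_vector \<Rightarrow> 'b::real_normed_vector) \<Rightarrow> 'a set \<Rightarrow> bool" where
  "Ck_on 0 f S \<longleftrightarrow> continuous_on S f"
| "Ck_on (Suc k) f S \<longleftrightarrow> (\<forall>x\<in>S. f differentiable (at x)) \<and>
     (\<forall>v. Ck_on k (\<lambda>x. frechet_derivative f (at x) v) S)"

text \<open>Only used for open sets \<open>S\<close>.\<close>

definition smooth_on :: "('a::real_normed_vector \<Rightarrow> 'b::real_normed_vector) \<Rightarrow> 'a set \<Rightarrow> bool" where
  "smooth_on f S \<longleftrightarrow> (\<forall>k. Ck_on k f S)"

text \<open>
  Immersed spheres are maps on the unit sphere in \<open>\<real>\<^sup>3\<close>; values off the unit sphere are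
  irrelevant. Smoothness and the differential are expressed through the extension that is constant
  along rays: it is smooth off the origin iff the map is smooth on the sphere, and its derivative
  at a point of the sphere restricts to the differential on the tangent plane.
\<close>

abbreviation S2 :: "(real^3) set" where
  "S2 \<equiv> sphere 0 1"

definition radial_extension :: "(real^3 \<Rightarrow> real^3) \<Rightarrow> real^3 \<Rightarrow> real^3" where
  "radial_extension f x = f (x /\<^sub>R norm x)"

definition immersed_sphere :: "(real^3 \<Rightarrow> real^3) \<Rightarrow> bool" where
  "immersed_sphere f \<longleftrightarrow> smooth_on (radial_extension f) (- {0}) \<and>
     (\<forall>x\<in>S2. \<forall>v. v \<bullet> x = 0 \<and> v \<noteq> 0 \<longrightarrow> frechet_derivative (radial_extension f) (at x) v \<noteq> 0)"

text \<open>
  The axis is the line through \<open>a\<close> in direction \<open>d\<close>. Being an immersion means that there are no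
  branch points; self-intersections are allowed.
\<close>

definition sphere_of_revolution :: "(real^3 \<Rightarrow> real^3) \<Rightarrow> bool" where
  "sphere_of_revolution f \<longleftrightarrow> immersed_sphere f \<and>
     (\<exists>a d. d \<noteq> 0 \<and>
        (\<forall>R. rotation_matrix R \<and> R *v d = d \<longrightarrow> (\<lambda>p. a + R *v (p - a)) ` (f ` S2) = f ` S2))"

text \<open>
  A chart is given by its inverse \<open>\<sigma>\<close>, a smooth parametrization of the sphere minus the point
  \<open>q\<close> by the whole complex plane; it is conformal for the metric induced by the immersion \<open>f\<close>.
\<close>

definition conformal_chart :: "(real^3 \<Rightarrow> real^3) \<Rightarrow> real^3 \<Rightarrow> (complex \<Rightarrow> real^3) \<Rightarrow> bool" where
  "conformal_chart f q \<sigma> \<longleftrightarrow>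
     smooth_on \<sigma> UNIV \<and> bij_betw \<sigma> UNIV (S2 - {q}) \<and>
     (\<forall>w h. h \<noteq> 0 \<longrightarrow> frechet_derivative \<sigma> (at w) h \<noteq> 0) \<and>
     (\<forall>w. let Fx = frechet_derivative (f \<circ> \<sigma>) (at w) 1;
              Fy = frechet_derivative (f \<circ> \<sigma>) (at w) \<i>
          in Fx \<bullet> Fy = 0 \<and> norm Fx = norm Fy)"

definition d_z :: "(complex \<Rightarrow> complex) \<Rightarrow> complex \<Rightarrow> complex" where
  "d_z f w = (frechet_derivative f (at w) 1 - \<i> * frechet_derivative f (at w) \<i>) / 2"

definition d_zbar :: "(complex \<Rightarrow> complex) \<Rightarrow> complex \<Rightarrow> complex" where
  "d_zbar f w = (frechet_derivative f (at w) 1 + \<i> * frechet_derivative f (at w) \<i>) / 2"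

definition dirac :: "(complex \<Rightarrow> real) \<Rightarrow> (complex \<Rightarrow> complex^2) \<Rightarrow> complex \<Rightarrow> complex^2" where
  "dirac U \<psi> w = vector
     [d_z (\<lambda>z. \<psi> z $ 2) w + of_real (U w) * \<psi> w $ 1,
      - d_zbar (\<lambda>z. \<psi> z $ 1) w + of_real (U w) * \<psi> w $ 2]"

text \<open>
  The three Weierstrass one-forms for a spinor value \<open>s\<close>, evaluated on a tangent vector \<open>h\<close>:
  \<open>dz\<close> and its conjugate take the values \<open>h\<close> and \<open>cnj h\<close>.
\<close>

definition weierstrass_form :: "complex^2 \<Rightarrow> complex \<Rightarrow> complex^3" where
  "weierstrass_form s h = vector
     [\<i> / 2 * (((cnj (s$2))\<^sup>2 + (s$1)\<^sup>2) * h - ((cnj (s$1))\<^sup>2 + (s$2)\<^sup>2) * cnj h),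
      1 / 2 * (((cnj (s$2))\<^sup>2 - (s$1)\<^sup>2) * h - ((cnj (s$1))\<^sup>2 - (s$2)\<^sup>2) * cnj h),
      s$1 * cnj (s$2) * h + cnj (s$1) * s$2 * cnj h]"

text \<open>
  \<open>X\<close> is an indefinite integral of these forms, so it is determined by \<open>\<psi>\<close> up to translations.
\<close>

definition weierstrass_map :: "(complex \<Rightarrow> complex^2) \<Rightarrow> (complex \<Rightarrow> real^3) \<Rightarrow> bool" where
  "weierstrass_map \<psi> X \<longleftrightarrow>
     (\<forall>\<gamma>. valid_path \<gamma> \<longrightarrow>
       ((\<lambda>t. weierstrass_form (\<psi> (\<gamma> t)) (vector_derivative \<gamma> (at t within {0..1})))
          has_integral (\<chi> k. of_real (X (pathfinish \<gamma>) $ k - X (pathstart \<gamma>) $ k))) {0..1})"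

text \<open>
  The charts \<open>z\<close> and \<open>u = - 1 / z\<close> have the inverses \<open>\<sigma>\<close> and \<open>\<tau>\<close>, so that \<open>\<tau> 0\<close> is the point
  \<open>z = \<infinity>\<close> and \<open>\<sigma> 0\<close> is the point \<open>u = \<infinity>\<close>. The orthogonal matrix \<open>A\<close> (of any determinant)
  chooses the Cartesian coordinates in \<open>\<real>\<^sup>3\<close>; moving the origin does not affect
  \<open>weierstrass_map\<close>. Smoothness of \<open>U\<close> and \<open>V\<close> follows from the Dirac equations, since the
  spinor of an immersion has no zeros.
\<close>

definition plane_representation ::
  "(real^3 \<Rightarrow> real^3) \<Rightarrow> (complex \<Rightarrow> real^3) \<Rightarrow> (complex \<Rightarrow> real^3) \<Rightarrow>
   (complex \<Rightarrow> real) \<Rightarrow> (complex \<Rightarrow> real) \<Rightarrow>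
   (complex \<Rightarrow> complex^2) \<Rightarrow> (complex \<Rightarrow> complex^2) \<Rightarrow> bool" where
  "plane_representation f \<sigma> \<tau> U V \<psi> \<phi> \<longleftrightarrow>
     conformal_chart f (\<tau> 0) \<sigma> \<and> conformal_chart f (\<sigma> 0) \<tau> \<and>
     (\<forall>z. z \<noteq> 0 \<longrightarrow> \<tau> (- 1 / z) = \<sigma> z) \<and>
     (\<forall>z. z \<noteq> 0 \<longrightarrow> V (- 1 / z) = (norm z)\<^sup>2 * U z \<and>
        \<phi> (- 1 / z) $ 1 = z * \<psi> z $ 1 \<and> \<phi> (- 1 / z) $ 2 = cnj z * \<psi> z $ 2) \<and>
     smooth_on \<psi> UNIV \<and> smooth_on \<phi> UNIV \<and>
     (\<forall>z. dirac U \<psi> z = 0) \<and> (\<forall>u. dirac V \<phi> u = 0) \<and>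
     (\<exists>A :: real^3^3. orthogonal_matrix A \<and>
        weierstrass_map \<psi> (\<lambda>z. A *v f (\<sigma> z)) \<and> weierstrass_map \<phi> (\<lambda>u. A *v f (\<tau> u)))"

text \<open>
  Functions on the cylinder are functions of \<open>w = log z\<close> on the universal cover, so that
  \<open>exp (w / 2)\<close> is the square root of \<open>z\<close>. The filter \<open>filtercomap Re at_top\<close> makes the
  asymptotics uniform in \<open>Im w\<close>.
\<close>

definition cylindric_representation ::
  "(real^3 \<Rightarrow> real^3) \<Rightarrow> (complex \<Rightarrow> real^3) \<Rightarrow> (complex \<Rightarrow> real^3) \<Rightarrow>
   (complex \<Rightarrow> real) \<Rightarrow> (complex \<Rightarrow> complex^2) \<Rightarrow> bool" where
  "cylindric_representation f \<sigma> \<tau> W \<eta> \<longleftrightarrow>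
     (\<exists>U V \<psi> \<phi>. plane_representation f \<sigma> \<tau> U V \<psi> \<phi> \<and>
        (\<forall>w. W w = norm (exp w) * U (exp w) \<and>
             \<eta> w $ 1 = exp (w / 2) * \<psi> (exp w) $ 1 \<and>
             \<eta> w $ 2 = cnj (exp (w / 2)) * \<psi> (exp w) $ 2)) \<and>
     (\<forall>w. dirac W \<eta> w = 0) \<and>
     (\<forall>w. \<eta> (w + 2 * of_real pi * \<i>) = - \<eta> w) \<and>
     (\<forall>F \<in> {filtercomap Re at_top, filtercomap Re at_bot}. \<exists>U0 C0 :: real. C0 \<noteq> 0 \<and>
        (\<lambda>w. W w - U0 * exp (- \<bar>Re w\<bar>)) \<in> O[F](\<lambda>w. exp (- 2 * \<bar>Re w\<bar>)) \<and>
        (\<lambda>w. (norm (\<eta> w))\<^sup>2 - C0 * exp (- \<bar>Re w\<bar>)) \<in> O[F](\<lambda>w. exp (- 2 * \<bar>Re w\<bar>)))"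

definition plane_potential :: "(real^3 \<Rightarrow> real^3) \<Rightarrow> (complex \<Rightarrow> real) \<Rightarrow> bool" where
  "plane_potential f U \<longleftrightarrow> (\<exists>\<sigma> \<tau> V \<psi> \<phi>. plane_representation f \<sigma> \<tau> U V \<psi> \<phi>)"

definition cylindric_potential :: "(real^3 \<Rightarrow> real^3) \<Rightarrow> (complex \<Rightarrow> real) \<Rightarrow> bool" where
  "cylindric_potential f W \<longleftrightarrow> (\<exists>\<sigma> \<tau> \<eta>. cylindric_representation f \<sigma> \<tau> W \<eta>)"

text \<open>
  Spheres are compared as surfaces, that is, up to the parametrization \<open>\<theta>\<close>. Pointwise equality in
  the given charts would be false: a round potential may be rotated in the domain.
\<close>

definition similar_spheres :: "(real^3 \<Rightarrow> real^3) \<Rightarrow> (real^3 \<Rightarrow> real^3) \<Rightarrow> bool" where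
  "similar_spheres f g \<longleftrightarrow>
     (\<exists>c R b \<theta> \<theta>'. 0 < c \<and> rotation_matrix R \<and> homeomorphism S2 S2 \<theta> \<theta>' \<and>
        (\<forall>p\<in>S2. g (\<theta> p) = c *\<^sub>R (R *v f p) + b))"

end

theory Submission
  imports Defs "HOL-Complex_Analysis.Cauchy_Integral_Formula"
begin

text \<open>
  The Killing field of the rotation is tangent to the surface, because the rotated copies of the
  surface would otherwise sweep out an open set. Pulled back to a conformal chart it is a holomorphic
  vector field on the Riemann sphere, hence a quadratic polynomial \<open>\<xi>\<close>, and its two zeros are
  simple with \<open>\<xi>' = \<plusminus>\<i>\<close>. Hence it generates a one-parameter group of elliptic Moebius
  transformations \<open>exp (t F / 2)\<close>, \<open>F\<^sup>2 = -1\<close>, under which \<open>U \<bar>dz\<bar>\<close> is invariant.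

  Two spheres with the same potential give two such matrices \<open>F\<close> and \<open>G\<close>. The trace of \<open>F G\<close> is
  real, since a loxodromic symmetry would force \<open>U = 0\<close>, and then the spinor would vanish by
  Liouville's theorem. Consequently a suitable product of symmetries conjugates \<open>F\<close> to \<open>G\<close> or
  \<open>-G\<close>, and the two axes may be assumed to agree. In the logarithmic coordinate both spinors are
  then, up to a constant element of \<open>SU(2)\<close>, solutions of the same linear ordinary differential
  equation that decay at one end. Such a solution is unique up to a complex factor, which acts
  on the surface by a homothety and a rotation.
\<close>

text \<open>The hypothesis rotates only the image of \<open>f\<close>, a possibly self-intersecting
  set. No action on the parametrizing sphere is given, and a rotated point need not depend
  continuously on the angle. Hence the start from the Killing field and a measure argument instead
  of a lifted symmetry group. The charts of a representation are arbitrary conformal ones, so the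
  fixed points of the symmetry may lie anywhere, and a potential may admit several such groups, as
  the round one does. Equal potentials therefore do not match the axes at once; this forces Moebius
  changes of the chart, hence homogeneous coordinates. The trace matters because \<open>F\<close>
  and \<open>G\<close> belong to the two groups, so \<open>F G\<close> is a symmetry. After
  replacing \<open>G\<close> by \<open>-G\<close> if necessary, the trace is \<open>-2c\<close> with
  \<open>c \<ge> 0\<close>, and the conjugating product has real coefficients. Coordinates of a
  representation are orthogonal of either determinant, while similarity asks for a rotation. The
  mirror symmetry from \<open>w\<close> to \<open>cnj w\<close> of a potential that depends only on
  \<open>Re w\<close> closes this gap.\<close>

section \<open>Wirtinger derivatives and homogeneous Weierstrass data\<close>

text \<open>The coefficients \<open>a\<close> and \<open>b\<close> are the derivatives of \<open>f\<close> with respect to \<open>z\<close> and \<open>cnj z\<close>.\<close>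

definition has_wirtinger :: "(complex \<Rightarrow> complex) \<Rightarrow> complex \<Rightarrow> complex \<Rightarrow> complex \<Rightarrow> bool" where
  "has_wirtinger f a b z \<longleftrightarrow> (f has_derivative (\<lambda>h. a * h + b * cnj h)) (at z)"

lemma wirtinger_unique:
  assumes "has_wirtinger f a b z" "has_wirtinger f a' b' z"
  shows "a = a'" "b = b'"
proof -
  have eq: "(\<lambda>h. a * h + b * cnj h) = (\<lambda>h. a' * h + b' * cnj h)"
    using assms has_derivative_unique unfolding has_wirtinger_def by blast
  have 1: "a + b = a' + b'"
    using fun_cong[OF eq, of 1] by simp
  have "\<i> * (a - b) = \<i> * (a' - b')"
    using fun_cong[OF eq, of \<i>] by (simp add: right_diff_distrib mult.commute)
  then have 2: "a - b = a' - b'" by simp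
  have "2 * a = (a + b) + (a - b)" by simp
  also have "\<dots> = 2 * a'" unfolding 1 2 by simp
  finally have "2 * a = 2 * a'" .
  then show "a = a'" by simp
  with 1 show "b = b'" by simp
qed

lemma wirtinger_cong:
  assumes "has_wirtinger f a b z" "a = a'" "b = b'"
  shows "has_wirtinger f a' b' z"
  using assms by simp

lemma wirtinger_const: "has_wirtinger (\<lambda>_. c) 0 0 z"
  by (simp add: has_wirtinger_def)

lemma wirtinger_add:
  assumes "has_wirtinger f a b z" "has_wirtinger g c d z"
  shows "has_wirtinger (\<lambda>w. f w + g w) (a + c) (b + d) z"
  using has_derivative_add[OF assms[unfolded has_wirtinger_def]]
  by (simp add: has_wirtinger_def algebra_simps)

lemma wirtinger_diff:
  assumes "has_wirtinger f a b z" "has_wirtinger g c d z"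
  shows "has_wirtinger (\<lambda>w. f w - g w) (a - c) (b - d) z"
  using has_derivative_diff[OF assms[unfolded has_wirtinger_def]]
  by (simp add: has_wirtinger_def algebra_simps)

lemma wirtinger_mult:
  assumes "has_wirtinger f a b z" "has_wirtinger g c d z"
  shows "has_wirtinger (\<lambda>w. f w * g w) (a * g z + f z * c) (b * g z + f z * d) z"
  using has_derivative_mult[OF assms[unfolded has_wirtinger_def]]
  by (simp add: has_wirtinger_def algebra_simps)

lemma wirtinger_cmult:
  assumes "has_wirtinger f a b z"
  shows "has_wirtinger (\<lambda>w. c * f w) (c * a) (c * b) z"
  using wirtinger_mult[OF wirtinger_const assms, of c] by simp

lemma wirtinger_cnj:
  assumes "has_wirtinger f a b z"
  shows "has_wirtinger (\<lambda>w. cnj (f w)) (cnj b) (cnj a) z"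
  using has_derivative_cnj[OF assms[unfolded has_wirtinger_def]]
  by (simp add: has_wirtinger_def algebra_simps)

lemma wirtinger_inverse:
  assumes "has_wirtinger f a b z" "f z \<noteq> 0"
  shows "has_wirtinger (\<lambda>w. inverse (f w)) (- a / (f z)\<^sup>2) (- b / (f z)\<^sup>2) z"
  using Deriv.has_derivative_inverse[OF assms(2) assms(1)[unfolded has_wirtinger_def]] assms(2)
  unfolding has_wirtinger_def
  by (elim has_derivative_eq_rhs) (simp add: fun_eq_iff field_simps power2_eq_square)

lemma wirtinger_holomorphic_iff: "has_wirtinger f a 0 z \<longleftrightarrow> (f has_field_derivative a) (at z)"
  by (simp add: has_wirtinger_def has_field_derivative_def)

lemma wirtinger_compose:
  assumes "has_wirtinger f a b (g z)" "(g has_field_derivative g') (at z)"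
  shows "has_wirtinger (\<lambda>w. f (g w)) (a * g') (b * cnj g') z"
  using has_derivative_compose[OF assms(2)[unfolded has_field_derivative_def] assms(1)[unfolded has_wirtinger_def]]
  by (simp add: has_wirtinger_def algebra_simps)

lemma wirtinger_compose_cnj:
  assumes "has_wirtinger f a b (cnj z)"
  shows "has_wirtinger (\<lambda>w. f (cnj w)) b a z"
  using has_derivative_compose[OF has_derivative_cnj[OF has_derivative_ident] assms[unfolded has_wirtinger_def]]
  by (simp add: has_wirtinger_def algebra_simps)

lemma wirtinger_transform:
  assumes "has_wirtinger f a b z" "eventually (\<lambda>w. f w = g w) (nhds z)"
  shows "has_wirtinger g a b z"
proof -
  have "eventually (\<lambda>w. f w = g w) (at z)"
    using assms(2) unfolding eventually_at_filter by (rule eventually_mono) simp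
  moreover have "f z = g z"
    using assms(2) eventually_nhds_x_imp_x by fastforce
  ultimately show ?thesis
    using has_derivative_transform_eventually[OF assms(1)[unfolded has_wirtinger_def]] unfolding has_wirtinger_def by simp
qed

lemma wirtinger_dz:
  assumes "f differentiable (at z)"
  shows "has_wirtinger f (d_z f z) (d_zbar f z) z"
proof -
  let ?D = "frechet_derivative f (at z)"
  have D: "(f has_derivative ?D) (at z)"
    using assms frechet_derivative_works by blast
  then have lin: "linear ?D"
    using has_derivative_linear by blast
  have aux: "(A - \<i> * B) / 2 * h + (A + \<i> * B) / 2 * k = (A * (h + k) - \<i> * B * (h - k)) / 2"
    for A B h k :: complex by (simp add: field_simps)
  have aux2: "Re h *\<^sub>R A + Im h *\<^sub>R B = (A * (h + cnj h) - \<i> * B * (h - cnj h)) / 2"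
    for A B h by (rule complex_eqI) (simp_all add: field_simps)
  have "?D h = d_z f z * h + d_zbar f z * cnj h" for h
  proof -
    have "?D (Re h *\<^sub>R 1 + Im h *\<^sub>R \<i>) = Re h *\<^sub>R ?D 1 + Im h *\<^sub>R ?D \<i>"
      by (simp only: linear_add[OF lin] linear_scale[OF lin])
    also have "\<dots> = (?D 1 * (h + cnj h) - \<i> * ?D \<i> * (h - cnj h)) / 2"
      by (rule aux2)
    also have "\<dots> = d_z f z * h + d_zbar f z * cnj h"
      unfolding d_z_def d_zbar_def aux ..
    also have "Re h *\<^sub>R 1 + Im h *\<^sub>R \<i> = h"
      by (simp add: complex_eq_iff)
    finally show ?thesis .
  qed
  then have "?D = (\<lambda>h. d_z f z * h + d_zbar f z * cnj h)" by blast
  with D show ?thesis by (simp add: has_wirtinger_def)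
qed

section \<open>The Weierstrass forms in complex coordinates\<close>

definition hor :: "real^3 \<Rightarrow> complex" where
  "hor x = Complex (x $ 1) (x $ 2)"

text \<open>The real Weierstrass forms of a spinor \<open>\<psi>\<close>, in terms of \<open>m = \<psi>\<^sub>1\<close> and \<open>n = cnj \<psi>\<^sub>2\<close>.\<close>

definition wform :: "complex \<Rightarrow> complex \<Rightarrow> complex \<Rightarrow> real^3" where
  "wform m n h = vector
     [Re (\<i> * n\<^sup>2 * h - \<i> * (cnj m)\<^sup>2 * cnj h), Im (\<i> * n\<^sup>2 * h - \<i> * (cnj m)\<^sup>2 * cnj h), 2 * Re (m * n * h)]"

lemma hor_eq_iff: "x = y \<longleftrightarrow> hor x = hor y \<and> x $ 3 = y $ 3"
  by (auto simp: hor_def vec_eq_iff forall_3)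

lemma bounded_linear_hor: "bounded_linear hor"
  by (rule linear_conv_bounded_linear[THEN iffD1], rule linearI)
     (simp_all add: hor_def complex_eq_iff)

lemma hor_wform: "hor (wform m n h) = \<i> * n\<^sup>2 * h - \<i> * (cnj m)\<^sup>2 * cnj h"
  unfolding hor_def wform_def vector_3 complex.collapse ..

lemma wform_3: "wform m n h $ 3 = 2 * Re (m * n * h)"
  by (simp add: wform_def)

lemma hor_add [simp]: "hor (x + y) = hor x + hor y"
  and hor_diff [simp]: "hor (x - y) = hor x - hor y"
  and hor_scaleR [simp]: "hor (c *\<^sub>R x) = of_real c * hor x"
  and hor_0 [simp]: "hor 0 = 0"
  by (simp_all add: hor_def complex_eq_iff)

lemma linear_wform: "linear (wform m n)"
proof (rule linearI)
  fix a b :: complex and r :: real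
  show "wform m n (a + b) = wform m n a + wform m n b"
    unfolding hor_eq_iff by (simp add: hor_wform wform_3 algebra_simps)
  have "Re (m * n * (of_real r * a)) = r * Re (m * n * a)"
    by (simp add: algebra_simps)
  then show "wform m n (r *\<^sub>R a) = r *\<^sub>R wform m n a"
    unfolding hor_eq_iff by (simp add: hor_wform wform_3 scaleR_conv_of_real[where 'a = complex] algebra_simps)
qed

text \<open>The form is conformal with factor \<open>(norm m)\<^sup>2 + (norm n)\<^sup>2\<close>, so
  it degenerates only at a zero of the spinor. By elimination: the horizontal and vertical parts
  together annihilate \<open>n * h * (m * cnj m + n * cnj n)\<close>, and the horizontal part gives
  \<open>m\<close> and \<open>n\<close> equal norms.\<close>

lemma wform_eq_0_imp:
  assumes "wform m n h = 0" "h \<noteq> 0"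
  shows "m = 0 \<and> n = 0"
proof -
  have 1: "n\<^sup>2 * h = (cnj m)\<^sup>2 * cnj h"
  proof -
    have "\<i> * (n\<^sup>2 * h - (cnj m)\<^sup>2 * cnj h) = 0"
      using hor_wform[of m n h] unfolding assms(1) hor_0 by (simp only: right_diff_distrib mult.assoc)
    then show ?thesis by simp
  qed
  have "Re (m * n * h) = 0"
    using wform_3[of m n h] unfolding assms(1) by simp
  then have "m * n * h + cnj (m * n * h) = 0"
    unfolding complex_add_cnj by simp
  then have 3: "m * n * h + cnj m * cnj n * cnj h = 0" by simp
  have "norm (n\<^sup>2 * h) = norm ((cnj m)\<^sup>2 * cnj h)" using 1 by simp
  then have nm: "norm n = norm m"
    using assms(2) by (simp add: norm_mult norm_power)
  have "n * h * (m * cnj m + n * cnj n) = cnj m * (m * n * h) + n\<^sup>2 * h * cnj n"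
    by (simp add: power2_eq_square algebra_simps)
  also have "\<dots> = cnj m * (m * n * h + cnj m * cnj n * cnj h)"
    unfolding 1 by (simp add: power2_eq_square algebra_simps)
  finally have "n * h * (m * cnj m + n * cnj n) = 0" unfolding 3 by simp
  then have "n = 0 \<or> m * cnj m + n * cnj n = 0" using assms(2) by simp
  then show ?thesis
  proof
    assume "m * cnj m + n * cnj n = 0"
    then have "complex_of_real ((norm m)\<^sup>2 + (norm n)\<^sup>2) = 0"
      by (simp only: complex_norm_square of_real_add)
    then have "(norm m)\<^sup>2 + (norm n)\<^sup>2 = 0" unfolding of_real_eq_0_iff .
    then show ?thesis by (simp add: sum_power2_eq_zero_iff)
  qed (use nm in auto)
qed

text \<open>
  Homogeneous form of a plane representation: the arguments are homogeneous coordinates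
  \<open>(p, q)\<close> with \<open>z = p / q\<close>, and \<open>m = \<psi>\<^sub>1 / q\<close>, \<open>n = cnj \<psi>\<^sub>2 / q\<close>. In this form the Dirac and
  Weierstrass equations hold along every holomorphic curve in \<open>\<complex>\<^sup>2 - {0}\<close>, weighted by the
  Wronskian, so that Moebius transformations of the chart and the passage to the cylinder
  are substitutions of curves.
\<close>

locale homogeneous_rep =
  fixes X :: "complex \<times> complex \<Rightarrow> real^3" and m n :: "complex \<times> complex \<Rightarrow> complex"
    and U :: "complex \<times> complex \<Rightarrow> real"
  assumes X_deriv: "\<And>p q p' q' w. \<lbrakk>(p has_field_derivative p') (at w);
      (q has_field_derivative q') (at w); (p w, q w) \<noteq> 0\<rbrakk> \<Longrightarrow>
      ((\<lambda>w. X (p w, q w)) has_derivative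
        (\<lambda>h. wform (m (p w, q w)) (n (p w, q w)) ((p' * q w - p w * q') * h))) (at w)"
    and m_deriv: "\<And>p q p' q' w. \<lbrakk>(p has_field_derivative p') (at w);
      (q has_field_derivative q') (at w); (p w, q w) \<noteq> 0\<rbrakk> \<Longrightarrow>
      \<exists>a. has_wirtinger (\<lambda>w. m (p w, q w)) a
        (U (p w, q w) * cnj (n (p w, q w)) * cnj (p' * q w - p w * q')) w"
    and n_deriv: "\<And>p q p' q' w. \<lbrakk>(p has_field_derivative p') (at w);
      (q has_field_derivative q') (at w); (p w, q w) \<noteq> 0\<rbrakk> \<Longrightarrow>
      \<exists>a. has_wirtinger (\<lambda>w. n (p w, q w)) a
        (- U (p w, q w) * cnj (m (p w, q w)) * cnj (p' * q w - p w * q')) w"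
    and X_hom: "\<And>k p q. k \<noteq> 0 \<Longrightarrow> X (k * p, k * q) = X (p, q)"
    and m_hom: "\<And>k p q. k \<noteq> 0 \<Longrightarrow> m (k * p, k * q) = m (p, q) / k"
    and n_hom: "\<And>k p q. k \<noteq> 0 \<Longrightarrow> n (k * p, k * q) = n (p, q) / k"
    and U_hom: "\<And>k p q. k \<noteq> 0 \<Longrightarrow> U (k * p, k * q) = U (p, q) / (norm k)\<^sup>2"
    and nonzero: "\<And>v. v \<noteq> 0 \<Longrightarrow> m v \<noteq> 0 \<or> n v \<noteq> 0"
    and cont_X: "continuous_on (- {0}) X" and cont_m: "continuous_on (- {0}) m"
    and cont_n: "continuous_on (- {0}) n" and cont_U: "continuous_on (- {0}) U"

section \<open>The Killing field of the rotation\<close>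

text \<open>Rodrigues' formula.\<close>

definition axis_rotation :: "real^3 \<Rightarrow> real \<Rightarrow> real^3 \<Rightarrow> real^3" where
  "axis_rotation d t x = cos t *\<^sub>R x + sin t *\<^sub>R cross3 d x + ((1 - cos t) * (d \<bullet> x)) *\<^sub>R d"

lemma axis_rotation_add:
  assumes "norm d = 1"
  shows "axis_rotation d s (axis_rotation d t x) = axis_rotation d (s + t) x"
proof -
  have d: "d \<bullet> d = 1" using assms by (simp add: dot_square_norm)
  have *: "cross3 d (cross3 d x) = (d \<bullet> x) *\<^sub>R d - x"
    using Lagrange[of d d x] d by simp
  have c: "cross3 d (axis_rotation d t x) = cos t *\<^sub>R cross3 d x + sin t *\<^sub>R ((d \<bullet> x) *\<^sub>R d - x)"
    by (simp add: axis_rotation_def cross_add_right cross_mult_right *)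
  have i: "d \<bullet> axis_rotation d t x = d \<bullet> x"
    by (simp add: axis_rotation_def inner_add_right dot_cross_self d algebra_simps)
  show ?thesis
    unfolding axis_rotation_def[of d s "axis_rotation d t x"] c i
    by (simp add: axis_rotation_def cos_add sin_add scaleR_add_right scaleR_diff_right
        scaleR_add_left scaleR_diff_left algebra_simps)
qed

lemma norm_axis_rotation:
  assumes "norm d = 1"
  shows "norm (axis_rotation d t x) = norm x"
proof -
  have d: "d \<bullet> d = 1" using assms by (simp add: dot_square_norm)
  have s: "(sin t)\<^sup>2 = 1 - (cos t)\<^sup>2" by (simp add: sin_squared_eq)
  have n: "cross3 d x \<bullet> cross3 d x = x \<bullet> x - (d \<bullet> x)\<^sup>2"
    using norm_cross[of d x] assms by (simp add: power2_norm_eq_inner)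
  have "axis_rotation d t x \<bullet> axis_rotation d t x = (cos t)\<^sup>2 * (x \<bullet> x) + (sin t)\<^sup>2 * (cross3 d x \<bullet> cross3 d x)
      + (1 - cos t)\<^sup>2 * (d \<bullet> x)\<^sup>2 + 2 * cos t * (1 - cos t) * (d \<bullet> x)\<^sup>2"
    by (simp add: axis_rotation_def inner_add_left inner_add_right dot_cross_self d inner_commute[of x d]
        inner_commute[of x "cross3 d x"] inner_commute[of d "cross3 d x"] power2_eq_square algebra_simps)
  also have "\<dots> = x \<bullet> x"
    unfolding n s by (simp add: power2_eq_square algebra_simps)
  finally show ?thesis by (simp add: norm_eq)
qed

lemma linear_axis_rotation: "linear (axis_rotation d t)"
  by (rule linearI) (simp_all add: axis_rotation_def cross_add_right cross_mult_right inner_add_right algebra_simps)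

lemma axis_rotation_matrix:
  assumes "norm d = 1"
  obtains R where "rotation_matrix R" "\<And>x. R *v x = axis_rotation d t x"
proof
  let ?M = "\<lambda>t. matrix (axis_rotation d t)"
  have app: "?M t *v x = axis_rotation d t x" for t x
    by (simp add: matrix_works linear_axis_rotation flip: matrix_vector_mult_basis)
  have orth: "orthogonal_matrix (?M t)" for t
    using linear_axis_rotation norm_axis_rotation[OF assms] orthogonal_transformation_matrix orthogonal_transformation
    by blast
  \<comment> \<open>An orthogonal matrix has determinant 1 or -1; the rotation by \<open>t\<close>
    is the square of the rotation by \<open>t / 2\<close>, which excludes -1.\<close>
  have "?M t = ?M (t / 2) ** ?M (t / 2)"
    using matrix_compose[OF linear_axis_rotation linear_axis_rotation, of d "t / 2" d "t / 2"] axis_rotation_add[OF assms, of "t / 2" "t / 2"]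
    by (simp add: o_def)
  then have "det (?M t) = (det (?M (t / 2)))\<^sup>2"
    by (simp add: det_mul power2_eq_square)
  moreover have "(det (?M (t / 2)))\<^sup>2 = 1"
    using det_orthogonal_matrix[OF orth, of "t / 2"] by auto
  ultimately show "rotation_matrix (?M t)"
    by (simp add: rotation_matrix_def orth)
  show "?M t *v x = axis_rotation d t x" for x by (rule app)
qed

lemma bounded_linear_cross3: "bounded_linear (cross3 d)"
  by (rule linear_conv_bounded_linear[THEN iffD1], rule linearI) (simp_all add: cross_add_right cross_mult_right)

text \<open>Supplies the bounded right inverse of the derivative that
  \<open>sussmann_open_mapping\<close> asks for; both spaces have real dimension three.\<close>

lemma linear_bij_real_complex:
  fixes f :: "real \<times> complex \<Rightarrow> real^3"
  assumes "linear f" "inj f"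
  obtains g where "bounded_linear g" "f \<circ> g = id"
proof -
  have "dim (range f) = dim (UNIV :: (real \<times> complex) set)"
    using dim_image_eq[OF assms(1), of UNIV] assms(2) by simp
  then have "range f = UNIV"
    using dim_eq_full[of "range f"] span_eq_iff[of "range f"] linear_subspace_image[OF assms(1) subspace_UNIV]
    by simp
  then show ?thesis
    using linear_surjective_right_inverse[OF assms(1)] that linear_conv_bounded_linear by blast
qed

text \<open>In \<open>rot_inv\<close> the vector \<open>v'\<close> may depend on \<open>t\<close>
  and \<open>v\<close> in any way: the surface is rotated into itself only as a set.\<close>

locale rotational_rep = homogeneous_rep +
  fixes a d :: "real^3"
  assumes d: "norm d = 1"
    and rot_inv: "\<And>t v. v \<noteq> 0 \<Longrightarrow> \<exists>v'. v' \<noteq> 0 \<and> a + axis_rotation d t (X v - a) = X v'"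
begin

definition killing :: "complex \<times> complex \<Rightarrow> real^3" where
  "killing v = cross3 d (X v - a)"

lemma negligible_surface: "negligible (X ` (- {0}))"
proof -
  have "(\<lambda>z. X (z, 1)) differentiable_on UNIV"
    unfolding differentiable_on_def differentiable_def
    using X_deriv[of "\<lambda>z. z" 1 _ "\<lambda>_. 1" 0] by (auto simp: zero_prod_def)
  then have "negligible (range (\<lambda>z. X (z, 1)))"
    by (intro negligible_differentiable_image_lowdim) auto
  then have "negligible (insert (X (1, 0)) (range (\<lambda>z. X (z, 1))))"
    by simp
  moreover have "X ` (- {0}) \<subseteq> insert (X (1, 0)) (range (\<lambda>z. X (z, 1)))"
  proof (rule image_subsetI)
    fix v :: "complex \<times> complex" assume v: "v \<in> - {0}"
    obtain p q where pq: "v = (p, q)" by force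
    show "X v \<in> insert (X (1, 0)) (range (\<lambda>z. X (z, 1)))"
    proof (cases "q = 0")
      case True
      with v X_hom[of p 1 0] show ?thesis by (auto simp: pq zero_prod_def)
    next
      case False
      with X_hom[of q "p / q" 1] show ?thesis by (auto simp: pq)
    qed
  qed
  ultimately show ?thesis using negligible_subset by blast
qed

text \<open>
  Otherwise rotating the surface would sweep out an open set, which is contained in the surface
  itself, a null set.
\<close>

lemma tangent:
  assumes v: "v \<noteq> 0"
  shows "\<exists>h. killing v = wform (m v) (n v) h"
proof (rule ccontr)
  assume no: "\<not> ?thesis"
  obtain p q where pq: "v = (p, q)" by force
  \<comment> \<open>A complex line through \<open>v\<close> in the direction
    \<open>(cnj q, - cnj p)\<close>; its Wronskian is the constant \<open>D\<close>, the squared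
    norm of \<open>v\<close>.\<close>
  define P Q where "P = (\<lambda>z. p + z * cnj q)" and "Q = (\<lambda>z. q - z * cnj p)"
  define D where "D = cnj q * q + p * cnj p"
  have "D = of_real ((norm q)\<^sup>2 + (norm p)\<^sup>2)"
    unfolding D_def of_real_add complex_norm_square by (simp only: mult.commute)
  then have D0: "D \<noteq> 0"
    using v pq by (auto simp: zero_prod_def sum_power2_eq_zero_iff simp del: of_real_add of_real_power)
  have W: "cnj q * Q z - P z * (- cnj p) = D" for z
    by (simp add: P_def Q_def D_def algebra_simps)
  have PQ: "(P z, Q z) \<noteq> 0" for z
    using W[of z] D0 by (auto simp: zero_prod_def)
  define Y where "Y = (\<lambda>z. X (P z, Q z))"
  have dP: "(P has_field_derivative cnj q) (at z)" "(Q has_field_derivative - cnj p) (at z)" for z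
    unfolding P_def Q_def by (auto intro!: derivative_eq_intros)
  have dY: "(Y has_derivative (\<lambda>h. wform (m (P z, Q z)) (n (P z, Q z)) (D * h))) (at z)" for z
    using X_deriv[OF dP PQ] W unfolding Y_def by simp
  have Y0: "Y 0 = X v" "(P 0, Q 0) = v" by (simp_all add: Y_def P_def Q_def pq)
  \<comment> \<open>Rotation angle and surface parameter together. The derivative of
    \<open>G\<close> at the origin is injective because the Killing vector is assumed not to be
    tangent.\<close>
  define G where "G = (\<lambda>x :: real \<times> complex. a + axis_rotation d (fst x) (Y (snd x) - a))"
  have contY: "continuous_on UNIV Y"
    using dY has_derivative_continuous continuous_at_imp_continuous_on by blast
  have contG: "continuous_on UNIV G"
    unfolding G_def axis_rotation_def
    by (intro continuous_intros continuous_on_compose2[OF contY]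
        continuous_on_cross) auto
  define G' where "G' = (\<lambda>x :: real \<times> complex. fst x *\<^sub>R killing v + wform (m v) (n v) (D * snd x))"
  have dYs: "((\<lambda>x. Y (snd x)) has_derivative (\<lambda>x. wform (m v) (n v) (D * snd x))) (at (0, 0))"
    using has_derivative_compose[OF has_derivative_snd[OF has_derivative_ident], of Y _ "(0, 0)" UNIV] dY[of 0] Y0 by simp
  have dC: "((\<lambda>x. cross3 d (Y (snd x) - a)) has_derivative (\<lambda>x. cross3 d (wform (m v) (n v) (D * snd x)))) (at (0, 0))"
    by (rule bounded_linear.has_derivative[OF bounded_linear_cross3])
       (use has_derivative_diff[OF dYs has_derivative_const, of a] in simp)
  have dG: "(G has_derivative G') (at (0, 0))"
    unfolding G_def axis_rotation_def
    by (rule derivative_eq_intros dYs dC refl | simp)+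
       (auto simp: G'_def killing_def Y0 fun_eq_iff)
  have lin: "linear G'" using dG has_derivative_linear by blast
  have "inj G'"
  proof (subst linear_injective_0[OF lin], intro allI impI)
    fix x assume x: "G' x = 0"
    have "fst x = 0"
    proof (rule ccontr)
      assume "fst x \<noteq> 0"
      let ?w = "wform (m v) (n v) (D * snd x)"
      have "fst x *\<^sub>R killing v = - ?w"
        using x unfolding G'_def by (simp add: eq_neg_iff_add_eq_0)
      then have "(1 / fst x) *\<^sub>R (fst x *\<^sub>R killing v) = (1 / fst x) *\<^sub>R (- ?w)" by simp
      then have "killing v = (- 1 / fst x) *\<^sub>R ?w"
        using \<open>fst x \<noteq> 0\<close> by simp
      then have "killing v = wform (m v) (n v) ((- 1 / fst x) *\<^sub>R (D * snd x))"
        using linear_scale[OF linear_wform] by metis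
      with no show False by blast
    qed
    moreover from this have "snd x = 0"
      using x wform_eq_0_imp[of "m v" "n v" "D * snd x"] D0 nonzero[OF v] unfolding G'_def by auto
    ultimately show "x = 0" by (simp add: prod_eq_iff)
  qed
  from linear_bij_real_complex[OF lin this] obtain g where g: "bounded_linear g" "G' \<circ> g = id" .
  \<comment> \<open>Every value of \<open>G\<close> lies on the surface, so an interior point of its
    range contradicts \<open>negligible_surface\<close>.\<close>
  have "G (0, 0) \<in> interior (range G)"
    by (rule sussmann_open_mapping[OF open_UNIV contG UNIV_I dG g]) auto
  moreover have "range G \<subseteq> X ` (- {0})"
    using rot_inv[OF PQ] unfolding G_def Y_def by fastforce
  ultimately have "interior (X ` (- {0})) \<noteq> {}"
    using interior_mono by blast
  moreover have "negligible (interior (X ` (- {0})))"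
    using negligible_surface negligible_subset interior_subset by blast
  ultimately show False
    using open_not_negligible open_interior by blast
qed

end

section \<open>The equations for the coefficient of the Killing field\<close>

lemma hor_cross3: "hor (cross3 d x) = \<i> * of_real (d $ 3) * hor x + Complex (d $ 2) (- (d $ 1)) * of_real (x $ 3)"
  by (rule complex_eqI) (simp_all add: hor_def cross_components)

lemma cross3_3:
  "complex_of_real (cross3 d x $ 3) =
     - (cnj (Complex (d $ 2) (- (d $ 1))) * hor x + Complex (d $ 2) (- d $ 1) * cnj (hor x)) / 2"
  by (rule complex_eqI) (simp_all add: hor_def cross_components)

lemma wform_3_complex: "complex_of_real (wform m n h $ 3) = m * n * h + cnj m * cnj n * cnj h"
proof -
  have "m * n * h + cnj (m * n * h) = complex_of_real (2 * Re (m * n * h))"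
    by (rule complex_add_cnj)
  then show ?thesis by (simp add: wform_3)
qed

lemma hor_deriv:
  assumes "(Y has_derivative (\<lambda>h. wform m n (D * h))) (at w)"
  shows "has_wirtinger (\<lambda>w. hor (Y w)) (\<i> * n\<^sup>2 * D) (- \<i> * (cnj m)\<^sup>2 * cnj D) w"
    and "has_wirtinger (\<lambda>w. of_real (Y w $ 3)) (m * n * D) (cnj m * cnj n * cnj D) w"
proof -
  show "has_wirtinger (\<lambda>w. hor (Y w)) (\<i> * n\<^sup>2 * D) (- \<i> * (cnj m)\<^sup>2 * cnj D) w"
    using bounded_linear.has_derivative[OF bounded_linear_hor assms]
    unfolding has_wirtinger_def hor_wform by (simp add: algebra_simps)
  have "bounded_linear (\<lambda>x :: real^3. complex_of_real (x $ 3))"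
    by (intro bounded_linear_compose[OF bounded_linear_of_real] bounded_linear_vec_nth)
  from bounded_linear.has_derivative[OF this assms]
  show "has_wirtinger (\<lambda>w. of_real (Y w $ 3)) (m * n * D) (cnj m * cnj n * cnj D) w"
    unfolding has_wirtinger_def wform_3_complex by (simp add: algebra_simps)
qed

lemma norm_sum_pos:
  fixes m n :: complex
  assumes "m \<noteq> 0 \<or> n \<noteq> 0"
  shows "m * cnj m + n * cnj n \<noteq> 0"
proof
  assume "m * cnj m + n * cnj n = 0"
  then have "complex_of_real ((norm m)\<^sup>2 + (norm n)\<^sup>2) = 0"
    by (simp only: complex_norm_square of_real_add)
  then have "(norm m)\<^sup>2 + (norm n)\<^sup>2 = 0" unfolding of_real_eq_0_iff .
  then show False using assms by (simp add: sum_power2_eq_zero_iff)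
qed

text \<open>
  The numbered hypotheses are the components of the \<open>z\<close>-bar derivative of \<open>K = \<xi> X\<^sub>z + cnj \<xi> X\<^sub>z\<^sub>b\<^sub>a\<^sub>r\<close>, paired
  with \<open>X\<^sub>z\<^sub>b\<^sub>a\<^sub>r\<close>: this kills everything except \<open>\<partial>\<^sub>z\<^sub>b\<^sub>a\<^sub>r \<xi>\<close>.
\<close>

lemma dbar_xi_zero:
  fixes I M N mb nb x xb xi xib y om be beb u aMb aNb :: complex
  assumes I: "I * I = - 1"
    and 1: "om * mb\<^sup>2 + be * mb * nb = - 2 * I * N * (u * mb) * xi + I * N\<^sup>2 * y - 2 * I * mb * aMb * xib - I * mb\<^sup>2 * xb"
    and 2: "- om * nb\<^sup>2 + beb * mb * nb = 2 * I * M * (u * nb) * xi + I * M\<^sup>2 * y - 2 * I * nb * aNb * xib - I * nb\<^sup>2 * xb"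
    and 3: "(beb * I * mb\<^sup>2 + be * I * nb\<^sup>2) / 2
      = (u * nb) * N * xi - M * (u * mb) * xi + M * N * y + aMb * nb * xib + mb * aNb * xib + mb * nb * xb"
  shows "(M * mb + N * nb)\<^sup>2 * y = 0"
proof -
  have s3: "beb * I * mb\<^sup>2 + be * I * nb\<^sup>2
      = 2 * ((u * nb) * N * xi - M * (u * mb) * xi + M * N * y + aMb * nb * xib + mb * aNb * xib + mb * nb * xb)"
    using 3 by (simp add: field_simps)
  show ?thesis using I 1 2 s3 by algebra
qed

text \<open>
  The numbered hypotheses are the components of the \<open>z\<close> derivative of the same equation at a zero of \<open>\<xi>\<close>,
  and \<open>x\<close> is \<open>\<xi>'\<close>: it is a nonzero eigenvalue of the infinitesimal rotation.
\<close>

lemma discriminant_at_zero: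
  fixes I M N x om be beb :: complex
  assumes I: "I * I = - 1" and unit: "om\<^sup>2 + be * beb = 1" and nz: "M \<noteq> 0 \<or> N \<noteq> 0"
    and 1: "- om * N\<^sup>2 + be * M * N = I * N\<^sup>2 * x"
    and 2: "om * M\<^sup>2 + beb * M * N = I * M\<^sup>2 * x"
    and 3: "- (beb * I * N\<^sup>2 + be * I * M\<^sup>2) / 2 = M * N * x"
  shows "x\<^sup>2 = - 1"
proof (cases "M = 0 \<or> N = 0")
  case True
  then show ?thesis
  proof
    assume "M = 0"
    then have "N \<noteq> 0" "beb * I * N\<^sup>2 = 0" "(- om - I * x) * N\<^sup>2 = 0" using nz 3 1 by (auto simp: algebra_simps)
    then have "beb = 0" "- om - I * x = 0" using I by (auto simp del: right_minus_eq)
    then show ?thesis using unit I by algebra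
  next
    assume "N = 0"
    then have "M \<noteq> 0" "be * I * M\<^sup>2 = 0" "(om - I * x) * M\<^sup>2 = 0" using nz 3 2 by (auto simp: algebra_simps)
    then have "be = 0" "om - I * x = 0" using I by auto
    then show ?thesis using unit I by algebra
  qed
next
  case False
  \<comment> \<open>Without the factors \<open>N\<close> and \<open>M\<close> the first two
    equations are an eigenvalue problem for the vector \<open>(M, N)\<close>, and its determinant
    condition is the claim.\<close>
  have "N * (be * M - (I * x + om) * N) = 0" "M * (beb * N - (I * x - om) * M) = 0"
    using 1 2 by algebra+
  then have "be * M = (I * x + om) * N" "beb * N = (I * x - om) * M"
    using False by auto
  then have "be * beb * (M * N) = (I * x + om) * (I * x - om) * (M * N)"
    by algebra
  then have "be * beb = (I * x + om) * (I * x - om)" using False by simp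
  then show ?thesis using unit I by algebra
qed

context rotational_rep
begin

text \<open>The unit axis in complex form: \<open>om\<close> is its vertical component and
  \<open>be\<close> is \<open>- \<i> * hor d\<close>, as they appear in
  \<open>hor_cross3\<close>.\<close>

abbreviation om :: complex where "om \<equiv> of_real (d $ 3)"
abbreviation be :: complex where "be \<equiv> Complex (d $ 2) (- (d $ 1))"

lemma unit_axis: "om\<^sup>2 + be * cnj be = 1"
proof -
  have "(d $ 1)\<^sup>2 + (d $ 2)\<^sup>2 + (d $ 3)\<^sup>2 = 1"
    using d by (simp add: norm_eq_1 inner_vec_def sum_3 power2_eq_square)
  then have "complex_of_real ((d $ 3)\<^sup>2 + ((d $ 2)\<^sup>2 + (d $ 1)\<^sup>2)) = 1"
    by (metis add.commute add.left_commute of_real_1)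
  moreover have "be * cnj be = of_real ((d $ 2)\<^sup>2 + (d $ 1)\<^sup>2)"
    by (rule complex_eqI) (simp_all add: power2_eq_square)
  ultimately show ?thesis by simp
qed

text \<open>The coefficient of X_z in the Killing field, obtained by pairing with X_zbar: that
  vector is isotropic, so its own contribution drops out. An explicit quotient, unlike a choice of
  the \<open>h\<close> in \<open>tangent\<close>, shows the differentiability.\<close>

definition Xi :: "complex \<times> complex \<Rightarrow> complex" where
  "Xi v = (- \<i> * (cnj (n v))\<^sup>2 * hor (killing v) - \<i> * (cnj (m v))\<^sup>2 * cnj (hor (killing v))
      + 2 * cnj (m v) * cnj (n v) * of_real (killing v $ 3)) / (m v * cnj (m v) + n v * cnj (n v))\<^sup>2"

lemma killing_Xi:
  assumes "v \<noteq> 0"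
  shows "killing v = wform (m v) (n v) (Xi v)"
proof -
  obtain h where h: "killing v = wform (m v) (n v) h"
    using tangent[OF assms] by blast
  have "- \<i> * (cnj (n v))\<^sup>2 * hor (killing v) - \<i> * (cnj (m v))\<^sup>2 * cnj (hor (killing v))
      + 2 * cnj (m v) * cnj (n v) * of_real (killing v $ 3) = h * (m v * cnj (m v) + n v * cnj (n v))\<^sup>2"
    unfolding h hor_wform wform_3_complex by (simp add: power2_eq_square algebra_simps)
  then have "Xi v = h"
    unfolding Xi_def using norm_sum_pos[OF nonzero[OF assms]] by simp
  with h show ?thesis by simp
qed

text \<open>Weight two is the transition rule of a vector field on the projective line, whose
  tangent bundle is O(2). It bounds the degree of the polynomial in
  \<open>Xi_quadratic\<close>.\<close>

lemma Xi_hom: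
  assumes "k \<noteq> 0"
  shows "Xi (k * p, k * q) = k\<^sup>2 * Xi (p, q)"
proof -
  have killing: "killing (k * p, k * q) = killing (p, q)" unfolding killing_def X_hom[OF assms] ..
  have A: "(- \<i> * (N / K)\<^sup>2 * A - \<i> * (M / K)\<^sup>2 * B + 2 * (M / K) * (N / K) * C) / (m * M / (k * K) + n * N / (k * K))\<^sup>2
     = k\<^sup>2 * ((- \<i> * N\<^sup>2 * A - \<i> * M\<^sup>2 * B + 2 * M * N * C) / (m * M + n * N)\<^sup>2)"
    if "K \<noteq> 0" for M N K A B C m n :: complex
  proof -
    have "(m * M / (k * K) + n * N / (k * K))\<^sup>2 = (m * M + n * N)\<^sup>2 / (k\<^sup>2 * K\<^sup>2)"
      by (simp add: power_divide power_mult_distrib flip: add_divide_distrib)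
    moreover have "- \<i> * (N / K)\<^sup>2 * A - \<i> * (M / K)\<^sup>2 * B + 2 * (M / K) * (N / K) * C
        = (- \<i> * N\<^sup>2 * A - \<i> * M\<^sup>2 * B + 2 * M * N * C) / K\<^sup>2"
      by (simp add: power2_eq_square add_divide_distrib diff_divide_distrib)
    ultimately show ?thesis using that assms by simp
  qed
  show ?thesis
    unfolding Xi_def killing m_hom[OF assms] n_hom[OF assms] complex_cnj_divide times_divide_times_eq
    by (rule A) (use assms in simp)
qed

text \<open>The Killing field is affine in \<open>X\<close>, so its derivatives contain the spinor
  but neither the derivatives of the spinor nor the potential. The comparison with the derivatives
  of the formula in \<open>killing_Xi\<close> is therefore informative.\<close>

lemma killing_wirtinger:
  assumes P: "(P has_field_derivative P') (at w)" and Q: "(Q has_field_derivative Q') (at w)"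
    and W: "P' * Q w - P w * Q' = 1"
  shows "has_wirtinger (\<lambda>w. hor (killing (P w, Q w)))
      (- om * (n (P w, Q w))\<^sup>2 + be * (m (P w, Q w) * n (P w, Q w)))
      (om * (cnj (m (P w, Q w)))\<^sup>2 + be * (cnj (m (P w, Q w)) * cnj (n (P w, Q w)))) w"
    and "has_wirtinger (\<lambda>w. of_real (killing (P w, Q w) $ 3))
      (- (cnj be * \<i> * (n (P w, Q w))\<^sup>2 + be * \<i> * (m (P w, Q w))\<^sup>2) / 2)
      ((cnj be * \<i> * (cnj (m (P w, Q w)))\<^sup>2 + be * \<i> * (cnj (n (P w, Q w)))\<^sup>2) / 2) w"
proof -
  have nz: "(P w, Q w) \<noteq> 0" using W by (auto simp: zero_prod_def)
  define M N where "M = m (P w, Q w)" and "N = n (P w, Q w)"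
  define Y where "Y = (\<lambda>w. X (P w, Q w) - a)"
  have dY: "(Y has_derivative (\<lambda>h. wform M N (1 * h))) (at w)"
    using has_derivative_diff[OF X_deriv[OF P Q nz] has_derivative_const[of a]] W
    unfolding Y_def M_def N_def by simp
  note hY = hor_deriv(1)[OF dY] and Y3 = hor_deriv(2)[OF dY]
  have ii: "\<i> * x * (\<i> * y) = - (x * y)" for x y
    by (metis (no_types) complex_i_mult_minus mult.assoc mult.left_commute mult_minus_right)
  have half: "- S / 2 = (- 1 / 2) * S" for S :: complex by simp
  have Heq: "(\<lambda>w. hor (killing (P w, Q w))) = (\<lambda>w. \<i> * om * hor (Y w) + be * of_real (Y w $ 3))"
    and K3eq: "(\<lambda>w. complex_of_real (killing (P w, Q w) $ 3)) = (\<lambda>w. (- 1 / 2) * (cnj be * hor (Y w) + be * cnj (hor (Y w))))"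
    unfolding killing_def hor_cross3 cross3_3 Y_def by (rule refl, rule ext, rule half)
  show "has_wirtinger (\<lambda>w. hor (killing (P w, Q w)))
      (- om * (n (P w, Q w))\<^sup>2 + be * (m (P w, Q w) * n (P w, Q w)))
      (om * (cnj (m (P w, Q w)))\<^sup>2 + be * (cnj (m (P w, Q w)) * cnj (n (P w, Q w)))) w"
    unfolding Heq M_def[symmetric] N_def[symmetric]
    by (rule wirtinger_cong, rule wirtinger_add[OF wirtinger_cmult[OF hY] wirtinger_cmult[OF Y3]]) (simp_all add: ii)
  show "has_wirtinger (\<lambda>w. of_real (killing (P w, Q w) $ 3))
      (- (cnj be * \<i> * (n (P w, Q w))\<^sup>2 + be * \<i> * (m (P w, Q w))\<^sup>2) / 2)
      ((cnj be * \<i> * (cnj (m (P w, Q w)))\<^sup>2 + be * \<i> * (cnj (n (P w, Q w)))\<^sup>2) / 2) w"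
    unfolding K3eq M_def[symmetric] N_def[symmetric]
    by (rule wirtinger_cong, rule wirtinger_cmult[OF wirtinger_add[OF wirtinger_cmult[OF hY] wirtinger_cmult[OF wirtinger_cnj[OF hY]]]])
       (simp_all add: algebra_simps)
qed

text \<open>Holomorphy expresses that an infinitesimal isometry acts conformally. It is found by
  differentiating \<open>killing_Xi\<close> and comparing with
  \<open>killing_wirtinger\<close>.\<close>

lemma Xi_curve:
  assumes P: "\<And>w. (P has_field_derivative P' w) (at w)" and Q: "\<And>w. (Q has_field_derivative Q' w) (at w)"
    and W: "\<And>w. P' w * Q w - P w * Q' w = 1"
  obtains x where "((\<lambda>w. Xi (P w, Q w)) has_field_derivative x) (at w)"
    and "Xi (P w, Q w) = 0 \<Longrightarrow> x\<^sup>2 = - 1"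
proof -
  have nz: "(P w, Q w) \<noteq> 0" for w
    using W[of w] by (auto simp: zero_prod_def)
  define M N where "M = (\<lambda>w. m (P w, Q w))" and "N = (\<lambda>w. n (P w, Q w))"
  define u where "u = complex_of_real (U (P w, Q w))"
  obtain aM where aM: "has_wirtinger M aM (u * cnj (N w)) w"
    using m_deriv[OF P Q nz, of w] W unfolding M_def N_def u_def by auto
  obtain aN where aN: "has_wirtinger N aN (- u * cnj (M w)) w"
    using n_deriv[OF P Q nz, of w] W unfolding M_def N_def u_def by auto
  define H K3 where "H = (\<lambda>w. hor (killing (P w, Q w)))" and "K3 = (\<lambda>w. complex_of_real (killing (P w, Q w) $ 3))"
  have dH: "has_wirtinger H (- om * (N w)\<^sup>2 + be * (M w * N w)) (om * (cnj (M w))\<^sup>2 + be * (cnj (M w) * cnj (N w))) w"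
    and dK3: "has_wirtinger K3 (- (cnj be * \<i> * (N w)\<^sup>2 + be * \<i> * (M w)\<^sup>2) / 2)
      ((cnj be * \<i> * (cnj (M w))\<^sup>2 + be * \<i> * (cnj (N w))\<^sup>2) / 2) w"
    unfolding H_def K3_def M_def N_def by (rule killing_wirtinger[OF P Q W])+
  define xi where "xi = (\<lambda>w. Xi (P w, Q w))"
  \<comment> \<open>The quotient formula gives only the existence of the derivatives; their values
    follow from the comparison below.\<close>
  have "\<exists>x y. has_wirtinger xi x y w"
  proof -
    have D: "M w * cnj (M w) + N w * cnj (N w) \<noteq> 0"
      using norm_sum_pos[OF nonzero[OF nz]] unfolding M_def N_def .
    have "xi = (\<lambda>w. ((- \<i>) * (cnj (N w) * cnj (N w)) * H w - \<i> * (cnj (M w) * cnj (M w)) * cnj (H w)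
      + 2 * (cnj (M w) * cnj (N w)) * K3 w) * inverse ((M w * cnj (M w) + N w * cnj (N w)) * (M w * cnj (M w) + N w * cnj (N w))))"
      unfolding xi_def Xi_def M_def N_def H_def K3_def divide_inverse power2_eq_square by (simp add: mult.assoc)
    moreover have "\<exists>x y. has_wirtinger (\<lambda>w. ((- \<i>) * (cnj (N w) * cnj (N w)) * H w - \<i> * (cnj (M w) * cnj (M w)) * cnj (H w)
      + 2 * (cnj (M w) * cnj (N w)) * K3 w) * inverse ((M w * cnj (M w) + N w * cnj (N w)) * (M w * cnj (M w) + N w * cnj (N w)))) x y w"
      by (rule exI, rule exI)
         (rule wirtinger_mult wirtinger_inverse wirtinger_add wirtinger_diff wirtinger_cnj aM aN dH dK3 wirtinger_const | simp add: D)+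
    ultimately show ?thesis by simp
  qed
  then obtain x y where xy: "has_wirtinger xi x y w" by blast
  have e1: "H = (\<lambda>w. \<i> * (N w * N w) * xi w - \<i> * (cnj (M w) * cnj (M w)) * cnj (xi w))"
    and e2: "K3 = (\<lambda>w. M w * N w * xi w + cnj (M w) * cnj (N w) * cnj (xi w))"
    unfolding H_def K3_def killing_Xi[OF nz] hor_wform wform_3_complex M_def N_def xi_def power2_eq_square by simp_all
  note d1 = wirtinger_diff[OF wirtinger_mult[OF wirtinger_cmult[OF wirtinger_mult[OF aN aN], of \<i>] xy]
      wirtinger_mult[OF wirtinger_cmult[OF wirtinger_mult[OF wirtinger_cnj[OF aM] wirtinger_cnj[OF aM]], of \<i>] wirtinger_cnj[OF xy]], folded e1]
  note d2 = wirtinger_add[OF wirtinger_mult[OF wirtinger_mult[OF aM aN] xy]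
      wirtinger_mult[OF wirtinger_mult[OF wirtinger_cnj[OF aM] wirtinger_cnj[OF aN]] wirtinger_cnj[OF xy]], folded e2]
  note A1 = wirtinger_unique(1)[OF dH d1] and B1 = wirtinger_unique(2)[OF dH d1]
  note A3 = wirtinger_unique(1)[OF dK3 d2] and B3 = wirtinger_unique(2)[OF dK3 d2]
  have ru: "cnj u = u" by (simp add: u_def)
  \<comment> \<open>The premises are the z-bar derivatives of the horizontal component, of its
    conjugate, and of the vertical component; the second one is the conjugate of the z derivative
    \<open>A1\<close>.\<close>
  have "(M w * cnj (M w) + N w * cnj (N w))\<^sup>2 * y = 0"
  proof (rule dbar_xi_zero[of \<i> om "cnj (M w)" be "cnj (N w)" "N w" u "xi w" y "cnj aM" "cnj (xi w)" "cnj x"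
        "cnj be" "M w" "cnj aN"])
    show "\<i> * \<i> = - 1" by simp
    show "om * (cnj (M w))\<^sup>2 + be * cnj (M w) * cnj (N w) =
      - 2 * \<i> * N w * (u * cnj (M w)) * xi w + \<i> * (N w)\<^sup>2 * y - 2 * \<i> * cnj (M w) * cnj aM * cnj (xi w)
      - \<i> * (cnj (M w))\<^sup>2 * cnj x"
      using B1 by (simp add: power2_eq_square algebra_simps)
    show "- om * (cnj (N w))\<^sup>2 + cnj be * cnj (M w) * cnj (N w) =
      2 * \<i> * M w * (u * cnj (N w)) * xi w + \<i> * (M w)\<^sup>2 * y - 2 * \<i> * cnj (N w) * cnj aN * cnj (xi w)
      - \<i> * (cnj (N w))\<^sup>2 * cnj x"
      using arg_cong[OF A1, of cnj] by (simp add: power2_eq_square algebra_simps ru)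
    show "(cnj be * \<i> * (cnj (M w))\<^sup>2 + be * \<i> * (cnj (N w))\<^sup>2) / 2 =
      u * cnj (N w) * N w * xi w - M w * (u * cnj (M w)) * xi w + M w * N w * y +
      cnj aM * cnj (N w) * cnj (xi w) + cnj (M w) * cnj aN * cnj (xi w) + cnj (M w) * cnj (N w) * cnj x"
      using B3 by (simp add: algebra_simps)
  qed
  then have y: "y = 0"
    using norm_sum_pos[OF nonzero[OF nz[of w]]] unfolding M_def N_def by simp
  have "x\<^sup>2 = - 1" if z: "Xi (P w, Q w) = 0"
  proof (rule discriminant_at_zero[of \<i> om be "cnj be" "M w" "N w"])
    have z': "xi w = 0" using z by (simp add: xi_def)
    show "M w \<noteq> 0 \<or> N w \<noteq> 0" using nonzero[OF nz] unfolding M_def N_def .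
    show "- om * (N w)\<^sup>2 + be * M w * N w = \<i> * (N w)\<^sup>2 * x"
      using A1 z' y by (simp add: power2_eq_square algebra_simps)
    show "om * (M w)\<^sup>2 + cnj be * M w * N w = \<i> * (M w)\<^sup>2 * x"
      using arg_cong[OF B1, of cnj] z' y by (simp add: power2_eq_square algebra_simps)
    show "- (cnj be * \<i> * (N w)\<^sup>2 + be * \<i> * (M w)\<^sup>2) / 2 = M w * N w * x"
      using A3 z' y by simp
  qed (use unit_axis in simp_all)
  with xy y that show thesis by (simp add: wirtinger_holomorphic_iff xi_def)
qed

end

section \<open>Spinors on the cylinder\<close>

lemma quadratic_root:
  fixes a b c :: complex
  assumes "a \<noteq> 0"
  obtains z where "a * z\<^sup>2 + b * z + c = 0"
proof
  have s: "(csqrt (b\<^sup>2 - 4 * a * c))\<^sup>2 = b\<^sup>2 - 4 * a * c" by simp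
  define r where "r = csqrt (b\<^sup>2 - 4 * a * c)"
  have "4 * a * (a * ((r - b) / (2 * a))\<^sup>2 + b * ((r - b) / (2 * a)) + c) = r\<^sup>2 - (b\<^sup>2 - 4 * a * c)"
    using assms by (simp add: power2_eq_square field_simps)
  also have "\<dots> = 0" unfolding r_def s by simp
  finally show "a * ((r - b) / (2 * a))\<^sup>2 + b * ((r - b) / (2 * a)) + c = 0"
    using assms by simp
qed

context rotational_rep
begin

text \<open>The quadratic form is half the wedge of \<open>F v\<close> and \<open>v\<close> for the
  trace-free matrix \<open>F\<close> with rows \<open>(x, y)\<close> and \<open>(z, - x)\<close>,
  and the normalization says \<open>F\<^sup>2 = -1\<close>. The second chart controls the growth at
  infinity. The value -1 arises because the discriminant of a quadratic is the square of its
  derivative at a root.\<close>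

lemma Xi_quadratic:
  obtains x y z where "x\<^sup>2 + y * z = - 1"
    and "\<And>p q. (p, q) \<noteq> 0 \<Longrightarrow> Xi (p, q) = (y * q\<^sup>2 + 2 * x * p * q - z * p\<^sup>2) / 2"
proof -
  define f where "f = (\<lambda>w. Xi (w, 1))"
  \<comment> \<open>The chart at infinity, with the signs that give the curve
    \<open>(- 1, w)\<close> the Wronskian 1.\<close>
  define g where "g = (\<lambda>w. Xi (- 1, w))"
  have df: "f field_differentiable (at w)" for w
  proof (rule Xi_curve[of "\<lambda>w. w" "\<lambda>_. 1" "\<lambda>_. 1" "\<lambda>_. 0" w])
    fix x assume "((\<lambda>w. Xi (w, 1)) has_field_derivative x) (at w)"
    then show ?thesis unfolding f_def field_differentiable_def by blast
  qed auto
  have dg: "g field_differentiable (at w)" for w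
  proof (rule Xi_curve[of "\<lambda>_. - 1" "\<lambda>_. 0" "\<lambda>w. w" "\<lambda>_. 1" w])
    fix x assume "((\<lambda>w. Xi (- 1, w)) has_field_derivative x) (at w)"
    then show ?thesis unfolding g_def field_differentiable_def by blast
  qed auto
  have holf: "f holomorphic_on UNIV"
    using df by (simp add: holomorphic_on_def field_differentiable_at_within)
  have contg: "isCont g w" for w
    using dg field_differentiable_imp_continuous_at by blast
  have fg: "f w = w\<^sup>2 * g (- 1 / w)" if "w \<noteq> 0" for w
    using Xi_hom[of "- w" "- 1" "- 1 / w"] that by (simp add: f_def g_def)
  obtain B where B: "\<And>w. norm w \<le> 1 \<Longrightarrow> norm (g w) \<le> B"
  proof -
    have "compact (g ` cball 0 1)"
      using contg by (intro compact_continuous_image continuous_at_imp_continuous_on) auto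
    then obtain B where "\<And>v. v \<in> g ` cball 0 1 \<Longrightarrow> norm v \<le> B"
      using compact_imp_bounded bounded_iff by metis
    then show thesis by (intro that[of B]) auto
  qed
  have "norm (f w) \<le> B * norm w ^ 2" if "1 \<le> norm w" for w
  proof -
    have "w \<noteq> 0" "norm (- 1 / w) \<le> 1" using that by (auto simp: norm_divide divide_le_eq)
    then show ?thesis
      using fg[of w] B[of "- 1 / w"] by (simp add: norm_mult norm_power mult.commute mult_right_mono)
  qed
  from Liouville_polynomial[OF holf this] obtain c where c: "\<And>w. f w = (\<Sum>k\<le>2. c k * w ^ k)"
    by (metis (no_types))
  then have f: "f w = c 0 + c 1 * w + c 2 * w\<^sup>2" for w
    by (simp add: eval_nat_numeral)
  have "g w = c 0 * w\<^sup>2 - c 1 * w + c 2" if "w \<noteq> 0" for w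
    using fg[of "- 1 / w"] that f[of "- 1 / w"] by (simp add: power2_eq_square field_simps)
  then have "eventually (\<lambda>w. c 0 * w\<^sup>2 - c 1 * w + c 2 = g w) (at 0)"
    by (auto simp: eventually_at_filter)
  moreover have "((\<lambda>w. c 0 * w\<^sup>2 - c 1 * w + c 2) \<longlongrightarrow> c 0 * 0\<^sup>2 - c 1 * 0 + c 2) (at 0)"
    by (intro tendsto_intros)
  ultimately have "(g \<longlongrightarrow> c 2) (at 0)"
    using Lim_transform_eventually by fastforce
  then have g0: "g 0 = c 2"
    using contg[of 0] LIM_unique unfolding isCont_def by blast
  have Xi: "Xi (p, q) = c 0 * q\<^sup>2 + c 1 * p * q + c 2 * p\<^sup>2" if "(p, q) \<noteq> 0" for p q
  proof (cases "q = 0")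
    case True
    then have "p \<noteq> 0" using that by (auto simp: zero_prod_def)
    then show ?thesis using Xi_hom[of "- p" "- 1" 0] g0 True by (simp add: g_def)
  next
    case False
    then show ?thesis using Xi_hom[of q "p / q" 1] f[of "p / q"]
      by (simp add: f_def power2_eq_square field_simps)
  qed
  obtain p0 q0 where pq0: "(p0, q0) \<noteq> 0" "c 0 * q0\<^sup>2 + c 1 * p0 * q0 + c 2 * p0\<^sup>2 = 0"
  proof (cases "c 2 = 0")
    case True
    then show thesis using that[of 1 0] by (simp add: zero_prod_def)
  next
    case False
    then obtain z where "c 2 * z\<^sup>2 + c 1 * z + c 0 = 0" using quadratic_root by blast
    then show thesis using that[of z 1] by (simp add: zero_prod_def algebra_simps)
  qed
  \<comment> \<open>A direction for which the line through the root has Wronskian 1, as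
    \<open>Xi_curve\<close> asks.\<close>
  obtain p1 q1 where pq1: "p1 * q0 - p0 * q1 = 1"
  proof (cases "q0 = 0")
    case True
    then show thesis using that[of 0 "- 1 / p0"] pq0 by (simp add: zero_prod_def)
  next
    case False
    then show thesis using that[of "1 / q0" 0] by simp
  qed
  define P Q where "P = (\<lambda>w. p0 + w * p1)" and "Q = (\<lambda>w. q0 + w * q1)"
  have dP: "(P has_field_derivative p1) (at w)" and dQ: "(Q has_field_derivative q1) (at w)" for w
    unfolding P_def Q_def by (auto intro!: derivative_eq_intros)
  have W: "p1 * Q w - P w * q1 = 1" for w
    using pq1 by (simp add: P_def Q_def algebra_simps)
  have nz: "(P w, Q w) \<noteq> 0" for w
    using W[of w] by (auto simp: zero_prod_def)
  obtain x where x: "((\<lambda>w. Xi (P w, Q w)) has_field_derivative x) (at 0)" "x\<^sup>2 = - 1"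
    using Xi_curve[of P "\<lambda>_. p1" Q "\<lambda>_. q1" 0, OF dP dQ W] pq0 Xi[OF nz, of 0]
    by (auto simp: P_def Q_def)
  have "((\<lambda>w. c 0 * (Q w * Q w) + c 1 * P w * Q w + c 2 * (P w * P w)) has_field_derivative
      2 * c 0 * q0 * q1 + c 1 * (p1 * q0 + p0 * q1) + 2 * c 2 * p0 * p1) (at 0)"
    by (rule derivative_eq_intros dP dQ refl)+ (simp add: P_def Q_def algebra_simps)
  moreover have "(\<lambda>w. c 0 * (Q w * Q w) + c 1 * P w * Q w + c 2 * (P w * P w)) = (\<lambda>w. Xi (P w, Q w))"
    unfolding Xi[OF nz] power2_eq_square ..
  ultimately have "x = 2 * c 0 * q0 * q1 + c 1 * (p1 * q0 + p0 * q1) + 2 * c 2 * p0 * p1"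
    using x(1) DERIV_unique by metis
  then have "(c 1)\<^sup>2 + (2 * c 0) * (- 2 * c 2) = - 1"
    using x(2) pq1 pq0(2) by algebra
  then show thesis
    using that[of "c 1" "2 * c 0" "- 2 * c 2"] Xi by (simp add: algebra_simps add_divide_distrib)
qed

end

section \<open>Reduction to the cylinder\<close>

text \<open>
  The Weierstrass and Dirac equations in the variable \<open>w = log z\<close>, for a spinor which also satisfies
  \<open>\<partial>\<^sub>y m = (\<i> / 2) m\<close> and \<open>\<partial>\<^sub>y n = - (\<i> / 2) n\<close> in the direction \<open>y = Im w\<close> of the rotation.
\<close>

definition cylinder_rep :: "(complex \<Rightarrow> real^3) \<Rightarrow> (complex \<Rightarrow> complex) \<Rightarrow> (complex \<Rightarrow> complex) \<Rightarrow>
    (complex \<Rightarrow> real) \<Rightarrow> bool" where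
  "cylinder_rep Y m n U \<longleftrightarrow>
     (\<forall>w. (Y has_derivative wform (m w) (n w)) (at w)) \<and>
     (\<forall>w. has_wirtinger m (m w / 2 + U w * cnj (n w)) (U w * cnj (n w)) w) \<and>
     (\<forall>w. has_wirtinger n (- n w / 2 - U w * cnj (m w)) (- U w * cnj (m w)) w) \<and>
     (\<forall>w. m w \<noteq> 0 \<or> n w \<noteq> 0) \<and>
     (\<forall>y. ((\<lambda>x. m (Complex x y)) \<longlongrightarrow> 0) at_bot \<and> ((\<lambda>x. n (Complex x y)) \<longlongrightarrow> 0) at_bot)"

text \<open>The double cover of the rotation group, acting on spinors. The formula for
  \<open>f\<close> is read off by expanding the transformed form: its components are linear in
  \<open>hor x\<close>, its conjugate and \<open>x $ 3\<close>.\<close>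

lemma SU2_rotation:
  fixes a b :: complex
  assumes ab: "a * cnj a + b * cnj b = 1"
  obtains Q :: "real^3^3" where "orthogonal_matrix Q"
    and "\<And>m n h. Q *v wform m n h = wform (a * m + b * n) (- cnj b * m + cnj a * n) h"
proof -
  define f :: "real^3 \<Rightarrow> real^3" where "f = (\<lambda>x.
     let h = (cnj a)\<^sup>2 * hor x + (cnj b)\<^sup>2 * cnj (hor x) - 2 * \<i> * cnj a * cnj b * of_real (x $ 3);
         t = 2 * Re (- \<i> * cnj a * b * hor x) + (Re (a * cnj a) - Re (b * cnj b)) * x $ 3
     in vector [Re h, Im h, t])"
  have hf: "hor (f x) = (cnj a)\<^sup>2 * hor x + (cnj b)\<^sup>2 * cnj (hor x) - 2 * \<i> * cnj a * cnj b * of_real (x $ 3)" for x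
    unfolding f_def Let_def hor_def vector_3 complex.collapse ..
  have r1: "complex_of_real (2 * Re z) = z + cnj z" for z by (simp add: complex_add_cnj)
  have r2: "complex_of_real (Re (z * cnj z)) = z * cnj z" for z by (rule complex_eqI) simp_all
  have r3: "complex_of_real (s + (t - u) * v) = of_real s + (of_real t - of_real u) * of_real v" for s t u v
    by simp
  have f3: "of_real (f x $ 3) = - \<i> * cnj a * b * hor x + \<i> * a * cnj b * cnj (hor x) + (a * cnj a - b * cnj b) * of_real (x $ 3)" for x
    unfolding f_def Let_def vector_3 r3 r1 r2 by simp
  have eqI: "x = y" if "hor x = hor y" "complex_of_real (x $ 3) = of_real (y $ 3)" for x y
    using that by (simp add: hor_eq_iff)
  have lin: "linear f"
  proof (rule linearI)
    show "f (x + y) = f x + f y" for x y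
      by (rule eqI) (simp_all add: hf f3 algebra_simps)
    show "f (c *\<^sub>R x) = c *\<^sub>R f x" for c x
      by (rule eqI) (simp_all add: hf f3 algebra_simps)
  qed
  have inner: "complex_of_real (x \<bullet> x) = hor x * cnj (hor x) + of_real (x $ 3) * of_real (x $ 3)" for x
    by (rule complex_eqI) (simp_all add: hor_def inner_vec_def sum_3)
  have "norm (f x) = norm x" for x
  proof -
    have id: "(A\<^sup>2 * h + B\<^sup>2 * k - 2 * \<i> * A * B * t) * (a\<^sup>2 * k + b\<^sup>2 * h + 2 * \<i> * a * b * t)
      + (- \<i> * A * b * h + \<i> * a * B * k + (a * A - b * B) * t) * (- \<i> * A * b * h + \<i> * a * B * k + (a * A - b * B) * t)
      = (a * A + b * B)\<^sup>2 * (h * k + t * t)" for A B h k t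
    proof -
      \<comment> \<open>For \<open>algebra\<close> the imaginary unit becomes an indeterminate with
        the single relation \<open>I * I = - 1\<close>.\<close>
      have "I * I = - 1 \<Longrightarrow> (A\<^sup>2 * h + B\<^sup>2 * k - 2 * I * A * B * t) * (a\<^sup>2 * k + b\<^sup>2 * h + 2 * I * a * b * t)
      + (- I * A * b * h + I * a * B * k + (a * A - b * B) * t) * (- I * A * b * h + I * a * B * k + (a * A - b * B) * t)
      = (a * A + b * B)\<^sup>2 * (h * k + t * t)" for I by algebra
      then show ?thesis by simp
    qed
    have "complex_of_real (f x \<bullet> f x) = of_real (x \<bullet> x)"
      unfolding inner hf f3 using id[of "cnj a" "hor x" "cnj b" "cnj (hor x)" "of_real (x $ 3)"] ab by simp
    then show ?thesis by (simp add: norm_eq)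
  qed
  with lin have "orthogonal_matrix (matrix f)"
    using orthogonal_transformation_matrix orthogonal_transformation by blast
  moreover have "matrix f *v wform m n h = wform (a * m + b * n) (- cnj b * m + cnj a * n) h" for m n h
  proof -
    have "matrix f *v wform m n h = f (wform m n h)" by (simp add: lin)
    also have "\<dots> = wform (a * m + b * n) (- cnj b * m + cnj a * n) h"
    proof (rule eqI)
      have ii: "\<i> * (\<i> * z) = - z" for z by (simp flip: mult.assoc)
      show "hor (f (wform m n h)) = hor (wform (a * m + b * n) (- cnj b * m + cnj a * n) h)"
        unfolding hf hor_wform wform_3_complex by (simp add: power2_eq_square algebra_simps ii)
      show "complex_of_real (f (wform m n h) $ 3) = of_real (wform (a * m + b * n) (- cnj b * m + cnj a * n) h $ 3)"
        unfolding f3 hor_wform wform_3_complex by (simp add: power2_eq_square algebra_simps ii)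
    qed
    finally show ?thesis .
  qed
  ultimately show thesis using that by blast
qed

text \<open>The pair is a unit row eigenvector, with eigenvalue 1, of the Hermitian matrix with rows
  \<open>(- om, - cnj be)\<close> and \<open>(- be, om)\<close>, which squares to the identity. As
  the first row of an element of SU(2) it makes the axis vertical. The eigenvector
  \<open>(- be, 1 + om)\<close> has squared norm \<open>2 * (1 + om)\<close> and degenerates for
  \<open>om = - 1\<close>, hence the case distinction.\<close>

lemma SU2_eigenvector:
  fixes om :: real and be :: complex
  assumes "(of_real om)\<^sup>2 + be * cnj be = 1"
  obtains a b where "a * cnj a + b * cnj b = 1" "- a * of_real om - b * be = a" "- a * cnj be + b * of_real om = b"
proof (cases "om = - 1")
  case True
  with assms have "be = 0" by simp
  with True that[of 1 0] show thesis by simp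
next
  case False
  define D where "D = 2 * (1 + om)"
  have bb: "be * cnj be = of_real (1 - om\<^sup>2)"
    using assms by (simp add: eq_diff_eq add.commute)
  have "1 - om\<^sup>2 \<ge> 0"
  proof -
    have "complex_of_real (1 - om\<^sup>2) = of_real ((norm be)\<^sup>2)" using bb complex_norm_square[of be] by simp
    then show ?thesis by (metis of_real_eq_iff zero_le_power2)
  qed
  then have "om\<^sup>2 \<le> 1" by simp
  then have "- 1 \<le> om" by (simp add: abs_square_le_1)
  with False have D: "D > 0" unfolding D_def by simp
  define r where "r = complex_of_real (1 / sqrt D)"
  have r: "r * r = of_real (1 / D)" "cnj r = r"
    using D by (simp_all add: r_def flip: of_real_mult)
  show thesis
  proof (rule that[of "- be * r" "of_real (1 + om) * r"])
    have "(- be * r) * cnj (- be * r) + (of_real (1 + om) * r) * cnj (of_real (1 + om) * r)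
      = (be * cnj be + of_real ((1 + om)\<^sup>2)) * (r * r)"
      by (simp add: r(2) power2_eq_square algebra_simps)
    also have "\<dots> = of_real ((1 - om\<^sup>2 + (1 + om)\<^sup>2) * (1 / D))"
      unfolding bb r of_real_add of_real_mult ..
    also have "(1 - om\<^sup>2 + (1 + om)\<^sup>2) * (1 / D) = 1"
      using D unfolding D_def by (simp add: power2_eq_square field_simps)
    finally show "(- be * r) * cnj (- be * r) + (of_real (1 + om) * r) * cnj (of_real (1 + om) * r) = 1"
      by simp
    show "- (- be * r) * of_real om - (of_real (1 + om) * r) * be = - be * r"
      by (simp add: algebra_simps)
    have "- (- be * r) * cnj be + (of_real (1 + om) * r) * of_real om = (be * cnj be + of_real (om + om\<^sup>2)) * r"
      by (simp add: power2_eq_square algebra_simps)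
    also have "\<dots> = of_real (1 + om) * r"
      unfolding bb by (simp add: algebra_simps)
    finally show "- (- be * r) * cnj be + (of_real (1 + om) * r) * of_real om = of_real (1 + om) * r" .
  qed
qed

text \<open>The numbered hypotheses come from differentiating \<open>N\<^sup>2\<close>,
  \<open>M\<^sup>2\<close> and \<open>M * N\<close>. They combine the two desired equations with
  coefficients \<open>M\<close> and \<open>N\<close>, and the mixed one decides the points where one
  component vanishes.\<close>

lemma spinor_rotation:
  fixes I M N mb nb u om be beb e aM aN aMb :: complex
  assumes I: "I * I = - 1" and e: "e * e = 1" and nz: "M \<noteq> 0 \<or> N \<noteq> 0"
    and 1: "- om * N\<^sup>2 + be * M * N = - e * (2 * N * aN + 2 * mb * u * N)"
    and 2: "om * M\<^sup>2 + beb * M * N = - e * (2 * M * aM - 2 * u * nb * M)"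
    and 3: "- (beb * I * N\<^sup>2 + be * I * M\<^sup>2) / 2 = e * I * (aM * N + M * aN) - e * I * (u * N * nb - u * M * mb)"
  shows "aM = u * nb - e * (om * M + beb * N) / 2 \<and> aN = - u * mb + e * (om * N - be * M) / 2"
proof -
  have t1: "N * (2 * (aN + u * mb) - e * (om * N - be * M)) = 0" using 1 e by algebra
  have t2: "M * (2 * (aM - u * nb) + e * (om * M + beb * N)) = 0" using 2 e by algebra
  have "- (beb * I * N\<^sup>2 + be * I * M\<^sup>2) = 2 * (e * I * (aM * N + M * aN) - e * I * (u * N * nb - u * M * mb))"
    using 3 by (simp add: field_simps)
  then have t3: "N * (2 * (aM - u * nb) + e * (om * M + beb * N)) + M * (2 * (aN + u * mb) - e * (om * N - be * M)) = 0"
    using I e by algebra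
  have "2 * (aN + u * mb) - e * (om * N - be * M) = 0 \<and> 2 * (aM - u * nb) + e * (om * M + beb * N) = 0"
    using t1 t2 t3 nz by (cases "M = 0"; cases "N = 0") auto
  then have "2 * (aN + u * mb) = e * (om * N - be * M)" "2 * (aM - u * nb) = - (e * (om * M + beb * N))"
    by (simp_all only: right_minus_eq eq_neg_iff_add_eq_0)
  then have "aN + u * mb = e * (om * N - be * M) / 2" "aM - u * nb = - (e * (om * M + beb * N)) / 2"
    by (simp_all only: eq_divide_eq_numeral1 mult.commute) auto
  then show ?thesis
    by (simp_all add: eq_diff_eq diff_eq_eq add.commute)
qed

text \<open>
  The curve lies over the cylinder whose ends are the points of the projective line with homogeneous
  coordinates \<open>e1\<close> (for \<open>Re w = \<infinity>\<close>) and \<open>e2\<close>.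
\<close>

definition cyl_curve :: "complex \<times> complex \<Rightarrow> complex \<times> complex \<Rightarrow> complex \<Rightarrow> complex \<times> complex" where
  "cyl_curve e1 e2 w = (exp (w / 2) * fst e1 + exp (- w / 2) * fst e2, exp (w / 2) * snd e1 + exp (- w / 2) * snd e2)"

text \<open>Multiplied by \<open>exp (w / 2)\<close>, the curve converges to \<open>e2\<close>; the
  weight -1 of the spinor turns this factor into decay.\<close>

lemma (in homogeneous_rep) tendsto_cyl_curve:
  assumes "fst e1 * snd e2 - fst e2 * snd e1 = 1"
  shows "((\<lambda>x. m (cyl_curve e1 e2 (Complex x y))) \<longlongrightarrow> 0) at_bot"
    and "((\<lambda>x. n (cyl_curve e1 e2 (Complex x y))) \<longlongrightarrow> 0) at_bot"
proof -
  define v where "v = (\<lambda>x. (exp (Complex x y) * fst e1 + fst e2, exp (Complex x y) * snd e1 + snd e2))"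
  have "((\<lambda>x. norm (exp (Complex x y))) \<longlongrightarrow> 0) at_bot"
    by (simp add: exp_at_bot)
  then have e: "((\<lambda>x. exp (Complex x y)) \<longlongrightarrow> 0) at_bot"
    using tendsto_norm_zero_iff by blast
  have "filterlim (\<lambda>x::real. x / 2) at_bot at_bot"
    by real_asymp
  then have "((\<lambda>x. exp (x / 2)) \<longlongrightarrow> (0::real)) at_bot"
    using filterlim_compose[OF exp_at_bot] by blast
  then have "((\<lambda>x. norm (exp (Complex x y / 2))) \<longlongrightarrow> 0) at_bot"
    by simp
  then have e2': "((\<lambda>x. exp (Complex x y / 2)) \<longlongrightarrow> 0) at_bot"
    using tendsto_norm_zero_iff by blast
  have "(v \<longlongrightarrow> (0 * fst e1 + fst e2, 0 * snd e1 + snd e2)) at_bot"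
    unfolding v_def by (intro tendsto_intros e)
  then have v: "(v \<longlongrightarrow> e2) at_bot" by simp
  have "e2 \<in> - {0}" using assms by auto
  then have "isCont m e2" "isCont n e2"
    using cont_m cont_n continuous_on_eq_continuous_at open_delete[OF open_UNIV]
    by (metis Compl_eq_Diff_UNIV)+
  then have mv: "((\<lambda>x. m (v x)) \<longlongrightarrow> m e2) at_bot" and nv: "((\<lambda>x. n (v x)) \<longlongrightarrow> n e2) at_bot"
    using v isCont_tendsto_compose by blast+
  have c: "cyl_curve e1 e2 w = (exp (- w / 2) * (exp w * fst e1 + fst e2), exp (- w / 2) * (exp w * snd e1 + snd e2))" for w
  proof -
    have "exp (- w / 2) * exp w = exp (w / 2)" by (simp flip: exp_add)
    then show ?thesis unfolding cyl_curve_def by (simp add: distrib_left flip: mult.assoc)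
  qed
  have i: "a / exp (- w / 2) = exp (w / 2) * a" for a w :: complex
    by (simp add: exp_minus field_simps)
  have mc: "m (cyl_curve e1 e2 (Complex x y)) = exp (Complex x y / 2) * m (v x)"
    and nc: "n (cyl_curve e1 e2 (Complex x y)) = exp (Complex x y / 2) * n (v x)" for x
    unfolding c v_def by (subst m_hom n_hom; simp only: i exp_not_eq_zero not_False_eq_True)+
  show "((\<lambda>x. m (cyl_curve e1 e2 (Complex x y))) \<longlongrightarrow> 0) at_bot"
    unfolding mc using tendsto_mult[OF e2' mv] by simp
  show "((\<lambda>x. n (cyl_curve e1 e2 (Complex x y))) \<longlongrightarrow> 0) at_bot"
    unfolding nc using tendsto_mult[OF e2' nv] by simp
qed

text \<open>The ends of the cylinder are the zeros of the Killing field, that is, the eigenvectors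
  of the matrix behind \<open>Xi_quadratic\<close>; in the logarithmic coordinate the field is then
  constant. The sign \<open>e\<close> makes room for exchanging the two ends, which reverses the
  generator.\<close>

lemma (in rotational_rep) cylinder_rep_exists:
  assumes Xi: "\<And>p q. (p, q) \<noteq> 0 \<Longrightarrow> Xi (p, q) = (y * q\<^sup>2 + 2 * x * p * q - z * p\<^sup>2) / 2"
    and det: "fst e1 * snd e2 - fst e2 * snd e1 = 1"
    and e1: "x * fst e1 + y * snd e1 = e * \<i> * fst e1" "z * fst e1 - x * snd e1 = e * \<i> * snd e1"
    and e2: "x * fst e2 + y * snd e2 = - e * \<i> * fst e2" "z * fst e2 - x * snd e2 = - e * \<i> * snd e2"
    and e: "e = 1 \<or> e = - 1"
  obtains A :: "real^3^3" and m' n' where "orthogonal_matrix A"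
    "cylinder_rep (\<lambda>w. A *v X (cyl_curve e1 e2 w)) m' n' (\<lambda>w. U (cyl_curve e1 e2 w))"
proof -
  define P Q where "P = (\<lambda>w. exp (w / 2) * fst e1 + exp (- w / 2) * fst e2)"
    and "Q = (\<lambda>w. exp (w / 2) * snd e1 + exp (- w / 2) * snd e2)"
  define P' Q' where "P' = (\<lambda>w. (exp (w / 2) * fst e1 - exp (- w / 2) * fst e2) / 2)"
    and "Q' = (\<lambda>w. (exp (w / 2) * snd e1 - exp (- w / 2) * snd e2) / 2)"
  have cc: "cyl_curve e1 e2 w = (P w, Q w)" for w by (simp add: cyl_curve_def P_def Q_def)
  have dP: "(P has_field_derivative P' w) (at w)" and dQ: "(Q has_field_derivative Q' w) (at w)" for w
    unfolding P_def Q_def P'_def Q'_def by (auto intro!: derivative_eq_intros simp: field_simps)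
  have ee: "exp (w / 2) * exp (- w / 2) = (1 :: complex)" for w by (simp flip: exp_add)
  have W: "P' w * Q w - P w * Q' w = 1" for w
  proof -
    have "P' w * Q w - P w * Q' w = (exp (w / 2) * exp (- w / 2)) * (fst e1 * snd e2 - fst e2 * snd e1)"
      unfolding P'_def Q'_def P_def Q_def by (simp add: field_simps)
    then show ?thesis unfolding det ee by simp
  qed
  have nz: "(P w, Q w) \<noteq> 0" for w using W[of w] by (auto simp: zero_prod_def)
  have Xi_e: "Xi (P w, Q w) = e * \<i>" for w
  proof -
    \<comment> \<open>Along the curve the matrix acts as \<open>2 * e * \<i>\<close> times
      differentiation, so the quadratic form turns into a multiple of the Wronskian.\<close>
    have "2 * Xi (P w, Q w) = (x * P w + y * Q w) * Q w - P w * (z * P w - x * Q w)"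
      unfolding Xi[OF nz] by (simp add: power2_eq_square field_simps)
    also have "x * P w + y * Q w = exp (w / 2) * (x * fst e1 + y * snd e1) + exp (- w / 2) * (x * fst e2 + y * snd e2)"
      unfolding P_def Q_def by (simp add: algebra_simps)
    also have "\<dots> = 2 * e * \<i> * P' w"
      unfolding e1 e2 P'_def by (simp add: algebra_simps)
    also have "z * P w - x * Q w = exp (w / 2) * (z * fst e1 - x * snd e1) + exp (- w / 2) * (z * fst e2 - x * snd e2)"
      unfolding P_def Q_def by (simp add: algebra_simps)
    also have "\<dots> = 2 * e * \<i> * Q' w"
      unfolding e1 e2 Q'_def by (simp add: algebra_simps)
    also have "2 * e * \<i> * P' w * Q w - P w * (2 * e * \<i> * Q' w) = 2 * e * \<i> * (P' w * Q w - P w * Q' w)"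
      by (simp add: algebra_simps)
    finally show ?thesis unfolding W by simp
  qed
  have er: "cnj e = e" "e * e = 1" using e by auto
  define M N where "M = (\<lambda>w. m (P w, Q w))" and "N = (\<lambda>w. n (P w, Q w))"
  define u where "u = (\<lambda>w. U (P w, Q w))"
  \<comment> \<open>The sign is absorbed into the axis: \<open>om'\<close> and \<open>be'\<close>
    belong to the direction \<open>e\<close> times \<open>d\<close>.\<close>
  define om' where "om' = Re e * d $ 3"
  define be' where "be' = e * be"
  have om': "of_real om' = e * om" using e by (auto simp: om'_def)
  have MN: "has_wirtinger M (u w * cnj (N w) - (of_real om' * M w + cnj be' * N w) / 2) (u w * cnj (N w)) w \<and>
            has_wirtinger N (- u w * cnj (M w) + (of_real om' * N w - be' * M w) / 2) (- u w * cnj (M w)) w" for w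
  proof -
    obtain aM where aM: "has_wirtinger M aM (u w * cnj (N w)) w"
      using m_deriv[OF dP dQ nz, of w] W unfolding M_def N_def u_def by auto
    obtain aN where aN: "has_wirtinger N aN (- u w * cnj (M w)) w"
      using n_deriv[OF dP dQ nz, of w] W unfolding M_def N_def u_def by auto
    define H K3 where "H = (\<lambda>w. hor (killing (P w, Q w)))" and "K3 = (\<lambda>w. complex_of_real (killing (P w, Q w) $ 3))"
    have dH: "has_wirtinger H (- om * (N w)\<^sup>2 + be * (M w * N w)) (om * (cnj (M w))\<^sup>2 + be * (cnj (M w) * cnj (N w))) w"
      and dK3: "has_wirtinger K3 (- (cnj be * \<i> * (N w)\<^sup>2 + be * \<i> * (M w)\<^sup>2) / 2)
        ((cnj be * \<i> * (cnj (M w))\<^sup>2 + be * \<i> * (cnj (N w))\<^sup>2) / 2) w"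
      unfolding H_def K3_def M_def N_def by (rule killing_wirtinger[OF dP dQ W])+
    have e1': "H = (\<lambda>w. (- e) * (N w * N w + cnj (M w) * cnj (M w)))"
      and e2': "K3 = (\<lambda>w. e * \<i> * (M w * N w - cnj (M w) * cnj (N w)))"
      unfolding H_def K3_def killing_Xi[OF nz] Xi_e hor_wform wform_3_complex M_def N_def power2_eq_square
      by (simp_all add: er algebra_simps fun_eq_iff)
    note d1 = wirtinger_cmult[OF wirtinger_add[OF wirtinger_mult[OF aN aN] wirtinger_mult[OF wirtinger_cnj[OF aM] wirtinger_cnj[OF aM]]], of "- e", folded e1']
    note d2 = wirtinger_cmult[OF wirtinger_diff[OF wirtinger_mult[OF aM aN] wirtinger_mult[OF wirtinger_cnj[OF aM] wirtinger_cnj[OF aN]]], of "e * \<i>", folded e2']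
    note A1 = wirtinger_unique(1)[OF dH d1] and B1 = wirtinger_unique(2)[OF dH d1] and A3 = wirtinger_unique(1)[OF dK3 d2]
    note sr = spinor_rotation[of \<i> e "M w" "N w" om be aN "cnj (M w)" "u w" "cnj be" aM "cnj (N w)"]
    have "aM = u w * cnj (N w) - e * (om * M w + cnj be * N w) / 2 \<and>
          aN = - complex_of_real (u w) * cnj (M w) + e * (om * N w - be * M w) / 2"
    proof (rule sr)
      show "\<i> * \<i> = - 1" "e * e = 1" using er by simp_all
      show "M w \<noteq> 0 \<or> N w \<noteq> 0" using nonzero[OF nz] unfolding M_def N_def .
      show "- om * (N w)\<^sup>2 + be * M w * N w = - e * (2 * N w * aN + 2 * cnj (M w) * u w * N w)"
        using A1 by (simp add: power2_eq_square algebra_simps)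
      show "om * (M w)\<^sup>2 + cnj be * M w * N w = - e * (2 * M w * aM - 2 * complex_of_real (u w) * cnj (N w) * M w)"
        using arg_cong[OF B1, of cnj] by (simp add: power2_eq_square algebra_simps er)
      show "- (cnj be * \<i> * (N w)\<^sup>2 + be * \<i> * (M w)\<^sup>2) / 2 =
        e * \<i> * (aM * N w + M w * aN) - e * \<i> * (u w * N w * cnj (N w) - u w * M w * cnj (M w))"
        using A3 by (simp add: algebra_simps)
    qed
    then have "aM = u w * cnj (N w) - (of_real om' * M w + cnj be' * N w) / 2"
      "aN = - u w * cnj (M w) + (of_real om' * N w - be' * M w) / 2"
      unfolding om' be'_def by (simp_all add: er right_diff_distrib distrib_left mult.assoc)
    with aM aN show ?thesis by simp
  qed
  have "(of_real om')\<^sup>2 + be' * cnj be' = e * e * (om\<^sup>2 + be * cnj be)"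
    unfolding om' be'_def by (simp add: er(1) power2_eq_square algebra_simps)
  then have "(of_real om')\<^sup>2 + be' * cnj be' = 1" unfolding unit_axis er by simp
  then obtain \<alpha> b where ab: "\<alpha> * cnj \<alpha> + b * cnj b = 1" "- \<alpha> * of_real om' - b * be' = \<alpha>"
      "- \<alpha> * cnj be' + b * of_real om' = b"
    using SU2_eigenvector by blast
  \<comment> \<open>These coordinates of space diagonalize the terms of the spinor equations that do
    not contain the potential.\<close>
  from SU2_rotation[OF ab(1)] obtain A where A: "orthogonal_matrix A"
    "\<And>m n h. A *v wform m n h = wform (\<alpha> * m + b * n) (- cnj b * m + cnj \<alpha> * n) h" by blast
  define m' n' where "m' = (\<lambda>w. \<alpha> * M w + b * N w)" and "n' = (\<lambda>w. (- cnj b) * M w + cnj \<alpha> * N w)"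
  have "cylinder_rep (\<lambda>w. A *v X (P w, Q w)) m' n' u"
    unfolding cylinder_rep_def
  proof (intro conjI allI)
    fix w
    have "((\<lambda>w. X (P w, Q w)) has_derivative wform (M w) (N w)) (at w)"
      using X_deriv[OF dP dQ nz, of w] W unfolding M_def N_def by simp
    from bounded_linear.has_derivative[OF matrix_vector_mul_bounded_linear this, of A]
    show "((\<lambda>w. A *v X (P w, Q w)) has_derivative wform (m' w) (n' w)) (at w)"
      unfolding A(2) m'_def n'_def .
    show "has_wirtinger m' (m' w / 2 + u w * cnj (n' w)) (u w * cnj (n' w)) w"
      unfolding m'_def
    proof (rule wirtinger_cong[OF wirtinger_add[OF wirtinger_cmult[OF conjunct1[OF MN]] wirtinger_cmult[OF conjunct2[OF MN]]]])
      have "\<alpha> * (u w * cnj (N w) - (of_real om' * M w + cnj be' * N w) / 2) +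
        b * (- u w * cnj (M w) + (of_real om' * N w - be' * M w) / 2)
        = ((- \<alpha> * of_real om' - b * be') * M w + (- \<alpha> * cnj be' + b * of_real om') * N w) / 2
          + u w * cnj (n' w)" by (simp add: n'_def field_simps)
      then show "\<alpha> * (u w * cnj (N w) - (of_real om' * M w + cnj be' * N w) / 2) +
        b * (- u w * cnj (M w) + (of_real om' * N w - be' * M w) / 2)
        = (\<alpha> * M w + b * N w) / 2 + u w * cnj (n' w)" unfolding ab .
    qed (simp add: n'_def algebra_simps)
    show "has_wirtinger n' (- n' w / 2 - u w * cnj (m' w)) (- complex_of_real (u w) * cnj (m' w)) w"
      unfolding n'_def
    proof (rule wirtinger_cong[OF wirtinger_add[OF wirtinger_cmult[OF conjunct1[OF MN]] wirtinger_cmult[OF conjunct2[OF MN]]]])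
      have "(- cnj b) * (u w * cnj (N w) - (of_real om' * M w + cnj be' * N w) / 2) +
        cnj \<alpha> * (- u w * cnj (M w) + (of_real om' * N w - be' * M w) / 2)
        = - (- cnj (- \<alpha> * cnj be' + b * of_real om') * M w + cnj (- \<alpha> * of_real om' - b * be') * N w) / 2
          - u w * cnj (m' w)" by (simp add: m'_def field_simps)
      then show "(- cnj b) * (u w * cnj (N w) - (of_real om' * M w + cnj be' * N w) / 2) +
        cnj \<alpha> * (- u w * cnj (M w) + (of_real om' * N w - be' * M w) / 2)
        = - ((- cnj b) * M w + cnj \<alpha> * N w) / 2 - u w * cnj (m' w)" unfolding ab .
    qed (simp add: m'_def algebra_simps)
    show "m' w \<noteq> 0 \<or> n' w \<noteq> 0"
    proof (rule ccontr)
      assume *: "\<not> ?thesis"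
      have "(\<alpha> * cnj \<alpha> + b * cnj b) * M w = cnj \<alpha> * m' w - b * n' w"
        "(\<alpha> * cnj \<alpha> + b * cnj b) * N w = cnj b * m' w + \<alpha> * n' w"
        by (simp_all add: m'_def n'_def algebra_simps)
      with * have "M w = 0" "N w = 0" unfolding ab by auto
      then show False using nonzero[OF nz, of w] unfolding M_def N_def by simp
    qed
    fix y
    have "((\<lambda>x. M (Complex x y)) \<longlongrightarrow> 0) at_bot" "((\<lambda>x. N (Complex x y)) \<longlongrightarrow> 0) at_bot"
      using tendsto_cyl_curve[OF det, of y] unfolding M_def N_def cc .
    note MN0 = tendsto_mult_right_zero[OF this(1)] tendsto_mult_right_zero[OF this(2)]
    show "((\<lambda>x. m' (Complex x y)) \<longlongrightarrow> 0) at_bot" "((\<lambda>x. n' (Complex x y)) \<longlongrightarrow> 0) at_bot"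
      unfolding m'_def n'_def by (intro tendsto_add_zero MN0)+
  qed
  then show thesis using that A(1) unfolding cc u_def by blast
qed

section \<open>Uniqueness of the spinor on the cylinder\<close>

lemma wirtinger_line:
  assumes f: "\<And>w. has_wirtinger f (a w) (b w) w" and k: "\<And>w. a w * v + b w * cnj v = k * f w"
  shows "f (w + of_real t * v) = exp (k * of_real t) * f w"
proof -
  define g where "g = (\<lambda>t :: real. exp (- k * of_real t) * f (w + of_real t * v))"
  have "(g has_derivative (\<lambda>h. 0)) (at t)" for t
  proof -
    have l: "((\<lambda>t. w + of_real t * v) has_derivative (\<lambda>h. of_real h * v)) (at t)"
      by (auto intro!: derivative_eq_intros)
    have "((\<lambda>t. f (w + of_real t * v)) has_derivative
        (\<lambda>h. of_real h * (k * f (w + of_real t * v)))) (at t)"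
      using has_derivative_compose[OF l f[unfolded has_wirtinger_def]]
      by (rule has_derivative_eq_rhs) (simp add: algebra_simps flip: k)
    moreover have "((\<lambda>t. exp (- k * of_real t)) has_derivative
        (\<lambda>h. of_real h * (- k * exp (- k * of_real t)))) (at t)"
    proof -
      have "((\<lambda>t. - k * complex_of_real t) has_derivative (\<lambda>h. - k * of_real h)) (at t)"
        by (auto intro!: derivative_eq_intros)
      from has_derivative_compose[OF this DERIV_exp[unfolded has_field_derivative_def]]
      show ?thesis by (rule has_derivative_eq_rhs) (simp add: fun_eq_iff)
    qed
    ultimately show ?thesis
      unfolding g_def by (rule has_derivative_eq_rhs[OF has_derivative_mult[rotated]]) (simp add: algebra_simps)
  qed
  then have "g t = g 0" using has_derivative_zero_unique[of UNIV g t 0] by simp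
  then have "exp (k * of_real t) * (exp (- k * of_real t) * f (w + of_real t * v)) = exp (k * of_real t) * f w"
    by (simp add: g_def)
  then show ?thesis by (simp add: exp_minus flip: mult.assoc)
qed

lemma wirtinger_zero_constant:
  assumes "\<And>w. has_wirtinger f 0 0 w"
  shows "f w = f z"
  using has_derivative_zero_unique[of UNIV f w z] assms by (simp add: has_wirtinger_def)

lemma wirtinger_shift:
  assumes "has_wirtinger f a b (w + c)"
  shows "has_wirtinger (\<lambda>w. f (w + c)) a b w"
proof -
  have "((\<lambda>w. w + c) has_field_derivative 1) (at w)"
    by (auto intro!: derivative_eq_intros)
  from wirtinger_compose[OF assms this] show ?thesis by simp
qed

lemma cylinder_repD:
  assumes "cylinder_rep Y m n U"
  shows "(Y has_derivative wform (m w) (n w)) (at w)"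
    and "has_wirtinger m (m w / 2 + U w * cnj (n w)) (U w * cnj (n w)) w"
    and "has_wirtinger n (- n w / 2 - U w * cnj (m w)) (- U w * cnj (m w)) w"
    and "m w \<noteq> 0 \<or> n w \<noteq> 0"
    and "((\<lambda>x. m (Complex x y)) \<longlongrightarrow> 0) at_bot" "((\<lambda>x. n (Complex x y)) \<longlongrightarrow> 0) at_bot"
  using assms unfolding cylinder_rep_def by blast+

text \<open>A translation along the rotation multiplies \<open>m\<close> by a phase and
  \<open>n\<close> by its conjugate. Comparing z-bar derivatives transfers the invariance to
  \<open>U\<close>, because one of the components is nonzero. As \<open>t\<close> is any real
  number, \<open>U\<close> depends only on \<open>Re w\<close>.\<close>

lemma cylinder_rep_potential_periodic:
  assumes c: "cylinder_rep Y m n U"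
  shows "U (w + of_real t * \<i>) = U w"
proof -
  define e where "e = exp (\<i> / 2 * of_real t)"
  have e0: "e \<noteq> 0" by (simp add: e_def)
  have ce: "cnj (exp (- \<i> / 2 * of_real t)) = e"
    by (simp add: e_def exp_cnj)
  have ce': "cnj e = exp (- \<i> / 2 * of_real t)" unfolding ce[symmetric] by simp
  have m: "m (w + of_real t * \<i>) = e * m w" for w
    unfolding e_def by (rule wirtinger_line[OF cylinder_repD(2)[OF c]]) (simp add: algebra_simps)
  have n: "n (w + of_real t * \<i>) = cnj e * n w" for w
    unfolding ce' by (rule wirtinger_line[OF cylinder_repD(3)[OF c]]) (simp add: algebra_simps)
  let ?w = "w + of_real t * \<i>"
  have "U ?w * cnj (n ?w) = e * (U w * cnj (n w))"
    using wirtinger_unique(2)[OF wirtinger_shift[OF cylinder_repD(2)[OF c, of ?w], unfolded m] wirtinger_cmult[OF cylinder_repD(2)[OF c, of w], of e]] .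
  moreover have "- complex_of_real (U ?w) * cnj (m ?w) = cnj e * (- complex_of_real (U w) * cnj (m w))"
    using wirtinger_unique(2)[OF wirtinger_shift[OF cylinder_repD(3)[OF c, of ?w], unfolded n] wirtinger_cmult[OF cylinder_repD(3)[OF c, of w], of "cnj e"]] .
  ultimately have "(complex_of_real (U ?w) - of_real (U w)) * (e * cnj (n w)) = 0"
    "(complex_of_real (U ?w) - of_real (U w)) * (cnj e * cnj (m w)) = 0"
    unfolding m n by (simp_all add: algebra_simps)
  then show ?thesis
    using e0 cylinder_repD(4)[OF c, of w] by auto
qed

lemma cylinder_rep_potential_cnj:
  assumes "cylinder_rep Y m n U"
  shows "U (cnj w) = U w"
proof -
  have "cnj w = w + of_real (- 2 * Im w) * \<i>" by (simp add: complex_eq_iff)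
  then show ?thesis using cylinder_rep_potential_periodic[OF assms] by metis
qed

text \<open>Serves to remove a reflection from the coordinates. The mirror image in the plane
  orthogonal to the first axis, reparametrized by \<open>cnj\<close>, has the conjugate spinor, and
  its potential is the same by \<open>cylinder_rep_potential_cnj\<close>.\<close>

lemma cylinder_rep_reflect:
  obtains S :: "real^3^3" where "orthogonal_matrix S" "det S = - 1"
    "\<And>Y m n U. cylinder_rep Y m n U \<Longrightarrow> \<exists>m' n'. cylinder_rep (\<lambda>w. S *v Y (cnj w)) m' n' U"
proof -
  define f :: "real^3 \<Rightarrow> real^3" where "f = (\<lambda>x. vector [- (x $ 1), x $ 2, x $ 3])"
  have lin: "linear f"
    by (rule linearI) (simp_all add: f_def vec_eq_iff forall_3)
  have app: "matrix f *v x = f x" for x by (simp add: lin)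
  have "norm (f x) = norm x" for x
    by (simp add: norm_eq f_def inner_vec_def sum_3)
  then have 1: "orthogonal_matrix (matrix f)"
    using lin orthogonal_transformation_matrix orthogonal_transformation by blast
  have 2: "det (matrix f) = - 1"
    by (simp add: det_3 matrix_def f_def axis_def)
  have 3: "matrix f *v wform m n (cnj h) = wform (cnj m) (cnj n) h" for m n h
  proof -
    have "hor (f x) = - cnj (hor x)" "f x $ 3 = x $ 3" for x
      by (simp_all add: hor_def f_def complex_eq_iff)
    then show ?thesis
      unfolding app hor_eq_iff by (simp add: hor_wform wform_3 algebra_simps)
  qed
  have "\<exists>m' n'. cylinder_rep (\<lambda>w. matrix f *v Y (cnj w)) m' n' U" if c: "cylinder_rep Y m n U" for Y m n U
  proof (intro exI)
    note Uc = cylinder_rep_potential_cnj[OF c]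
    show "cylinder_rep (\<lambda>w. matrix f *v Y (cnj w)) (\<lambda>w. cnj (m (cnj w))) (\<lambda>w. cnj (n (cnj w))) U"
      unfolding cylinder_rep_def
    proof (intro conjI allI)
      fix w
      have "((\<lambda>w. Y (cnj w)) has_derivative (\<lambda>h. wform (m (cnj w)) (n (cnj w)) (cnj h))) (at w)"
        by (rule has_derivative_compose[OF has_derivative_cnj[OF has_derivative_ident] cylinder_repD(1)[OF c]])
      from bounded_linear.has_derivative[OF matrix_vector_mul_bounded_linear this, of "matrix f"]
      show "((\<lambda>w. matrix f *v Y (cnj w)) has_derivative wform (cnj (m (cnj w))) (cnj (n (cnj w)))) (at w)"
        unfolding 3 .
      show "has_wirtinger (\<lambda>w. cnj (m (cnj w))) (cnj (m (cnj w)) / 2 + U w * cnj (cnj (n (cnj w)))) (U w * cnj (cnj (n (cnj w)))) w"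
        by (rule wirtinger_cong[OF wirtinger_cnj[OF wirtinger_compose_cnj[OF cylinder_repD(2)[OF c, of "cnj w"]]]])
           (simp_all add: Uc)
      show "has_wirtinger (\<lambda>w. cnj (n (cnj w))) (- cnj (n (cnj w)) / 2 - U w * cnj (cnj (m (cnj w)))) (- complex_of_real (U w) * cnj (cnj (m (cnj w)))) w"
        by (rule wirtinger_cong[OF wirtinger_cnj[OF wirtinger_compose_cnj[OF cylinder_repD(3)[OF c, of "cnj w"]]]])
           (simp_all add: Uc)
      show "cnj (m (cnj w)) \<noteq> 0 \<or> cnj (n (cnj w)) \<noteq> 0"
        using cylinder_repD(4)[OF c, of "cnj w"] by simp
      fix y
      have "cnj (Complex x y) = Complex x (- y)" for x by (simp add: complex_eq_iff)
      then show "((\<lambda>x. cnj (m (cnj (Complex x y)))) \<longlongrightarrow> 0) at_bot"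
        "((\<lambda>x. cnj (n (cnj (Complex x y)))) \<longlongrightarrow> 0) at_bot"
        using tendsto_cnj[OF cylinder_repD(5)[OF c, of "- y"]] tendsto_cnj[OF cylinder_repD(6)[OF c, of "- y"]] by simp_all
    qed
  qed
  with 1 2 that show thesis by blast
qed

text \<open>
  The Wronskian of two solutions is constant along the lines \<open>Im w = const\<close> and vanishes at the
  end \<open>Re w = -\<infinity>\<close>. This replaces the asymptotic analysis of the Dirac equation at the end.
\<close>

lemma cylinder_rep_spinor_unique:
  assumes c: "cylinder_rep Y m n U" and c': "cylinder_rep Y' m' n' U"
  obtains l where "l \<noteq> 0" "\<And>w. m' w = l * m w" "\<And>w. n' w = cnj l * n w"
proof -
  define W where "W = (\<lambda>w. m w * cnj (n' w) - m' w * cnj (n w))"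
  note dW = wirtinger_diff[OF wirtinger_mult[OF cylinder_repD(2)[OF c] wirtinger_cnj[OF cylinder_repD(3)[OF c']]]
      wirtinger_mult[OF cylinder_repD(2)[OF c'] wirtinger_cnj[OF cylinder_repD(3)[OF c]]], folded W_def]
  \<comment> \<open>In the real direction \<open>m\<close> and \<open>cnj n\<close> satisfy a linear
    system whose matrix has trace zero.\<close>
  have const: "W (w + of_real t * 1) = exp (0 * of_real t) * W w" for w t
    by (rule wirtinger_line[OF dW]) (simp add: field_simps)
  have W0: "W w = 0" for w
  proof -
    have "W (Complex x (Im w)) = W w" for x
    proof -
      have "Complex x (Im w) = w + of_real (x - Re w) * 1" by (simp add: complex_eq_iff)
      then show ?thesis using const[of w "x - Re w"] by simp
    qed
    moreover have "((\<lambda>x. W (Complex x (Im w))) \<longlongrightarrow> 0 * cnj 0 - 0 * cnj 0) at_bot"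
      unfolding W_def by (intro tendsto_intros cylinder_repD(5,6)[OF c] cylinder_repD(5,6)[OF c'])
    ultimately have "((\<lambda>x::real. W w) \<longlongrightarrow> 0) at_bot" by simp
    then show ?thesis using tendsto_unique[OF trivial_limit_at_bot_linorder tendsto_const] by metis
  qed
  define D where "D = (\<lambda>w. m w * cnj (m w) + n w * cnj (n w))"
  have D0: "D w \<noteq> 0" for w unfolding D_def by (rule norm_sum_pos[OF cylinder_repD(4)[OF c]])
  \<comment> \<open>The ratio of the proportional pairs \<open>(m', cnj n')\<close> and
    \<open>(m, cnj n)\<close>; weighting with the conjugates avoids division by a component that may
    vanish.\<close>
  define l where "l = (\<lambda>w. (m' w * cnj (m w) + cnj (n' w) * n w) * inverse (D w))"
  have lm: "m' w = l w * m w" for w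
  proof -
    have "m' w * D w = (m' w * cnj (m w) + cnj (n' w) * n w) * m w"
      using W0[of w] unfolding D_def W_def by algebra
    then show ?thesis unfolding l_def using D0[of w] by (simp add: field_simps)
  qed
  have ln: "cnj (n' w) = l w * cnj (n w)" for w
  proof -
    have "cnj (n' w) * D w = (m' w * cnj (m w) + cnj (n' w) * n w) * cnj (n w)"
      using W0[of w] unfolding D_def W_def by algebra
    then show ?thesis unfolding l_def using D0[of w] by (simp add: field_simps)
  qed
  \<comment> \<open>Both pairs solve the same equations, which are complex linear in
    \<open>m\<close> and \<open>cnj n\<close>, so the product rule leaves only the derivatives of
    \<open>l\<close>.\<close>
  have "has_wirtinger l 0 0 w" for w
  proof -
    have "\<exists>a b. has_wirtinger l a b w"
      unfolding l_def D_def
      by (rule exI, rule exI)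
         (rule wirtinger_mult wirtinger_inverse wirtinger_add wirtinger_cnj cylinder_repD(2,3)[OF c] cylinder_repD(2,3)[OF c'] D0[unfolded D_def])+
    then obtain a b where ab: "has_wirtinger l a b w" by blast
    have e1: "m' = (\<lambda>w. l w * m w)" and e2: "(\<lambda>w. cnj (n' w)) = (\<lambda>w. l w * cnj (n w))"
      using lm ln by auto
    note d1 = wirtinger_mult[OF ab cylinder_repD(2)[OF c], folded e1]
    note d2 = wirtinger_mult[OF ab wirtinger_cnj[OF cylinder_repD(3)[OF c]], folded e2]
    note u1 = wirtinger_unique[OF cylinder_repD(2)[OF c', of w] d1]
    note u2 = wirtinger_unique[OF wirtinger_cnj[OF cylinder_repD(3)[OF c', of w]] d2]
    have "a * m w = 0" "b * m w = 0" "a * cnj (n w) = 0" "b * cnj (n w) = 0"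
      using u1 u2 lm[of w] ln[of w] by (simp_all add: field_simps)
    then have "a = 0" "b = 0" using cylinder_repD(4)[OF c, of w] by auto
    with ab show ?thesis by simp
  qed
  then have l: "l w = l 0" for w by (rule wirtinger_zero_constant)
  have m': "m' w = l 0 * m w" for w using lm[of w] unfolding l[of w] .
  have n': "n' w = cnj (l 0) * n w" for w
    using arg_cong[OF ln[of w], of cnj] unfolding l[of w] by simp
  have "l 0 \<noteq> 0" using cylinder_repD(4)[OF c', of 0] m' n' by auto
  with m' n' that show thesis by blast
qed

lemma cylinder_rep_unique:
  assumes c: "cylinder_rep Y m n U" and c': "cylinder_rep Y' m' n' U"
  obtains s R b where "0 < s" "rotation_matrix R" "\<And>w. Y' w = s *\<^sub>R (R *v Y w) + b"
proof -
  obtain l where l: "l \<noteq> 0" "\<And>w. m' w = l * m w" "\<And>w. n' w = cnj l * n w"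
    using cylinder_rep_spinor_unique[OF c c'] by blast
  define s where "s = (norm l)\<^sup>2"
  have s: "s > 0" using l by (simp add: s_def)
  have sl: "of_real s = l * cnj l" unfolding s_def by (rule complex_norm_square)
  \<comment> \<open>The scalar \<open>l\<close> multiplies the horizontal form by
    \<open>(cnj l)\<^sup>2\<close> and the vertical one by \<open>l * cnj l\<close>; the argument of
    the first factor is the angle of rotation.\<close>
  define t where "t = Arg ((cnj l)\<^sup>2)"
  have t: "(cnj l)\<^sup>2 = of_real s * cis t"
    using rcis_cmod_Arg[of "(cnj l)\<^sup>2"] by (simp add: rcis_def s_def t_def norm_power)
  define d :: "real^3" where "d = axis 3 1"
  have "norm d = 1" by (simp add: d_def)
  then obtain R where R: "rotation_matrix R" "\<And>x. R *v x = axis_rotation d t x"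
    using axis_rotation_matrix by blast
  have d3: "d $ 1 = 0" "d $ 2 = 0" "d $ 3 = 1" by (simp_all add: d_def axis_def)
  have hR: "hor (R *v x) = cis t * hor x" for x
    unfolding R(2) axis_rotation_def
    by (simp add: hor_cross3 d3 cis.ctr complex_eq_iff) (simp add: hor_def d3)
  have R3: "(R *v x) $ 3 = x $ 3" for x
    unfolding R(2) axis_rotation_def
    by (simp add: cross_components d3 inner_vec_def sum_3 algebra_simps)
  have wf: "wform (m' w) (n' w) h = s *\<^sub>R (R *v wform (m w) (n w) h)" for w h
  proof -
    have "complex_of_real (wform (m' w) (n' w) h $ 3) = of_real ((s *\<^sub>R (R *v wform (m w) (n w) h)) $ 3)"
      by (simp add: wform_3_complex R3 sl l(2,3) algebra_simps)
    moreover have "hor (wform (m' w) (n' w) h) = hor (s *\<^sub>R (R *v wform (m w) (n w) h))"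
    proof -
      have "hor (wform (m' w) (n' w) h) = (cnj l)\<^sup>2 * hor (wform (m w) (n w) h)"
        unfolding hor_wform l(2,3) by (simp add: power_mult_distrib algebra_simps)
      then show ?thesis unfolding t by (simp add: hR algebra_simps)
    qed
    ultimately show ?thesis unfolding hor_eq_iff of_real_eq_iff by blast
  qed
  have "((\<lambda>w. Y' w - s *\<^sub>R (R *v Y w)) has_derivative (\<lambda>h. 0)) (at w)" for w
  proof -
    have "((\<lambda>w. s *\<^sub>R (R *v Y w)) has_derivative (\<lambda>h. s *\<^sub>R (R *v wform (m w) (n w) h))) (at w)"
      by (intro has_derivative_scaleR_right bounded_linear.has_derivative[OF matrix_vector_mul_bounded_linear] cylinder_repD(1)[OF c])
    from has_derivative_diff[OF cylinder_repD(1)[OF c', of w] this] show ?thesis unfolding wf by simp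
  qed
  then have "Y' w - s *\<^sub>R (R *v Y w) = Y' 0 - s *\<^sub>R (R *v Y 0)" for w
    using has_derivative_zero_unique[of UNIV "\<lambda>w. Y' w - s *\<^sub>R (R *v Y w)" w 0] by simp
  then have "Y' w = s *\<^sub>R (R *v Y w) + (Y' 0 - s *\<^sub>R (R *v Y 0))" for w
    by (metis add.commute diff_add_cancel)
  with s R(1) that show thesis by blast
qed

section \<open>Symmetries of the potential\<close>

text \<open>Trace-free matrices, and the elements \<open>c + s F\<close> of the one-parameter groups they generate if \<open>F\<^sup>2 = -1\<close>.\<close>

definition trace_free_act :: "complex \<Rightarrow> complex \<Rightarrow> complex \<Rightarrow> complex \<times> complex \<Rightarrow> complex \<times> complex" where
  "trace_free_act x y z v = (x * fst v + y * snd v, z * fst v - x * snd v)"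

definition elliptic :: "real \<Rightarrow> real \<Rightarrow> complex \<Rightarrow> complex \<Rightarrow> complex \<Rightarrow> complex \<times> complex \<Rightarrow> complex \<times> complex" where
  "elliptic c s x y z v = (of_real c * fst v + of_real s * fst (trace_free_act x y z v), of_real c * snd v + of_real s * snd (trace_free_act x y z v))"

abbreviation wedge :: "complex \<times> complex \<Rightarrow> complex \<times> complex \<Rightarrow> complex" where
  "wedge v w \<equiv> fst v * snd w - fst w * snd v"

text \<open>The determinant of \<open>c + s F\<close> is \<open>c\<^sup>2 + s\<^sup>2\<close>, as
  \<open>F\<close> is trace-free with \<open>F\<^sup>2 = -1\<close>.\<close>

lemma wedge_elliptic:
  assumes "x\<^sup>2 + y * z = - 1" "c\<^sup>2 + s\<^sup>2 = 1"
  shows "wedge (elliptic c s x y z v) (elliptic c s x y z w) = wedge v w"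
proof -
  have "complex_of_real (c\<^sup>2 + s\<^sup>2) = 1" using assms(2) by simp
  then have "(complex_of_real c)\<^sup>2 + (of_real s)\<^sup>2 = 1" by simp
  moreover have "wedge (elliptic c s x y z v) (elliptic c s x y z w)
    = ((of_real c)\<^sup>2 - (of_real s)\<^sup>2 * (x\<^sup>2 + y * z)) * wedge v w"
    by (simp add: elliptic_def trace_free_act_def power2_eq_square algebra_simps)
  ultimately show ?thesis using assms(1) by simp
qed

lemma nonzero_iff_wedge: "v \<noteq> (0 :: complex \<times> complex) \<longleftrightarrow> (\<exists>w. wedge v w \<noteq> 0)"
proof
  assume "v \<noteq> 0"
  then have "fst v \<noteq> 0 \<or> snd v \<noteq> 0" by (auto simp: prod_eq_iff)
  then show "\<exists>w. wedge v w \<noteq> 0"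
  proof
    assume "fst v \<noteq> 0"
    then show ?thesis by (intro exI[of _ "(0, 1)"]) simp
  next
    assume "snd v \<noteq> 0"
    then show ?thesis by (intro exI[of _ "(1, 0)"]) simp
  qed
qed auto

lemma elliptic_nonzero:
  assumes "x\<^sup>2 + y * z = - 1" "c\<^sup>2 + s\<^sup>2 = 1" "v \<noteq> 0"
  shows "elliptic c s x y z v \<noteq> 0"
  using wedge_elliptic[OF assms(1,2)] assms(3) unfolding nonzero_iff_wedge by metis

lemma trace_free_eigenvectors:
  assumes "x\<^sup>2 + y * z = - 1"
  obtains e1 e2 where "wedge e1 e2 = 1"
    "trace_free_act x y z e1 = (\<i> * fst e1, \<i> * snd e1)" "trace_free_act x y z e2 = (- \<i> * fst e2, - \<i> * snd e2)"
proof -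
  have ii: "\<i> * (\<i> * w) = - w" for w by (simp flip: mult.assoc)
  obtain f1 f2 where f: "wedge f1 f2 \<noteq> 0"
    "trace_free_act x y z f1 = (\<i> * fst f1, \<i> * snd f1)" "trace_free_act x y z f2 = (- \<i> * fst f2, - \<i> * snd f2)"
  proof (cases "y = 0")
    case False
    have zy: "z * y = - 1 - x * x" using assms by (simp add: power2_eq_square algebra_simps)
    show thesis
      by (rule that[of "(y, \<i> - x)" "(y, - \<i> - x)"]) (use False zy in \<open>simp_all add: trace_free_act_def algebra_simps ii\<close>)
  next
    case True
    then have "(x - \<i>) * (x + \<i>) = 0" using assms by (simp add: power2_eq_square algebra_simps)
    then consider "x = \<i>" | "x = - \<i>" by (auto simp: eq_neg_iff_add_eq_0)
    then show thesis
    proof cases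
      case 1
      show ?thesis
        by (rule that[of "(2 * \<i>, z)" "(0, 1)"]) (simp_all add: trace_free_act_def 1 True algebra_simps ii)
    next
      case 2
      show ?thesis
        by (rule that[of "(0, 1)" "(- 2 * \<i>, z)"]) (simp_all add: trace_free_act_def 2 True algebra_simps ii)
    qed
  qed
  define D where "D = wedge f1 f2"
  define e1 where "e1 = (fst f1 / D, snd f1 / D)"
  have D: "D \<noteq> 0" using f(1) by (simp add: D_def)
  have "wedge e1 f2 = wedge f1 f2 / D" by (simp add: e1_def diff_divide_distrib)
  then have "wedge e1 f2 = 1" using D unfolding D_def by simp
  moreover have "trace_free_act x y z e1 = (fst (trace_free_act x y z f1) / D, snd (trace_free_act x y z f1) / D)"
    by (simp add: trace_free_act_def e1_def add_divide_distrib diff_divide_distrib)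
  then have "trace_free_act x y z e1 = (\<i> * fst e1, \<i> * snd e1)" unfolding f(2) by (simp add: e1_def)
  ultimately show thesis using that f(3) by blast
qed

lemma cyl_curve_nonzero:
  assumes "wedge e1 e2 = 1"
  shows "cyl_curve e1 e2 w \<noteq> 0"
proof
  assume "cyl_curve e1 e2 w = 0"
  then have "wedge (cyl_curve e1 e2 w) e2 = 0" by simp
  moreover have "wedge (cyl_curve e1 e2 w) e2 = exp (w / 2) * wedge e1 e2"
    by (simp add: cyl_curve_def algebra_simps)
  ultimately show False using assms by simp
qed

text \<open>The logarithm of the quotient of the coordinates of \<open>v\<close> in the basis
  \<open>e1\<close>, \<open>e2\<close> is the point \<open>w\<close> of the cylinder; a vanishing
  coordinate puts \<open>v\<close> on the line of one of the ends.\<close>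

lemma cyl_curve_decomp:
  assumes "wedge e1 e2 = 1"
  obtains k w where "k \<noteq> 0" "v = (k * fst (cyl_curve e1 e2 w), k * snd (cyl_curve e1 e2 w))"
  | k where "v = (k * fst e1, k * snd e1)" | k where "v = (k * fst e2, k * snd e2)"
proof -
  define \<alpha> \<beta> where "\<alpha> = wedge v e2" and "\<beta> = wedge e1 v"
  have "fst v * wedge e1 e2 = \<alpha> * fst e1 + \<beta> * fst e2" "snd v * wedge e1 e2 = \<alpha> * snd e1 + \<beta> * snd e2"
    by (simp_all add: \<alpha>_def \<beta>_def algebra_simps)
  then have v: "v = (\<alpha> * fst e1 + \<beta> * fst e2, \<alpha> * snd e1 + \<beta> * snd e2)"
    using assms by (simp add: prod_eq_iff)
  show thesis
  proof (cases "\<alpha> = 0 \<or> \<beta> = 0")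
    case True
    with v that(2)[of \<alpha>] that(3)[of \<beta>] show thesis by auto
  next
    case False
    define w where "w = Ln (\<alpha> / \<beta>)"
    have w: "exp w = \<alpha> / \<beta>" using False by (simp add: w_def)
    define k where "k = \<alpha> / exp (w / 2)"
    have 1: "k * exp (w / 2) = \<alpha>" by (simp add: k_def)
    have "exp (- w / 2) = exp (w / 2) / exp w" by (simp flip: exp_diff)
    then have 2: "k * exp (- w / 2) = \<beta>" using False unfolding w by (simp add: k_def)
    have "v = (k * fst (cyl_curve e1 e2 w), k * snd (cyl_curve e1 e2 w))"
      unfolding cyl_curve_def fst_conv snd_conv distrib_left mult.assoc[symmetric] 1 2 by (rule v)
    moreover have "k \<noteq> 0" using False by (simp add: k_def)
    ultimately show thesis using that(1) by blast
  qed
qed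

text \<open>In the logarithmic coordinate the group element is the imaginary translation by twice
  its angle, so \<open>cylinder_rep_potential_periodic\<close> applies. At the two ends it
  multiplies by a number of modulus 1, which leaves \<open>U\<close> unchanged by
  \<open>U_hom\<close>.\<close>

lemma (in rotational_rep) potential_elliptic:
  assumes F: "x\<^sup>2 + y * z = - 1"
    and Xi: "\<And>p q. (p, q) \<noteq> 0 \<Longrightarrow> Xi (p, q) = (y * q\<^sup>2 + 2 * x * p * q - z * p\<^sup>2) / 2"
    and cs: "c\<^sup>2 + s\<^sup>2 = 1" and v: "v \<noteq> 0"
  shows "U (elliptic c s x y z v) = U v"
proof -
  obtain e1 e2 where e: "wedge e1 e2 = 1"
    "trace_free_act x y z e1 = (\<i> * fst e1, \<i> * snd e1)" "trace_free_act x y z e2 = (- \<i> * fst e2, - \<i> * snd e2)"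
    using trace_free_eigenvectors[OF F] by blast
  have e': "x * fst e1 + y * snd e1 = 1 * \<i> * fst e1" "z * fst e1 - x * snd e1 = 1 * \<i> * snd e1"
    "x * fst e2 + y * snd e2 = - 1 * \<i> * fst e2" "z * fst e2 - x * snd e2 = - 1 * \<i> * snd e2"
    using e(2,3) by (simp_all add: trace_free_act_def)
  obtain t where t: "c = cos t" "s = sin t" using sincos_total_2pi[OF cs] by metis
  have E: "of_real c + of_real s * \<i> = exp (\<i> * of_real t)" "of_real c - of_real s * \<i> = exp (- (\<i> * of_real t))"
    unfolding t by (simp_all add: complex_eq_iff Re_exp Im_exp)
  have l1: "elliptic c s x y z (k * fst e1, k * snd e1) = (exp (\<i> * of_real t) * (k * fst e1), exp (\<i> * of_real t) * (k * snd e1))" for k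
    using e'(1,2) unfolding E[symmetric] elliptic_def trace_free_act_def by (simp add: algebra_simps) algebra
  have l2: "elliptic c s x y z (k * fst e2, k * snd e2) = (exp (- (\<i> * of_real t)) * (k * fst e2), exp (- (\<i> * of_real t)) * (k * snd e2))" for k
    using e'(3,4) unfolding E[symmetric] elliptic_def trace_free_act_def by (simp add: algebra_simps) algebra
  have add: "elliptic c s x y z (p + p', q + q') = elliptic c s x y z (p, q) + elliptic c s x y z (p', q')" for p q p' q'
    by (simp add: elliptic_def trace_free_act_def algebra_simps)
  have scale: "elliptic c s x y z (k * p, k * q) = (k * fst (elliptic c s x y z (p, q)), k * snd (elliptic c s x y z (p, q)))" for k p q
    by (simp add: elliptic_def trace_free_act_def algebra_simps)
  show ?thesis
  proof (rule cyl_curve_decomp[OF e(1), of v])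
    fix k assume "v = (k * fst e1, k * snd e1)"
    then show ?thesis unfolding l1 using U_hom[of "exp (\<i> * of_real t)"] by (simp add: l1)
  next
    fix k assume "v = (k * fst e2, k * snd e2)"
    then show ?thesis using U_hom[of "exp (- (\<i> * of_real t))"] by (simp add: l2)
  next
    fix k w assume k: "k \<noteq> 0" "v = (k * fst (cyl_curve e1 e2 w), k * snd (cyl_curve e1 e2 w))"
    obtain A :: "real^3^3" and m' n' where A: "orthogonal_matrix A"
      "cylinder_rep (\<lambda>w. A *v X (cyl_curve e1 e2 w)) m' n' (\<lambda>w. U (cyl_curve e1 e2 w))"
      using cylinder_rep_exists[where e = 1, OF Xi e(1) e'] by blast
    have "elliptic c s x y z (cyl_curve e1 e2 w) = cyl_curve e1 e2 (w + of_real (2 * t) * \<i>)"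
    proof -
      have "exp ((w + of_real (2 * t) * \<i>) / 2) = exp (\<i> * of_real t) * exp (w / 2)"
        "exp (- (w + of_real (2 * t) * \<i>) / 2) = exp (- (\<i> * of_real t)) * exp (- w / 2)"
        unfolding exp_add[symmetric] by (rule arg_cong[where f = exp], simp add: field_simps)+
      then show ?thesis unfolding cyl_curve_def add l1 l2 by (simp add: mult.assoc)
    qed
    then have "U (elliptic c s x y z (cyl_curve e1 e2 w)) = U (cyl_curve e1 e2 w)"
      using cylinder_rep_potential_periodic[OF A(2), of w "2 * t"] by simp
    then show ?thesis unfolding k(2) scale U_hom[OF k(1)] by simp
  qed
qed

section \<open>Excluding loxodromic symmetries\<close>

lemma eigenvector_exists:
  fixes k11 k12 k21 k22 :: complex
  assumes "\<mu>\<^sup>2 - (k11 + k22) * \<mu> + (k11 * k22 - k12 * k21) = 0"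
  obtains p q where "(p, q) \<noteq> 0" "k11 * p + k12 * q = \<mu> * p" "k21 * p + k22 * q = \<mu> * q"
proof (cases "k12 = 0 \<and> \<mu> - k11 = 0")
  case False
  show thesis
  proof (rule that[of k12 "\<mu> - k11"])
    show "(k12, \<mu> - k11) \<noteq> 0" using False by (auto simp: zero_prod_def)
    show "k11 * k12 + k12 * (\<mu> - k11) = \<mu> * k12" by (simp add: algebra_simps)
    show "k21 * k12 + k22 * (\<mu> - k11) = \<mu> * (\<mu> - k11)" using assms by algebra
  qed
next
  case k: True
  show thesis
  proof (cases "k21 = 0 \<and> \<mu> - k22 = 0")
    case True
    with k show ?thesis using that[of 1 0] by (simp add: zero_prod_def)
  next
    case False
    show ?thesis
    proof (rule that[of "\<mu> - k22" k21])
      show "(\<mu> - k22, k21) \<noteq> 0" using False by (auto simp: zero_prod_def)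
      show "k11 * (\<mu> - k22) + k12 * k21 = \<mu> * (\<mu> - k22)" using assms by algebra
      show "k21 * (\<mu> - k22) + k22 * k21 = \<mu> * k21" by (simp add: algebra_simps)
    qed
  qed
qed

text \<open>A vanishing potential would make the closed surface minimal. In terms of the spinor:
  \<open>m\<close> and \<open>n\<close> would be entire along a line and tend to zero at infinity by
  their weight -1, hence vanish.\<close>

lemma (in homogeneous_rep) potential_not_zero:
  assumes D: "wedge e1 e2 \<noteq> 0"
  obtains w where "U (w * fst e1 + fst e2, w * snd e1 + snd e2) \<noteq> 0"
proof -
  have False if U0: "\<And>w. U (w * fst e1 + fst e2, w * snd e1 + snd e2) = 0"
  proof -
    define P Q where "P = (\<lambda>w. w * fst e1 + fst e2)" and "Q = (\<lambda>w. w * snd e1 + snd e2)"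
    have dP: "(P has_field_derivative fst e1) (at w)" and dQ: "(Q has_field_derivative snd e1) (at w)" for w
      unfolding P_def Q_def by (auto intro!: derivative_eq_intros)
    have nz: "(P w, Q w) \<noteq> 0" for w
    proof
      assume "(P w, Q w) = 0"
      then have "fst e1 * Q w - snd e1 * P w = 0" by (simp add: zero_prod_def)
      moreover have "fst e1 * Q w - snd e1 * P w = wedge e1 e2" by (simp add: P_def Q_def algebra_simps)
      ultimately show False using D by simp
    qed
    have U: "U (P w, Q w) = 0" for w using U0 by (simp add: P_def Q_def)
    have "e1 \<in> - {0}" using D by auto
    then have cm: "isCont m e1" "isCont n e1"
      using cont_m cont_n continuous_on_eq_continuous_at open_delete[OF open_UNIV]
      by (metis Compl_eq_Diff_UNIV)+
    have lim: "((\<lambda>w. (fst e1 + fst e2 / w, snd e1 + snd e2 / w)) \<longlongrightarrow> e1) at_infinity"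
    proof -
      have "((\<lambda>w. (fst e1 + fst e2 / w, snd e1 + snd e2 / w)) \<longlongrightarrow> (fst e1 + 0, snd e1 + 0)) at_infinity"
        by (intro tendsto_intros tendsto_divide_0[OF tendsto_const] filterlim_ident)
      then show ?thesis by simp
    qed
    have eq: "(P w, Q w) = (w * (fst e1 + fst e2 / w), w * (snd e1 + snd e2 / w))" if "w \<noteq> 0" for w
      using that by (simp add: P_def Q_def algebra_simps)
    have lim0: "((\<lambda>w. g (P w, Q w)) \<longlongrightarrow> 0) at_infinity"
      if "isCont g e1" "\<And>k p q. k \<noteq> 0 \<Longrightarrow> g (k * p, k * q) = g (p, q) / k" for g :: "complex \<times> complex \<Rightarrow> complex"
    proof -
      have "((\<lambda>w. g (fst e1 + fst e2 / w, snd e1 + snd e2 / w) / w) \<longlongrightarrow> 0) at_infinity"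
        by (rule tendsto_divide_0[OF isCont_tendsto_compose[OF that(1) lim] filterlim_ident])
      moreover have "eventually (\<lambda>w. g (fst e1 + fst e2 / w, snd e1 + snd e2 / w) / w = g (P w, Q w)) at_infinity"
        using eventually_not_equal_at_infinity[of 0] by eventually_elim (simp only: eq that(2) not_False_eq_True)
      ultimately show ?thesis by (rule Lim_transform_eventually)
    qed
    have "(\<lambda>w. m (P w, Q w)) holomorphic_on UNIV" "(\<lambda>w. n (P w, Q w)) holomorphic_on UNIV"
      using m_deriv[OF dP dQ nz] n_deriv[OF dP dQ nz] unfolding U
      by (auto simp: holomorphic_on_def field_differentiable_def wirtinger_holomorphic_iff)
    then have "m (P 0, Q 0) = 0" "n (P 0, Q 0) = 0"
      using Liouville_weak_0[OF _ lim0[OF cm(1) m_hom]] Liouville_weak_0[OF _ lim0[OF cm(2) n_hom]] by blast+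
    then show False using nonzero[OF nz, of 0] by simp
  qed
  then show thesis using that by blast
qed

text \<open>A loxodromic symmetry contracts towards a fixed point, and forces the potential to vanish.\<close>

lemma (in homogeneous_rep) symmetry_trace_real:
  assumes det: "k11 * k22 - k12 * k21 = 1"
    and inv: "\<And>p q. (p, q) \<noteq> 0 \<Longrightarrow> U (k11 * p + k12 * q, k21 * p + k22 * q) = U (p, q)"
  shows "Im (k11 + k22) = 0"
proof (rule ccontr)
  assume tr: "Im (k11 + k22) \<noteq> 0"
  define \<tau> where "\<tau> = k11 + k22"
  obtain \<mu>0 where \<mu>0: "1 * \<mu>0\<^sup>2 + (- \<tau>) * \<mu>0 + 1 = 0"
    using quadratic_root[of 1 "- \<tau>" 1] by auto
  have \<mu>0_0: "\<mu>0 \<noteq> 0" using \<mu>0 by auto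
  \<comment> \<open>The two eigenvalues are inverse to each other; on the unit circle they would be
    conjugate and their sum real.\<close>
  have "norm \<mu>0 \<noteq> 1"
  proof
    assume "norm \<mu>0 = 1"
    then have c: "\<mu>0 * cnj \<mu>0 = 1" using complex_norm_square[of \<mu>0] by simp
    have "\<mu>0 * \<tau> = \<mu>0 * (\<mu>0 + cnj \<mu>0)" using \<mu>0 c by algebra
    then have "\<tau> = \<mu>0 + cnj \<mu>0" using \<mu>0_0 by simp
    then show False using tr unfolding \<tau>_def by (metis Im_complex_of_real complex_add_cnj)
  qed
  obtain \<mu> where \<mu>: "\<mu> \<noteq> 0" "norm \<mu> < 1" "\<mu>\<^sup>2 - \<tau> * \<mu> + 1 = 0"
  proof (cases "norm \<mu>0 < 1")
    case True
    then show thesis using that[of \<mu>0] \<mu>0 \<mu>0_0 by simp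
  next
    case False
    with \<open>norm \<mu>0 \<noteq> 1\<close> have "norm (1 / \<mu>0) < 1" by (simp add: norm_divide divide_less_eq)
    moreover have "(1 / \<mu>0)\<^sup>2 - \<tau> * (1 / \<mu>0) + 1 = (1 * \<mu>0\<^sup>2 + (- \<tau>) * \<mu>0 + 1) / \<mu>0\<^sup>2"
      using \<mu>0_0 by (simp add: field_simps power2_eq_square)
    ultimately show thesis using that[of "1 / \<mu>0"] \<mu>0 \<mu>0_0 by simp
  qed
  define \<nu> where "\<nu> = 1 / \<mu>"
  have mn: "\<mu> * \<nu> = 1" "\<nu> \<noteq> 0" using \<mu>(1) by (simp_all add: \<nu>_def)
  have "\<nu>\<^sup>2 * (\<mu>\<^sup>2 - \<tau> * \<mu> + 1) = \<nu>\<^sup>2 - \<tau> * \<nu> + 1" using mn(1) by algebra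
  then have \<nu>: "\<nu>\<^sup>2 - \<tau> * \<nu> + 1 = 0" unfolding \<mu>(3) by simp
  obtain p1 q1 where e1: "(p1, q1) \<noteq> 0" "k11 * p1 + k12 * q1 = \<mu> * p1" "k21 * p1 + k22 * q1 = \<mu> * q1"
    using eigenvector_exists[of \<mu> k11 k22 k12 k21] \<mu>(3) det unfolding \<tau>_def by metis
  obtain p2 q2 where e2: "(p2, q2) \<noteq> 0" "k11 * p2 + k12 * q2 = \<nu> * p2" "k21 * p2 + k22 * q2 = \<nu> * q2"
    using eigenvector_exists[of \<nu> k11 k22 k12 k21] \<nu> det unfolding \<tau>_def by metis
  have "norm \<nu> > 1" using \<mu>(1,2) by (simp add: \<nu>_def norm_divide)
  then have mn_ne: "\<mu> \<noteq> \<nu>" using \<mu>(2) by auto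
  have D: "p1 * q2 - p2 * q1 \<noteq> 0"
  proof
    assume D0: "p1 * q2 - p2 * q1 = 0"
    have "(\<mu> - \<nu>) * (p1 * p2) = 0" "(\<mu> - \<nu>) * (p1 * q2) = 0" "(\<mu> - \<nu>) * (q1 * p2) = 0" "(\<mu> - \<nu>) * (q1 * q2) = 0"
      using e1(2,3) e2(2,3) D0 by algebra+
    then show False using e1(1) e2(1) mn_ne by (auto simp: zero_prod_def)
  qed
  define u where "u = (\<lambda>w. U (w * p1 + p2, w * q1 + q2))"
  have nz: "(w * p1 + p2, w * q1 + q2) \<noteq> 0" for w
  proof
    assume "(w * p1 + p2, w * q1 + q2) = 0"
    then have "p1 * (w * q1 + q2) - q1 * (w * p1 + p2) = 0" by (simp add: zero_prod_def)
    then show False using D by (simp add: algebra_simps)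
  qed
  \<comment> \<open>In the coordinate of the eigenbasis the symmetry maps \<open>w\<close> to
    \<open>\<mu>\<^sup>2 * w\<close>; the common factor \<open>\<nu>\<close> leaves through
    \<open>U_hom\<close>.\<close>
  have step: "u w = (norm \<mu>)\<^sup>2 * u (\<mu>\<^sup>2 * w)" for w
  proof -
    have "(k11 * (w * p1 + p2) + k12 * (w * q1 + q2), k21 * (w * p1 + p2) + k22 * (w * q1 + q2))
      = (\<nu> * (\<mu>\<^sup>2 * w * p1 + p2), \<nu> * (\<mu>\<^sup>2 * w * q1 + q2))"
    proof -
      have "k11 * (w * p1 + p2) + k12 * (w * q1 + q2) = \<nu> * (\<mu>\<^sup>2 * w * p1 + p2)"
        using e1(2) e2(2) mn(1) by algebra
      moreover have "k21 * (w * p1 + p2) + k22 * (w * q1 + q2) = \<nu> * (\<mu>\<^sup>2 * w * q1 + q2)"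
        using e1(3) e2(3) mn(1) by algebra
      ultimately show ?thesis by simp
    qed
    then have "u w = U (\<nu> * (\<mu>\<^sup>2 * w * p1 + p2), \<nu> * (\<mu>\<^sup>2 * w * q1 + q2))"
      using inv[OF nz, of w] by (simp add: u_def)
    also have "\<dots> = u (\<mu>\<^sup>2 * w) / (norm \<nu>)\<^sup>2"
      unfolding U_hom[OF mn(2)] u_def ..
    also have "\<dots> = (norm \<mu>)\<^sup>2 * u (\<mu>\<^sup>2 * w)"
      by (simp add: \<nu>_def norm_divide power_divide)
    finally show ?thesis .
  qed
  have iter: "u w = ((norm \<mu>)\<^sup>2) ^ k * u ((\<mu>\<^sup>2) ^ k * w)" for w k
    by (induction k) (simp_all add: step[of "(\<mu>\<^sup>2) ^ _ * w"] mult.assoc mult.left_commute)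
  have "u w = 0" for w
  proof -
    have "(norm \<mu>)\<^sup>2 < 1" using \<mu>(2) by (simp add: power_less_one_iff)
    then have z: "(\<lambda>k. ((norm \<mu>)\<^sup>2) ^ k) \<longlonglongrightarrow> 0" by (intro LIMSEQ_power_zero) simp
    have "norm (\<mu>\<^sup>2) < 1" using \<open>(norm \<mu>)\<^sup>2 < 1\<close> by (simp add: norm_power)
    then have "(\<lambda>k. (\<mu>\<^sup>2) ^ k * w) \<longlonglongrightarrow> 0 * w" by (intro tendsto_intros LIMSEQ_power_zero)
    then have "(\<lambda>k. (\<mu>\<^sup>2) ^ k * w) \<longlonglongrightarrow> 0" by simp
    moreover have "isCont u 0"
    proof -
      have "continuous_on UNIV u"
        unfolding u_def using nz
        by (intro continuous_on_compose2[OF cont_U] continuous_intros) auto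
      then show ?thesis by (simp add: continuous_on_eq_continuous_at)
    qed
    ultimately have "(\<lambda>k. u ((\<mu>\<^sup>2) ^ k * w)) \<longlonglongrightarrow> u 0"
      using isCont_tendsto_compose by blast
    from tendsto_mult[OF z this] have "(\<lambda>k. u w) \<longlonglongrightarrow> 0" unfolding iter[symmetric] by simp
    then show ?thesis using LIMSEQ_unique tendsto_const by blast
  qed
  then show False
    using potential_not_zero[of "(p1, q1)" "(p2, q2)"] D unfolding u_def by auto
qed

text \<open>
  If \<open>FG + GF = -2c\<close> and \<open>\<gamma>\<^sup>2 = (2c + 1) s\<^sup>2\<close>, then \<open>A = \<gamma> + sF\<close> and \<open>B = \<gamma> + sG\<close> satisfy the braid
  relation \<open>ABA = BAB\<close>, so \<open>AB\<close> conjugates \<open>F\<close> to \<open>G\<close>.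
\<close>

lemma braid_conjugates:
  fixes x y z x' y' z' :: complex
  assumes F: "x\<^sup>2 + y * z = - 1" and G: "x'\<^sup>2 + y' * z' = - 1"
    and tr: "2 * x * x' + y * z' + z * y' = - 2 * of_real c"
    and g: "\<gamma>\<^sup>2 = (2 * c + 1) * s\<^sup>2"
  shows "trace_free_act x' y' z' (elliptic \<gamma> s x y z (elliptic \<gamma> s x' y' z' v)) = elliptic \<gamma> s x y z (elliptic \<gamma> s x' y' z' (trace_free_act x y z v))"
proof -
  have "complex_of_real (\<gamma>\<^sup>2) = of_real ((2 * c + 1) * s\<^sup>2)" using g by simp
  then have g': "(complex_of_real \<gamma>)\<^sup>2 = (2 * of_real c + 1) * (of_real s)\<^sup>2" by simp
  obtain p q where v: "v = (p, q)" by force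
  define C S where "C = complex_of_real \<gamma>" and "S = complex_of_real s"
  define f1 f2 g1 g2 where "f1 = x * p + y * q" and "f2 = z * p - x * q"
    and "g1 = x' * p + y' * q" and "g2 = z' * p - x' * q"
  define \<tau> where "\<tau> = 2 * x * x' + y * z' + z * y'"
  have C: "C\<^sup>2 = (1 - \<tau>) * S\<^sup>2"
    using g' tr by (simp add: C_def S_def \<tau>_def algebra_simps)
  \<comment> \<open>For trace-free matrices \<open>F G + G F\<close> is the scalar
    \<open>\<tau>\<close>, which reduces the words \<open>F G F\<close> and \<open>G F G\<close>;
    here they are applied to \<open>v\<close>.\<close>
  have fgf: "x * (x' * f1 + y' * f2) + y * (z' * f1 - x' * f2) = \<tau> * f1 - (x\<^sup>2 + y * z) * g1"
    "z * (x' * f1 + y' * f2) - x * (z' * f1 - x' * f2) = \<tau> * f2 - (x\<^sup>2 + y * z) * g2"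
    by (simp_all add: f1_def f2_def g1_def g2_def \<tau>_def power2_eq_square algebra_simps)
  have gfg: "x' * (x * g1 + y * g2) + y' * (z * g1 - x * g2) = \<tau> * g1 - (x'\<^sup>2 + y' * z') * f1"
    "z' * (x * g1 + y * g2) - x' * (z * g1 - x * g2) = \<tau> * g2 - (x'\<^sup>2 + y' * z') * f2"
    by (simp_all add: f1_def f2_def g1_def g2_def \<tau>_def power2_eq_square algebra_simps)
  have ff: "x * f1 + y * f2 = (x\<^sup>2 + y * z) * p" "z * f1 - x * f2 = (x\<^sup>2 + y * z) * q"
    and gg: "x' * g1 + y' * g2 = (x'\<^sup>2 + y' * z') * p" "z' * g1 - x' * g2 = (x'\<^sup>2 + y' * z') * q"
    by (simp_all add: f1_def f2_def g1_def g2_def power2_eq_square algebra_simps)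
  have gf: "x' * (C * (C * p + S * g1) + S * (x * (C * p + S * g1) + y * (C * q + S * g2)))
      + y' * (C * (C * q + S * g2) + S * (z * (C * p + S * g1) - x * (C * q + S * g2)))
      = C\<^sup>2 * g1 + C * S * (x' * g1 + y' * g2) + C * S * (x' * f1 + y' * f2)
        + S\<^sup>2 * (x' * (x * g1 + y * g2) + y' * (z * g1 - x * g2))"
    "z' * (C * (C * p + S * g1) + S * (x * (C * p + S * g1) + y * (C * q + S * g2)))
      - x' * (C * (C * q + S * g2) + S * (z * (C * p + S * g1) - x * (C * q + S * g2)))
      = C\<^sup>2 * g2 + C * S * (z' * g1 - x' * g2) + C * S * (z' * f1 - x' * f2)
        + S\<^sup>2 * (z' * (x * g1 + y * g2) - x' * (z * g1 - x * g2))"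
    by (simp_all add: f1_def f2_def g1_def g2_def power2_eq_square algebra_simps)
  have fg: "C * (C * f1 + S * (x' * f1 + y' * f2)) + S * (x * (C * f1 + S * (x' * f1 + y' * f2)) + y * (C * f2 + S * (z' * f1 - x' * f2)))
      = C\<^sup>2 * f1 + C * S * (x * f1 + y * f2) + C * S * (x' * f1 + y' * f2)
        + S\<^sup>2 * (x * (x' * f1 + y' * f2) + y * (z' * f1 - x' * f2))"
    "C * (C * f2 + S * (z' * f1 - x' * f2)) + S * (z * (C * f1 + S * (x' * f1 + y' * f2)) - x * (C * f2 + S * (z' * f1 - x' * f2)))
      = C\<^sup>2 * f2 + C * S * (z * f1 - x * f2) + C * S * (z' * f1 - x' * f2)
        + S\<^sup>2 * (z * (x' * f1 + y' * f2) - x * (z' * f1 - x' * f2))"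
    by (simp_all add: power2_eq_square algebra_simps)
  show ?thesis
    unfolding v elliptic_def trace_free_act_def fst_conv snd_conv C_def[symmetric] S_def[symmetric] prod.inject
      f1_def[symmetric] f2_def[symmetric] g1_def[symmetric] g2_def[symmetric]
      gf fg ff gg fgf gfg F G C
    by (simp add: algebra_simps)
qed

section \<open>Plane representations\<close>

lemma wform_divide:
  assumes "q \<noteq> 0"
  shows "wform (m / q) (n / q) h = wform m n (h / q\<^sup>2)"
proof -
  have "hor (wform (m / q) (n / q) h) = hor (wform m n (h / q\<^sup>2))"
    unfolding hor_wform using assms by (simp add: power_divide)
  moreover have "wform (m / q) (n / q) h $ 3 = wform m n (h / q\<^sup>2) $ 3"
    unfolding wform_3 using assms by (simp add: power2_eq_square)
  ultimately show ?thesis unfolding hor_eq_iff by blast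
qed

text \<open>The derivative of \<open>p / q\<close> is the Wronskian divided by
  \<open>q\<^sup>2\<close>, and the holomorphic factor \<open>1 / q\<close> has no z-bar derivative.
  The powers of \<open>q\<close> combine into the weights of the homogeneous data.\<close>

lemma chart_curve:
  assumes Y: "\<And>z. (Y has_derivative wform (M z) (N z)) (at z)"
    and M: "\<And>z. \<exists>a. has_wirtinger M a (of_real (U z) * cnj (N z)) z"
    and N: "\<And>z. \<exists>a. has_wirtinger N a (- of_real (U z) * cnj (M z)) z"
    and p: "(p has_field_derivative p') (at w)" and q: "(q has_field_derivative q') (at w)" and q0: "q w \<noteq> 0"
  shows "((\<lambda>w. Y (p w / q w)) has_derivative
      (\<lambda>h. wform (M (p w / q w) / q w) (N (p w / q w) / q w) ((p' * q w - p w * q') * h))) (at w)"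
    and "\<exists>a. has_wirtinger (\<lambda>w. M (p w / q w) / q w) a (of_real (U (p w / q w) / (norm (q w))\<^sup>2)
      * cnj (N (p w / q w) / q w) * cnj (p' * q w - p w * q')) w"
    and "\<exists>a. has_wirtinger (\<lambda>w. N (p w / q w) / q w) a (- of_real (U (p w / q w) / (norm (q w))\<^sup>2)
      * cnj (M (p w / q w) / q w) * cnj (p' * q w - p w * q')) w"
proof -
  let ?D = "p' * q w - p w * q'" and ?z = "p w / q w"
  have pq: "((\<lambda>w. p w / q w) has_field_derivative ?D / (q w)\<^sup>2) (at w)"
    using DERIV_divide[OF p q q0] by (simp add: power2_eq_square)
  show "((\<lambda>w. Y (p w / q w)) has_derivative (\<lambda>h. wform (M ?z / q w) (N ?z / q w) (?D * h))) (at w)"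
    using has_derivative_compose[OF pq[unfolded has_field_derivative_def] Y]
    unfolding wform_divide[OF q0] by simp
  have iq: "has_wirtinger (\<lambda>w. inverse (q w)) (- (inverse (q w) * q' * inverse (q w))) 0 w"
    unfolding wirtinger_holomorphic_iff by (rule DERIV_inverse'[OF q q0])
  have n2: "complex_of_real ((norm (q w))\<^sup>2) = q w * cnj (q w)"
    by (rule complex_norm_square)
  obtain a where "has_wirtinger M a (of_real (U ?z) * cnj (N ?z)) ?z" using M by blast
  from wirtinger_mult[OF wirtinger_compose[where g = "\<lambda>w. p w / q w", OF this pq] iq]
  show "\<exists>a. has_wirtinger (\<lambda>w. M (p w / q w) / q w) a (of_real (U ?z / (norm (q w))\<^sup>2) * cnj (N ?z / q w) * cnj ?D) w"
    unfolding divide_inverse[symmetric] of_real_divide n2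
    by - (rule exI, erule wirtinger_cong[OF _ refl], use q0 in \<open>simp add: field_simps power2_eq_square\<close>)
  obtain b where "has_wirtinger N b (- of_real (U ?z) * cnj (M ?z)) ?z" using N by blast
  from wirtinger_mult[OF wirtinger_compose[where g = "\<lambda>w. p w / q w", OF this pq] iq]
  show "\<exists>a. has_wirtinger (\<lambda>w. N (p w / q w) / q w) a (- of_real (U ?z / (norm (q w))\<^sup>2) * cnj (M ?z / q w) * cnj ?D) w"
    unfolding divide_inverse[symmetric] of_real_divide n2
    by - (rule exI, erule wirtinger_cong[OF _ refl], use q0 in \<open>simp add: field_simps power2_eq_square\<close>)
qed

section \<open>From line integrals and Dirac equations to derivatives\<close>

lemma smooth_on_differentiable: "smooth_on f S \<Longrightarrow> x \<in> S \<Longrightarrow> f differentiable (at x)"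
  unfolding smooth_on_def by (metis Ck_on.simps(2))

lemma smooth_on_continuous_derivative:
  "smooth_on f S \<Longrightarrow> continuous_on S (\<lambda>x. frechet_derivative f (at x) v)"
  unfolding smooth_on_def by (metis Ck_on.simps)

lemma frechet_derivative_component:
  fixes \<psi> :: "complex \<Rightarrow> complex^2"
  assumes "\<psi> differentiable (at z)"
  shows "(\<lambda>z. \<psi> z $ i) differentiable (at z)"
    and "frechet_derivative (\<lambda>z. \<psi> z $ i) (at z) v = frechet_derivative \<psi> (at z) v $ i"
proof -
  have "((\<lambda>z. \<psi> z $ i) has_derivative (\<lambda>v. frechet_derivative \<psi> (at z) v $ i)) (at z)"
    using assms bounded_linear.has_derivative[OF bounded_linear_vec_nth] frechet_derivative_works by blast
  then show "(\<lambda>z. \<psi> z $ i) differentiable (at z)"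
    "frechet_derivative (\<lambda>z. \<psi> z $ i) (at z) v = frechet_derivative \<psi> (at z) v $ i"
    using differentiableI frechet_derivative_at by (blast, metis)
qed

lemma dirac_components:
  assumes "dirac U \<psi> z = 0"
  shows "d_z (\<lambda>z. \<psi> z $ 2) z = - of_real (U z) * \<psi> z $ 1" "d_zbar (\<lambda>z. \<psi> z $ 1) z = of_real (U z) * \<psi> z $ 2"
  using assms unfolding dirac_def vec_eq_iff forall_2
  by (simp_all add: eq_neg_iff_add_eq_0 algebra_simps)

lemma dirac_wirtinger:
  assumes s: "smooth_on \<psi> UNIV" and d: "\<And>z. dirac U \<psi> z = 0"
  shows "\<exists>a. has_wirtinger (\<lambda>z. \<psi> z $ 1) a (of_real (U z) * cnj (cnj (\<psi> z $ 2))) z"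
    and "\<exists>a. has_wirtinger (\<lambda>z. cnj (\<psi> z $ 2)) a (- of_real (U z) * cnj (\<psi> z $ 1)) z"
proof -
  have diff: "(\<lambda>z. \<psi> z $ i) differentiable (at z)" for i z
    using frechet_derivative_component(1)[OF smooth_on_differentiable[OF s UNIV_I]] .
  show "\<exists>a. has_wirtinger (\<lambda>z. \<psi> z $ 1) a (of_real (U z) * cnj (cnj (\<psi> z $ 2))) z"
    using wirtinger_dz[OF diff[of 1]] unfolding dirac_components(2)[OF d] complex_cnj_cnj by blast
  have "cnj (- of_real (U z) * \<psi> z $ 1) = - of_real (U z) * cnj (\<psi> z $ 1)" by simp
  then show "\<exists>a. has_wirtinger (\<lambda>z. cnj (\<psi> z $ 2)) a (- of_real (U z) * cnj (\<psi> z $ 1)) z"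
    using wirtinger_cnj[OF wirtinger_dz[OF diff[of 2]]] unfolding dirac_components(1)[OF d] by metis
qed

text \<open>The definition of a representation states no regularity of \<open>U\<close>. Pairing the
  Dirac equations with the conjugate spinor recovers \<open>U\<close> as a quotient whose
  denominator is the squared norm of the spinor.\<close>

lemma dirac_potential_continuous:
  assumes s: "smooth_on \<psi> UNIV" and d: "\<And>z. dirac U \<psi> z = 0"
    and nz: "\<And>z. \<psi> z $ 1 \<noteq> 0 \<or> cnj (\<psi> z $ 2) \<noteq> 0"
  shows "continuous_on UNIV U"
proof -
  define D where "D = (\<lambda>z. \<psi> z $ 1 * cnj (\<psi> z $ 1) + cnj (\<psi> z $ 2) * cnj (cnj (\<psi> z $ 2)))"
  have D: "D z \<noteq> 0" for z unfolding D_def by (rule norm_sum_pos[OF nz])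
  define E where "E = (\<lambda>z. d_zbar (\<lambda>z. \<psi> z $ 1) z * cnj (\<psi> z $ 2) - d_z (\<lambda>z. \<psi> z $ 2) z * cnj (\<psi> z $ 1))"
  have "of_real (U z) * D z = E z" for z
    unfolding E_def D_def dirac_components[OF d] by (simp add: algebra_simps)
  then have "complex_of_real (U z) = E z / D z" for z using D by (simp add: field_simps)
  then have U: "U z = Re (E z / D z)" for z by (metis Re_complex_of_real)
  have diff: "\<psi> differentiable (at z)" for z using smooth_on_differentiable[OF s] by simp
  have c: "continuous_on UNIV \<psi>"
    using diff differentiable_imp_continuous_within continuous_at_imp_continuous_on by blast
  note dc = smooth_on_continuous_derivative[OF s]
  have "continuous_on UNIV E"
    unfolding E_def d_z_def d_zbar_def frechet_derivative_component(2)[OF diff]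
    by (intro continuous_intros dc c) auto
  moreover have "continuous_on UNIV D" unfolding D_def by (intro continuous_intros c)
  ultimately have "continuous_on UNIV (\<lambda>z. Re (E z / D z))"
    using D by (intro continuous_intros) auto
  then show ?thesis unfolding U[symmetric] .
qed

lemma weierstrass_form_re:
  "(\<chi> k. Re (weierstrass_form s h $ k)) = wform (s $ 1) (cnj (s $ 2)) h"
proof -
  let ?x = "(\<chi> k. Re (weierstrass_form s h $ k)) :: real^3"
  let ?a = "weierstrass_form s h"
  let ?m = "s $ 1" and ?n = "cnj (s $ 2)"
  have "?a $ 1 = \<i> / 2 * (((?n)\<^sup>2 + ?m\<^sup>2) * h - cnj ((?n\<^sup>2 + ?m\<^sup>2) * h))"
    "?a $ 2 = 1 / 2 * (((?n)\<^sup>2 - ?m\<^sup>2) * h + cnj ((?n\<^sup>2 - ?m\<^sup>2) * h))"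
    "?a $ 3 = ?m * ?n * h + cnj (?m * ?n * h)"
    by (simp_all add: weierstrass_form_def algebra_simps)
  moreover have "Re (\<i> / 2 * (A - cnj A)) = - Im A" "Re (1 / 2 * (A + cnj A)) = Re A" "Re (A + cnj A) = 2 * Re A" for A
    by simp_all
  ultimately have "?x $ 1 = - Im ((?n\<^sup>2 + ?m\<^sup>2) * h)" "?x $ 2 = Re ((?n\<^sup>2 - ?m\<^sup>2) * h)" "?x $ 3 = 2 * Re (?m * ?n * h)"
    unfolding vec_lambda_beta by metis+
  then show ?thesis
    unfolding vec_eq_iff[of ?x] forall_3 wform_def vector_3 by (simp add: algebra_simps flip: complex_cnj_power)
qed

text \<open>The increment of \<open>Y\<close> is the integral of the form over a straight segment
  from \<open>z\<close>, and by continuity the form on a short segment is close to its value at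
  \<open>z\<close>.\<close>

lemma weierstrass_map_derivative:
  assumes s: "continuous_on UNIV \<psi>" and w: "weierstrass_map \<psi> Y"
  shows "(Y has_derivative wform (\<psi> z $ 1) (cnj (\<psi> z $ 2))) (at z)"
proof -
  define \<omega> where "\<omega> = (\<lambda>z. wform (\<psi> z $ 1) (cnj (\<psi> z $ 2)))"
  have lin: "\<omega> z (h + k) = \<omega> z h + \<omega> z k" "\<omega> z (c *\<^sub>R h) = c *\<^sub>R \<omega> z h" for z h k c
    unfolding \<omega>_def using linear_add[OF linear_wform] linear_scale[OF linear_wform] by blast+
  have int: "((\<lambda>t. \<omega> (z + of_real t * h) h) has_integral (Y (z + h) - Y z)) {0..1}" for h
  proof -
    let ?g = "linepath z (z + h)"
    have "bounded_linear (\<lambda>x :: complex^3. (\<chi> k. Re (x $ k)) :: real^3)"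
      by (rule linear_conv_bounded_linear[THEN iffD1], rule linearI) (simp_all add: vec_eq_iff)
    from has_integral_linear[OF w[unfolded weierstrass_map_def, rule_format, of ?g, OF valid_path_linepath] this]
    have "((\<lambda>t. \<omega> (?g t) (vector_derivative ?g (at t within {0..1}))) has_integral
        (\<chi> k. Re (of_real (Y (z + h) $ k - Y z $ k)))) {0..1}"
      unfolding o_def weierstrass_form_re \<omega>_def by simp
    moreover have "((\<chi> k. Re (of_real (Y (z + h) $ k - Y z $ k))) :: real^3) = Y (z + h) - Y z"
      by (simp add: vec_eq_iff)
    moreover have "\<omega> (?g t) (vector_derivative ?g (at t within {0..1})) = \<omega> (z + of_real t * h) h"
      if "t \<in> {0..1}" for t
    proof -
      have "?g t = z + of_real t * h"
        by (simp add: linepath_def algebra_simps scaleR_conv_of_real)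
      moreover have "vector_derivative ?g (at t within {0..1}) = h"
        using vector_derivative_linepath_within[of t z "z + h"] that by simp
      ultimately show ?thesis by simp
    qed
    ultimately show ?thesis
      by (metis (no_types, lifting) has_integral_eq)
  qed
  have cA: "isCont (\<lambda>z. \<omega> z 1) z" and cB: "isCont (\<lambda>z. \<omega> z \<i>) z" for z
  proof -
    have "isCont (\<lambda>z. wform (\<psi> z $ 1) (cnj (\<psi> z $ 2)) h) z" for h
      unfolding isCont_def
    proof (rule vec_tendstoI)
      fix i :: 3
      have "continuous_on UNIV (\<lambda>z. wform (\<psi> z $ 1) (cnj (\<psi> z $ 2)) h $ i)"
        using exhaust_3[of i] unfolding wform_def
        by (elim disjE; simp only: vector_3; intro continuous_intros s)
      then have "isCont (\<lambda>z. wform (\<psi> z $ 1) (cnj (\<psi> z $ 2)) h $ i) z"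
        by (simp add: continuous_on_eq_continuous_at)
      then show "((\<lambda>z. wform (\<psi> z $ 1) (cnj (\<psi> z $ 2)) h $ i) \<longlongrightarrow> wform (\<psi> z $ 1) (cnj (\<psi> z $ 2)) h $ i) (at z)"
        unfolding isCont_def .
    qed
    then show "isCont (\<lambda>z. \<omega> z 1) z" "isCont (\<lambda>z. \<omega> z \<i>) z" unfolding \<omega>_def by auto
  qed
  have "(Y has_derivative \<omega> z) (at z)"
    unfolding has_derivative_at_alt
  proof (intro conjI allI impI)
    show "bounded_linear (\<omega> z)"
      unfolding \<omega>_def using linear_wform linear_conv_bounded_linear by blast
    fix e :: real assume "0 < e"
    then have e2: "0 < e / 2" by simp
    obtain d1 where d1: "0 < d1" "\<And>y. dist y z < d1 \<Longrightarrow> norm (\<omega> y 1 - \<omega> z 1) < e / 2"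
      using cA[of z] e2 unfolding continuous_at_eps_delta dist_norm by blast
    obtain d2 where d2: "0 < d2" "\<And>y. dist y z < d2 \<Longrightarrow> norm (\<omega> y \<i> - \<omega> z \<i>) < e / 2"
      using cB[of z] e2 unfolding continuous_at_eps_delta dist_norm by blast
    show "\<exists>d>0. \<forall>y. norm (y - z) < d \<longrightarrow> norm (Y y - Y z - \<omega> z (y - z)) \<le> e * norm (y - z)"
    proof (intro exI conjI allI impI)
      show "0 < min d1 d2" using d1 d2 by simp
      fix y assume y: "norm (y - z) < min d1 d2"
      define h where "h = y - z"
      have "norm (Y (z + h) - Y z - \<omega> z h) \<le> e * norm h * measure lborel (cbox 0 (1 :: real))"
      proof (rule has_integral_bound)
        show "0 \<le> e * norm h" using \<open>0 < e\<close> by simp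
        show "((\<lambda>t. \<omega> (z + of_real t * h) h - \<omega> z h) has_integral (Y (z + h) - Y z - \<omega> z h)) (cbox 0 1)"
          using has_integral_diff[OF int[of h] has_integral_const_real[of "\<omega> z h" 0 1]] by simp
        fix t :: real assume t: "t \<in> cbox 0 1"
        let ?y = "z + of_real t * h"
        have "norm (of_real t * h) \<le> norm h"
          using t by (simp add: norm_mult mult_left_le_one_le)
        then have "dist ?y z < d1" "dist ?y z < d2"
          using y unfolding h_def[symmetric] dist_norm by simp_all
        then have AB: "norm (\<omega> ?y 1 - \<omega> z 1) < e / 2" "norm (\<omega> ?y \<i> - \<omega> z \<i>) < e / 2"
          using d1 d2 by blast+
        have h: "h = Re h *\<^sub>R 1 + Im h *\<^sub>R \<i>" by (simp add: complex_eq_iff)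
        have "\<omega> x h = Re h *\<^sub>R \<omega> x 1 + Im h *\<^sub>R \<omega> x \<i>" for x
          by (subst h) (simp only: lin)
        then have "\<omega> ?y h - \<omega> z h = Re h *\<^sub>R (\<omega> ?y 1 - \<omega> z 1) + Im h *\<^sub>R (\<omega> ?y \<i> - \<omega> z \<i>)"
          by (simp add: algebra_simps)
        also have "norm \<dots> \<le> \<bar>Re h\<bar> * norm (\<omega> ?y 1 - \<omega> z 1) + \<bar>Im h\<bar> * norm (\<omega> ?y \<i> - \<omega> z \<i>)"
          by (rule norm_triangle_le) simp
        also have "\<dots> \<le> norm h * (e / 2) + norm h * (e / 2)"
          using AB abs_Re_le_cmod[of h] abs_Im_le_cmod[of h] by (intro add_mono mult_mono) auto
        finally show "norm (\<omega> ?y h - \<omega> z h) \<le> e * norm h" by (simp add: mult.commute)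
      qed
      then show "norm (Y y - Y z - \<omega> z (y - z)) \<le> e * norm (y - z)" by (simp add: h_def)
    qed
  qed
  then show ?thesis unfolding \<omega>_def .
qed

text \<open>The chart stays on the unit sphere, so its derivative is orthogonal to the radius; on
  such vectors the differential of an immersion is injective.\<close>

lemma immersed_sphere_chart_derivative:
  assumes f: "immersed_sphere f" and \<sigma>: "conformal_chart f q \<sigma>"
  shows "\<exists>F. ((\<lambda>z. f (\<sigma> z)) has_derivative F) (at z) \<and> F 1 \<noteq> 0"
proof -
  let ?S = "frechet_derivative \<sigma> (at z)" and ?R = "frechet_derivative (radial_extension f) (at (\<sigma> z))"
  have S2: "\<sigma> w \<in> S2" for w
    using \<sigma> unfolding conformal_chart_def bij_betw_def by blast
  have dS: "(\<sigma> has_derivative ?S) (at z)"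
    using \<sigma> smooth_on_differentiable[of \<sigma> UNIV z] unfolding conformal_chart_def frechet_derivative_works[symmetric] by blast
  have "\<sigma> z \<noteq> 0" using S2[of z] by auto
  then have dR: "(radial_extension f has_derivative ?R) (at (\<sigma> z))"
    using f smooth_on_differentiable[of "radial_extension f" "- {0}" "\<sigma> z"]
    unfolding immersed_sphere_def frechet_derivative_works[symmetric] by blast
  have "radial_extension f (\<sigma> w) = f (\<sigma> w)" for w
    using S2[of w] by (simp add: radial_extension_def)
  then have dF: "((\<lambda>w. f (\<sigma> w)) has_derivative (\<lambda>h. ?R (?S h))) (at z)"
    using has_derivative_compose[OF dS dR] by simp
  have "((\<lambda>w. \<sigma> w \<bullet> \<sigma> w) has_derivative (\<lambda>h. \<sigma> z \<bullet> ?S h + ?S h \<bullet> \<sigma> z)) (at z)"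
    by (rule has_derivative_inner[OF dS dS])
  moreover have "(\<lambda>w. \<sigma> w \<bullet> \<sigma> w) = (\<lambda>w. 1)"
    using S2 by (auto simp: dot_square_norm)
  ultimately have "(\<lambda>h. \<sigma> z \<bullet> ?S h + ?S h \<bullet> \<sigma> z) = (\<lambda>h. 0)"
    using has_derivative_unique[OF _ has_derivative_const] by metis
  from fun_cong[OF this, of 1] have "?S 1 \<bullet> \<sigma> z = 0" by (simp add: inner_commute)
  moreover have "?S 1 \<noteq> 0" using \<sigma> unfolding conformal_chart_def by simp
  ultimately have "?R (?S 1) \<noteq> 0" using f S2[of z] unfolding immersed_sphere_def by blast
  with dF show ?thesis by blast
qed

text \<open>A zero of the spinor would be a branch point of the surface.\<close>

lemma spinor_nonzero:
  assumes f: "immersed_sphere f" and \<sigma>: "conformal_chart f q \<sigma>" and A: "orthogonal_matrix A"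
    and d: "((\<lambda>z. A *v f (\<sigma> z)) has_derivative wform m n) (at z)"
  shows "m \<noteq> 0 \<or> n \<noteq> 0"
proof (rule ccontr)
  assume "\<not> ?thesis"
  then have w: "wform m n 1 = 0" by (simp add: hor_eq_iff hor_wform wform_3)
  obtain F where F: "((\<lambda>z. f (\<sigma> z)) has_derivative F) (at z)" "F 1 \<noteq> 0"
    using immersed_sphere_chart_derivative[OF f \<sigma>] by blast
  have "wform m n = (\<lambda>h. A *v F h)"
    using has_derivative_unique[OF d bounded_linear.has_derivative[OF matrix_vector_mul_bounded_linear F(1)]] .
  then have "A *v F 1 = 0" using w by metis
  then have "transpose A *v (A *v F 1) = 0" by simp
  then show False
    using A F(2) unfolding matrix_vector_mul_assoc orthogonal_matrix_def by simp
qed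

lemma chart_curve_transform:
  assumes Y: "\<And>z. (Y has_derivative wform (M z) (N z)) (at z)"
    and M: "\<And>z. \<exists>a. has_wirtinger M a (of_real (U z) * cnj (N z)) z"
    and N: "\<And>z. \<exists>a. has_wirtinger N a (- of_real (U z) * cnj (M z)) z"
    and p: "(p has_field_derivative p') (at w)" and q: "(q has_field_derivative q') (at w)" and q0: "q w \<noteq> 0"
    and eq: "\<And>w. q w \<noteq> 0 \<Longrightarrow> X w = Y (p w / q w)" "\<And>w. q w \<noteq> 0 \<Longrightarrow> m w = M (p w / q w) / q w"
      "\<And>w. q w \<noteq> 0 \<Longrightarrow> n w = N (p w / q w) / q w" "\<And>w. q w \<noteq> 0 \<Longrightarrow> u w = U (p w / q w) / (norm (q w))\<^sup>2"
    and D: "p' * q w - p w * q' = D"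
  shows "(X has_derivative (\<lambda>h. wform (m w) (n w) (D * h))) (at w)"
    and "\<exists>a. has_wirtinger m a (of_real (u w) * cnj (n w) * cnj D) w"
    and "\<exists>a. has_wirtinger n a (- of_real (u w) * cnj (m w) * cnj D) w"
proof -
  have "isCont q w" using q DERIV_isCont by blast
  then have "(q \<longlongrightarrow> q w) (nhds w)" by (simp add: continuous_at_imp_continuous_at_within isCont_def tendsto_nhds_iff)
  then have ev: "eventually (\<lambda>w. q w \<noteq> 0) (nhds w)"
    using q0 tendsto_imp_eventually_ne by blast
  note c = chart_curve[OF Y M N p q q0, unfolded D]
  have "eventually (\<lambda>w. Y (p w / q w) = X w) (at w)"
    using ev unfolding eventually_at_filter by eventually_elim (simp add: eq)
  then show "(X has_derivative (\<lambda>h. wform (m w) (n w) (D * h))) (at w)"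
    using has_derivative_transform_eventually[OF c(1), of X] eq[OF q0] by simp
  have "eventually (\<lambda>w. M (p w / q w) / q w = m w) (nhds w)" "eventually (\<lambda>w. N (p w / q w) / q w = n w) (nhds w)"
    using ev by (eventually_elim, simp add: eq)+
  with wirtinger_transform c(2,3) show "\<exists>a. has_wirtinger m a (of_real (u w) * cnj (n w) * cnj D) w"
    "\<exists>a. has_wirtinger n a (- of_real (u w) * cnj (m w) * cnj D) w"
    unfolding eq[OF q0] by blast+
qed

section \<open>Gluing the two charts into homogeneous data\<close>

lemma continuous_on_punctured:
  assumes 1: "\<And>v. snd v \<noteq> 0 \<Longrightarrow> H v = F v" and 2: "\<And>v. fst v \<noteq> 0 \<Longrightarrow> H v = G v"
    and F: "continuous_on {v. snd v \<noteq> 0} F" and G: "continuous_on {v. fst v \<noteq> 0} G"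
  shows "continuous_on (- {0 :: complex \<times> complex}) H"
proof -
  have o: "open {v :: complex \<times> complex. snd v \<noteq> 0}" "open {v :: complex \<times> complex. fst v \<noteq> 0}"
    by (intro open_Collect_neq continuous_intros)+
  have "continuous_on {v. snd v \<noteq> 0} H" "continuous_on {v. fst v \<noteq> 0} H"
    using F G continuous_on_cong[OF refl, of "{v. snd v \<noteq> 0}" H F] continuous_on_cong[OF refl, of "{v. fst v \<noteq> 0}" H G] 1 2
    by blast+
  from continuous_on_open_Un[OF o this]
  show ?thesis
    by (rule continuous_on_subset) (auto simp: prod_eq_iff)
qed

lemma continuous_on_chart:
  assumes "continuous_on UNIV F"
  shows "continuous_on {v :: complex \<times> complex. snd v \<noteq> 0} (\<lambda>v. F (fst v / snd v))"
    and "continuous_on {v :: complex \<times> complex. fst v \<noteq> 0} (\<lambda>v. F (- snd v / fst v))"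
proof -
  show "continuous_on {v :: complex \<times> complex. snd v \<noteq> 0} (\<lambda>v. F (fst v / snd v))"
    by (rule continuous_on_compose2[OF assms _ subset_UNIV]) (intro continuous_intros; simp)+
  show "continuous_on {v :: complex \<times> complex. fst v \<noteq> 0} (\<lambda>v. F (- snd v / fst v))"
    by (rule continuous_on_compose2[OF assms _ subset_UNIV]) (intro continuous_intros; simp)+
qed

text \<open>
  Parametrization of the sphere by the projective line, in homogeneous coordinates.
\<close>

definition proj_param :: "(complex \<times> complex \<Rightarrow> real^3) \<Rightarrow> bool" where
  "proj_param P \<longleftrightarrow> continuous_on (- {0}) P \<and> P ` (- {0}) = S2 \<and>
     (\<forall>v w. v \<noteq> 0 \<longrightarrow> w \<noteq> 0 \<longrightarrow> (P v = P w \<longleftrightarrow> wedge v w = 0))"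

lemma plane_representation_proj_param:
  assumes "plane_representation f \<sigma> \<tau> U V \<psi> \<phi>"
  obtains P where "proj_param P"
    "\<And>v. snd v \<noteq> 0 \<Longrightarrow> P v = \<sigma> (fst v / snd v)" "\<And>v. fst v \<noteq> 0 \<Longrightarrow> P v = \<tau> (- snd v / fst v)"
    "\<And>v. P v \<in> S2"
proof -
  have cs: "conformal_chart f (\<tau> 0) \<sigma>" and ct: "conformal_chart f (\<sigma> 0) \<tau>"
    and st: "\<And>z. z \<noteq> 0 \<Longrightarrow> \<tau> (- 1 / z) = \<sigma> z"
    using assms unfolding plane_representation_def by blast+
  have bs: "bij_betw \<sigma> UNIV (S2 - {\<tau> 0})" and bt: "bij_betw \<tau> UNIV (S2 - {\<sigma> 0})"
    using cs ct unfolding conformal_chart_def by blast+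
  have cont: "continuous_on UNIV \<sigma>" "continuous_on UNIV \<tau>"
    using cs ct smooth_on_differentiable[of _ UNIV] unfolding conformal_chart_def
    by (metis UNIV_I differentiable_imp_continuous_within continuous_at_imp_continuous_on)+
  define P where "P = (\<lambda>v :: complex \<times> complex. if snd v \<noteq> 0 then \<sigma> (fst v / snd v) else \<tau> (- snd v / fst v))"
  have P1: "P v = \<sigma> (fst v / snd v)" if "snd v \<noteq> 0" for v using that by (simp add: P_def)
  have P2: "P v = \<tau> (- snd v / fst v)" if "fst v \<noteq> 0" for v
    using st[of "fst v / snd v"] that by (cases "snd v = 0") (simp_all add: P_def)
  have "\<sigma> z \<in> S2" "\<tau> z \<in> S2" for z
    using bs bt unfolding bij_betw_def by blast+
  then have S2: "P v \<in> S2" for v unfolding P_def by simp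
  have tau: "P v = \<tau> 0 \<longleftrightarrow> snd v = 0" for v
    using bs unfolding bij_betw_def P_def by (cases "snd v = 0") auto
  have "proj_param P"
    unfolding proj_param_def
  proof (intro conjI allI impI)
    show "continuous_on (- {0}) P"
      by (rule continuous_on_punctured, erule P1, erule P2)
         (rule continuous_on_chart(1)[OF cont(1)] continuous_on_chart(2)[OF cont(2)])+
    show "P ` (- {0}) = S2"
    proof
      show "P ` (- {0}) \<subseteq> S2" using S2 by blast
      show "S2 \<subseteq> P ` (- {0})"
      proof
        fix x assume x: "x \<in> S2"
        show "x \<in> P ` (- {0})"
        proof (cases "x = \<tau> 0")
          case True
          then have "x = P (1, 0)" using tau[of "(1, 0)"] by simp
          then show ?thesis by (auto simp: zero_prod_def)
        next
          case False
          then obtain z where "x = \<sigma> z" using x bs unfolding bij_betw_def by blast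
          then have "x = P (z, 1)" by (simp add: P_def)
          then show ?thesis by (auto simp: zero_prod_def)
        qed
      qed
    qed
    fix v w :: "complex \<times> complex" assume vw: "v \<noteq> 0" "w \<noteq> 0"
    show "P v = P w \<longleftrightarrow> wedge v w = 0"
    proof (cases "snd v = 0 \<or> snd w = 0")
      case True
      have "P v = P w \<longleftrightarrow> snd v = 0 \<and> snd w = 0"
        using True tau by metis
      moreover have "wedge v w = 0 \<longleftrightarrow> snd v = 0 \<and> snd w = 0"
        using True vw by (auto simp: prod_eq_iff)
      ultimately show ?thesis by blast
    next
      case False
      then have "P v = P w \<longleftrightarrow> fst v / snd v = fst w / snd w"
        using bs unfolding bij_betw_def P_def inj_on_def by auto
      also have "\<dots> \<longleftrightarrow> wedge v w = 0"
        using False by (simp add: field_simps)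
      finally show ?thesis .
    qed
  qed
  with P1 P2 S2 that show thesis by blast
qed

text \<open>The coordinate change \<open>A\<close> carries the axis along. Rotations about the new
  axis are conjugate under \<open>A\<close> to rotations about the old one, and conjugation keeps
  the determinant 1 even if \<open>A\<close> reverses orientation.\<close>

lemma sphere_of_revolution_axis:
  assumes f: "sphere_of_revolution f" and A: "orthogonal_matrix A"
  shows "\<exists>a d. norm d = 1 \<and> (\<forall>t. \<forall>x\<in>S2. \<exists>y\<in>S2. a + axis_rotation d t (A *v f x - a) = A *v f y)"
proof -
  obtain a0 d0 where d0: "d0 \<noteq> 0"
    and inv: "\<forall>R. rotation_matrix R \<and> R *v d0 = d0 \<longrightarrow> (\<lambda>p. a0 + R *v (p - a0)) ` (f ` S2) = f ` S2"
    using f unfolding sphere_of_revolution_def by (elim conjE exE) (rule that)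
  have tA: "transpose A *v (A *v x) = x" "A *v (transpose A *v x) = x" for x
    using A unfolding matrix_vector_mul_assoc orthogonal_matrix_def by simp_all
  define d where "d = A *v (d0 /\<^sub>R norm d0)"
  have "norm d = norm (d0 /\<^sub>R norm d0)"
    using A orthogonal_transformation_matrix[of "(*v) A"] unfolding d_def orthogonal_transformation by simp
  then have d: "norm d = 1" using d0 by simp
  have "\<exists>y\<in>S2. A *v a0 + axis_rotation d t (A *v f x - A *v a0) = A *v f y" if x: "x \<in> S2" for t x
  proof -
    obtain R where R: "rotation_matrix R" "\<And>x. R *v x = axis_rotation d t x"
      using axis_rotation_matrix[OF d] by blast
    have dd: "axis_rotation d t d = d"
      using d by (simp add: axis_rotation_def dot_square_norm algebra_simps flip: scaleR_add_left)
    let ?R = "transpose A ** R ** A"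
    have o: "orthogonal_matrix ?R"
      using A R(1) orthogonal_matrix_mul orthogonal_matrix_transpose unfolding rotation_matrix_def by blast
    have "det (transpose A) * det A = 1"
      using A unfolding orthogonal_matrix_def by (metis det_I det_mul)
    then have "det ?R = 1" using R(1) unfolding rotation_matrix_def by (simp add: det_mul)
    with o have rR: "rotation_matrix ?R" unfolding rotation_matrix_def by blast
    have app: "?R *v x = transpose A *v axis_rotation d t (A *v x)" for x
      by (simp add: R(2) flip: matrix_vector_mul_assoc)
    have d0d: "d0 = norm d0 *\<^sub>R (transpose A *v d)" using d0 unfolding d_def tA by simp
    have "?R *v (transpose A *v d) = transpose A *v d" unfolding app tA dd ..
    then have "?R *v d0 = d0" using d0d by (metis matrix_vector_mult_scaleR)
    with rR have "(\<lambda>p. a0 + ?R *v (p - a0)) ` (f ` S2) = f ` S2" using inv by (meson conjI)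
    then have "a0 + ?R *v (f x - a0) \<in> f ` S2" using x by blast
    then obtain y where y: "y \<in> S2" "f y = a0 + ?R *v (f x - a0)" by auto
    have "A *v f y = A *v a0 + axis_rotation d t (A *v f x - A *v a0)"
      unfolding y(2) app matrix_vector_right_distrib tA matrix_vector_mult_diff_distrib
      by (simp add: linear_diff[OF linear_axis_rotation])
    with y(1) show ?thesis by metis
  qed
  with d show ?thesis by (intro exI[of _ "A *v a0"] exI[of _ d]) simp
qed

lemma plane_representation_rotational_rep:
  assumes f: "sphere_of_revolution f" and rep: "plane_representation f \<sigma> \<tau> U V \<psi> \<phi>"
  obtains A P m n u a d where "orthogonal_matrix A" "proj_param P" "rotational_rep (\<lambda>v. A *v f (P v)) m n u a d"
    "\<And>z. u (z, 1) = U z"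
proof -
  have im: "immersed_sphere f" using f unfolding sphere_of_revolution_def by blast
  obtain A :: "real^3^3" where A: "orthogonal_matrix A"
    and wS: "weierstrass_map \<psi> (\<lambda>z. A *v f (\<sigma> z))" and wT: "weierstrass_map \<phi> (\<lambda>u. A *v f (\<tau> u))"
    using rep unfolding plane_representation_def by blast
  have cs: "conformal_chart f (\<tau> 0) \<sigma>" and ct: "conformal_chart f (\<sigma> 0) \<tau>"
    and st: "\<And>z. z \<noteq> 0 \<Longrightarrow> \<tau> (- 1 / z) = \<sigma> z"
    and tr: "\<And>z. z \<noteq> 0 \<Longrightarrow> V (- 1 / z) = (norm z)\<^sup>2 * U z"
      "\<And>z. z \<noteq> 0 \<Longrightarrow> \<phi> (- 1 / z) $ 1 = z * \<psi> z $ 1" "\<And>z. z \<noteq> 0 \<Longrightarrow> \<phi> (- 1 / z) $ 2 = cnj z * \<psi> z $ 2"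
    and smooth: "smooth_on \<psi> UNIV" "smooth_on \<phi> UNIV"
    and dirac: "\<And>z. dirac U \<psi> z = 0" "\<And>u. dirac V \<phi> u = 0"
    using rep unfolding plane_representation_def by blast+
  obtain P where P: "proj_param P"
    "\<And>v. snd v \<noteq> 0 \<Longrightarrow> P v = \<sigma> (fst v / snd v)" "\<And>v. fst v \<noteq> 0 \<Longrightarrow> P v = \<tau> (- snd v / fst v)"
    "\<And>v. P v \<in> S2"
    using plane_representation_proj_param[OF rep] by blast
  define YS YT where "YS = (\<lambda>z. A *v f (\<sigma> z))" and "YT = (\<lambda>z. A *v f (\<tau> z))"
  define MS NS MT NT where "MS = (\<lambda>z. \<psi> z $ 1)" and "NS = (\<lambda>z. cnj (\<psi> z $ 2))"
    and "MT = (\<lambda>z. \<phi> z $ 1)" and "NT = (\<lambda>z. cnj (\<phi> z $ 2))"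
  have cpsi: "continuous_on UNIV \<psi>" "continuous_on UNIV \<phi>"
    using smooth_on_differentiable[OF smooth(1)] smooth_on_differentiable[OF smooth(2)]
    by (metis UNIV_I differentiable_imp_continuous_within continuous_at_imp_continuous_on)+
  have dYS: "(YS has_derivative wform (MS z) (NS z)) (at z)" for z
    unfolding YS_def MS_def NS_def by (rule weierstrass_map_derivative[OF cpsi(1) wS])
  have dYT: "(YT has_derivative wform (MT z) (NT z)) (at z)" for z
    unfolding YT_def MT_def NT_def by (rule weierstrass_map_derivative[OF cpsi(2) wT])
  have nzS: "MS z \<noteq> 0 \<or> NS z \<noteq> 0" for z
    by (rule spinor_nonzero[OF im cs A dYS[unfolded YS_def]])
  have nzT: "MT z \<noteq> 0 \<or> NT z \<noteq> 0" for z
    by (rule spinor_nonzero[OF im ct A dYT[unfolded YT_def]])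
  have cU: "continuous_on UNIV U"
    by (rule dirac_potential_continuous[OF smooth(1) dirac(1) nzS[unfolded MS_def NS_def]])
  have cV: "continuous_on UNIV V"
    by (rule dirac_potential_continuous[OF smooth(2) dirac(2) nzT[unfolded MT_def NT_def]])
  have cMN: "continuous_on UNIV MS" "continuous_on UNIV NS" "continuous_on UNIV MT" "continuous_on UNIV NT"
    unfolding MS_def NS_def MT_def NT_def
    by (rule continuous_on_cnj continuous_on_component cpsi)+
  have cY: "continuous_on UNIV YS" "continuous_on UNIV YT"
    using has_derivative_continuous[OF dYS] has_derivative_continuous[OF dYT]
    by (simp_all add: continuous_on_eq_continuous_within)
  have wMS: "\<exists>a. has_wirtinger MS a (of_real (U z) * cnj (NS z)) z" and wNS: "\<exists>a. has_wirtinger NS a (- of_real (U z) * cnj (MS z)) z"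
    and wMT: "\<exists>a. has_wirtinger MT a (of_real (V z) * cnj (NT z)) z" and wNT: "\<exists>a. has_wirtinger NT a (- of_real (V z) * cnj (MT z)) z" for z
    unfolding MS_def NS_def MT_def NT_def
    by (rule dirac_wirtinger[OF smooth(1) dirac(1)] dirac_wirtinger[OF smooth(2) dirac(2)])+
  define X where "X = (\<lambda>v. A *v f (P v))"
  \<comment> \<open>The transition rules between \<open>\<psi>\<close> and \<open>\<phi>\<close>
    make the two branches agree where both coordinates are nonzero, which is the content of
    \<open>T\<close>.\<close>
  define m where "m = (\<lambda>v. if snd v \<noteq> 0 then MS (fst v / snd v) / snd v else MT (- snd v / fst v) / fst v)"
  define n where "n = (\<lambda>v. if snd v \<noteq> 0 then NS (fst v / snd v) / snd v else NT (- snd v / fst v) / fst v)"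
  define u where "u = (\<lambda>v. if snd v \<noteq> 0 then U (fst v / snd v) / (norm (snd v))\<^sup>2 else V (- snd v / fst v) / (norm (fst v))\<^sup>2)"
  have S: "X v = YS (fst v / snd v)" "m v = MS (fst v / snd v) / snd v" "n v = NS (fst v / snd v) / snd v"
    "u v = U (fst v / snd v) / (norm (snd v))\<^sup>2" if "snd v \<noteq> 0" for v
    using that P(2) by (simp_all add: X_def m_def n_def u_def YS_def)
  have T: "X v = YT (- snd v / fst v) \<and> m v = MT (- snd v / fst v) / fst v \<and> n v = NT (- snd v / fst v) / fst v \<and>
    u v = V (- snd v / fst v) / (norm (fst v))\<^sup>2" if "fst v \<noteq> 0" for v
  proof (cases "snd v = 0")
    case True
    with that P(3) show ?thesis by (simp add: X_def m_def n_def u_def YT_def)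
  next
    case False
    define z where "z = fst v / snd v"
    have z: "z \<noteq> 0" "- snd v / fst v = - 1 / z" using False that by (simp_all add: z_def)
    have "X v = YT (- 1 / z)" using P(3)[OF that] z(2) by (simp add: X_def YT_def)
    then show ?thesis
      unfolding z(2) MT_def NT_def tr[OF z(1)] S(2-4)[OF False] z_def[symmetric] MS_def NS_def
      using False that by (simp add: z_def norm_divide power_divide)
  qed
  note T = T[THEN conjunct1] T[THEN conjunct2, THEN conjunct1] T[THEN conjunct2, THEN conjunct2, THEN conjunct1]
    T[THEN conjunct2, THEN conjunct2, THEN conjunct2]
  have curve: "((\<lambda>w. X (p w, q w)) has_derivative
        (\<lambda>h. wform (m (p w, q w)) (n (p w, q w)) ((p' * q w - p w * q') * h))) (at w) \<and>
      (\<exists>a. has_wirtinger (\<lambda>w. m (p w, q w)) a (of_real (u (p w, q w)) * cnj (n (p w, q w)) * cnj (p' * q w - p w * q')) w) \<and>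
      (\<exists>a. has_wirtinger (\<lambda>w. n (p w, q w)) a (- of_real (u (p w, q w)) * cnj (m (p w, q w)) * cnj (p' * q w - p w * q')) w)"
    if p: "(p has_field_derivative p') (at w)" and q: "(q has_field_derivative q') (at w)" and nz: "(p w, q w) \<noteq> 0"
    for p q p' q' w
  proof (cases "q w = 0")
    case False
    show ?thesis
      by (intro conjI chart_curve_transform[OF dYS wMS wNS p q False] refl; simp add: S)
  next
    case True
    with nz have p0: "p w \<noteq> 0" by (auto simp: zero_prod_def)
    \<comment> \<open>In the second chart the curve is \<open>(- q, p)\<close>; the sign in
      \<open>u = - 1 / z\<close> preserves the Wronskian.\<close>
    have D: "- q' * p w - - q w * p' = p' * q w - p w * q'" by simp
    show ?thesis
      by (intro conjI chart_curve_transform[OF dYT wMT wNT DERIV_minus[OF q] p p0] D; simp add: T)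
  qed
  obtain a d where ad: "norm d = 1"
    "\<forall>t. \<forall>x\<in>S2. \<exists>y\<in>S2. a + axis_rotation d t (A *v f x - a) = A *v f y"
    using sphere_of_revolution_axis[OF f A] by (elim exE conjE) (rule that)
  have "rotational_rep X m n u a d"
  proof
    fix p q :: "complex \<Rightarrow> complex" and p' q' w
    assume *: "(p has_field_derivative p') (at w)" "(q has_field_derivative q') (at w)" "(p w, q w) \<noteq> 0"
    show "((\<lambda>w. X (p w, q w)) has_derivative
        (\<lambda>h. wform (m (p w, q w)) (n (p w, q w)) ((p' * q w - p w * q') * h))) (at w)"
      using curve[OF *] by blast
    show "\<exists>a. has_wirtinger (\<lambda>w. m (p w, q w)) a (u (p w, q w) * cnj (n (p w, q w)) * cnj (p' * q w - p w * q')) w"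
      using curve[OF *] by blast
    show "\<exists>a. has_wirtinger (\<lambda>w. n (p w, q w)) a (- u (p w, q w) * cnj (m (p w, q w)) * cnj (p' * q w - p w * q')) w"
      using curve[OF *] by simp
  next
    fix k p q :: complex assume k: "k \<noteq> 0"
    show "m (k * p, k * q) = m (p, q) / k" "n (k * p, k * q) = n (p, q) / k"
      "u (k * p, k * q) = u (p, q) / (norm k)\<^sup>2"
      using k by (simp_all add: m_def n_def u_def norm_mult power_mult_distrib)
    show "X (k * p, k * q) = X (p, q)"
    proof (cases "q = 0")
      case False
      then show ?thesis using k by (simp add: S(1))
    next
      case True
      show ?thesis
      proof (cases "p = 0")
        case False
        with True k show ?thesis by (simp add: T(1))
      qed (simp add: True)
    qed
  next
    fix v :: "complex \<times> complex" assume v: "v \<noteq> 0"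
    show "m v \<noteq> 0 \<or> n v \<noteq> 0"
    proof (cases "snd v = 0")
      case False
      then show ?thesis using nzS by (simp add: S)
    next
      case True
      with v have "fst v \<noteq> 0" by (auto simp: prod_eq_iff)
      then show ?thesis using nzT by (simp add: T)
    qed
    show "\<exists>v'. v' \<noteq> 0 \<and> a + axis_rotation d t (X v - a) = X v'" for t
    proof -
      have "\<exists>y\<in>S2. a + axis_rotation d t (A *v f (P v) - a) = A *v f y" using ad(2) P(4) by simp
      then obtain y where y: "y \<in> S2" "a + axis_rotation d t (X v - a) = A *v f y" unfolding X_def by (elim bexE)
      have "P ` (- {0}) = S2" using P(1) unfolding proj_param_def by (elim conjE)
      with y(1) obtain v' where "v' \<in> - {0}" "P v' = y" by (metis imageE)
      with y(2) show ?thesis unfolding X_def by (intro exI[of _ v']) simp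
    qed
  next
    show "continuous_on (- {0}) X"
      by (rule continuous_on_punctured, erule S(1), erule T(1))
         (rule continuous_on_chart(1)[OF cY(1)] continuous_on_chart(2)[OF cY(2)])+
    show "continuous_on (- {0}) m"
      by (rule continuous_on_punctured, erule S(2), erule T(2))
         (intro continuous_on_divide continuous_on_chart(1)[OF cMN(1)] continuous_on_chart(2)[OF cMN(3)] continuous_intros; simp)+
    show "continuous_on (- {0}) n"
      by (rule continuous_on_punctured, erule S(3), erule T(3))
         (intro continuous_on_divide continuous_on_chart(1)[OF cMN(2)] continuous_on_chart(2)[OF cMN(4)] continuous_intros; simp)+
    show "continuous_on (- {0}) u"
      by (rule continuous_on_punctured, erule S(4), erule T(4))
         (intro continuous_on_divide continuous_on_chart(1)[OF cU] continuous_on_chart(2)[OF cV] continuous_intros; simp)+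
    show "norm d = 1" by (rule ad(1))
  qed
  moreover have "u (z, 1) = U z" for z by (simp add: u_def)
  ultimately show thesis using that A P(1) unfolding X_def by blast
qed

section \<open>Similarity of spheres\<close>

lemma punctured_agree:
  fixes F G :: "complex \<times> complex \<Rightarrow> 'b :: t2_space"
  assumes F: "continuous_on (- {0}) F" and G: "continuous_on (- {0}) G"
    and eq: "\<And>v. fst v \<noteq> 0 \<Longrightarrow> snd v \<noteq> 0 \<Longrightarrow> F v = G v" and v: "v \<noteq> 0"
  shows "F v = G v"
proof -
  \<comment> \<open>Only vanishing coordinates are perturbed, so all terms of the approximating
    sequence have both coordinates nonzero.\<close>
  define a b :: complex where "a = (if fst v = 0 then 1 else 0)" and "b = (if snd v = 0 then 1 else 0)"
  define s where "s = (\<lambda>k. (fst v + a * (1 / of_nat (Suc k)), snd v + b * (1 / of_nat (Suc k))))"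
  have "s \<longlonglongrightarrow> (fst v + a * 0, snd v + b * 0)"
    unfolding s_def
    by (intro tendsto_intros LIMSEQ_Suc[OF lim_1_over_n])
  then have s: "s \<longlonglongrightarrow> v" by simp
  have "F (s k) = G (s k)" for k
  proof (rule eq)
    have "complex_of_nat (Suc k) \<noteq> 0" by (simp only: of_nat_eq_0_iff)
    then show "fst (s k) \<noteq> 0" "snd (s k) \<noteq> 0"
      unfolding s_def a_def b_def by (simp_all del: of_nat_Suc)
  qed
  moreover have "isCont F v" "isCont G v"
    using F G v continuous_on_eq_continuous_at[OF open_delete[OF open_UNIV]]
    by (auto simp: Compl_eq_Diff_UNIV)
  then have "(\<lambda>k. F (s k)) \<longlonglongrightarrow> F v" "(\<lambda>k. G (s k)) \<longlonglongrightarrow> G v"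
    using s isCont_tendsto_compose by blast+
  ultimately show ?thesis using LIMSEQ_unique by auto
qed

text \<open>The premise leaves out \<open>z = 0\<close> because a cylindric potential does not see
  the two ends; continuity restores them.\<close>

lemma homogeneous_rep_potential_eq:
  assumes 1: "homogeneous_rep X m n u" and 2: "homogeneous_rep X' m' n' u'" and eq: "\<And>z. z \<noteq> 0 \<Longrightarrow> u (z, 1) = u' (z, 1)"
  shows "u = u'"
proof
  fix v
  show "u v = u' v"
  proof (cases "v = 0")
    \<comment> \<open>Equality of functions includes the zero vector, where homogeneity with the
      factor 2 forces both values to be 0.\<close>
    case True
    have "u (2 * 0, 2 * 0) = u (0, 0) / (norm (2 :: complex))\<^sup>2" "u' (2 * 0, 2 * 0) = u' (0, 0) / (norm (2 :: complex))\<^sup>2"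
      using homogeneous_rep.U_hom[OF 1, of 2 0 0] homogeneous_rep.U_hom[OF 2, of 2 0 0] by simp_all
    with True show ?thesis by (simp add: zero_prod_def)
  next
    case False
    show ?thesis
    proof (rule punctured_agree[OF homogeneous_rep.cont_U[OF 1] homogeneous_rep.cont_U[OF 2] _ False])
      fix v :: "complex \<times> complex" assume v: "fst v \<noteq> 0" "snd v \<noteq> 0"
      then have "v = (snd v * (fst v / snd v), snd v * 1)" by (simp add: prod_eq_iff)
      then show "u v = u' v"
        using homogeneous_rep.U_hom[OF 1 v(2), of "fst v / snd v" 1] homogeneous_rep.U_hom[OF 2 v(2), of "fst v / snd v" 1] eq[of "fst v / snd v"] v
        by simp
    qed
  qed
qed

lemma proj_paramD:
  assumes "proj_param P"
  shows "continuous_on (- {0}) P" and "P ` (- {0}) = S2"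
    and "v \<noteq> 0 \<Longrightarrow> w \<noteq> 0 \<Longrightarrow> P v = P w \<longleftrightarrow> wedge v w = 0"
proof -
  note * = assms[unfolded proj_param_def]
  show "continuous_on (- {0}) P" by (rule conjunct1[OF *])
  show "P ` (- {0}) = S2" by (rule conjunct1[OF conjunct2[OF *]])
  show "P v = P w \<longleftrightarrow> wedge v w = 0" if "v \<noteq> 0" "w \<noteq> 0"
    by (rule conjunct2[OF conjunct2[OF *], rule_format, OF that])
qed

text \<open>Meant for linear and conjugate-linear bijections \<open>T\<close>, both of which
  preserve proportionality of vectors.\<close>

lemma proj_param_compose:
  assumes P: "proj_param P" and T: "continuous_on UNIV T" "\<And>v. v \<noteq> 0 \<Longrightarrow> \<exists>w. w \<noteq> 0 \<and> T w = v"
    and w: "\<And>v w. wedge (T v) (T w) = 0 \<longleftrightarrow> wedge v w = 0"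
  shows "proj_param (\<lambda>v. P (T v))"
proof -
  have nz: "T v \<noteq> 0" if "v \<noteq> 0" for v
    using that w unfolding nonzero_iff_wedge by blast
  note P1 = proj_paramD(1)[OF P] and P2 = proj_paramD(2)[OF P] and P3 = proj_paramD(3)[OF P]
  have "continuous_on (- {0}) (\<lambda>v. P (T v))"
    by (rule continuous_on_compose2[OF P1 continuous_on_subset[OF T(1) subset_UNIV]]) (rule image_subsetI, simp add: nz)
  moreover have "T ` (- {0}) = - {0}"
  proof
    show "T ` (- {0}) \<subseteq> - {0}" by (rule image_subsetI) (simp add: nz)
    show "- {0} \<subseteq> T ` (- {0})"
    proof
      fix v :: "complex \<times> complex" assume "v \<in> - {0}"
      then obtain w where "w \<noteq> 0" "T w = v" using T(2)[of v] by blast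
      then show "v \<in> T ` (- {0})" by (intro image_eqI[of _ _ w]) simp_all
    qed
  qed
  then have "(\<lambda>v. P (T v)) ` (- {0}) = S2"
    using P2 by (metis image_image)
  moreover have "P (T v) = P (T w') \<longleftrightarrow> wedge v w' = 0" if "v \<noteq> 0" "w' \<noteq> 0" for v w'
    unfolding P3[OF nz[OF that(1)] nz[OF that(2)]] by (rule w)
  ultimately show ?thesis unfolding proj_param_def by simp
qed

lemma proj_param_onto_unit:
  assumes P: "proj_param P" and x: "x \<in> S2"
  obtains v where "v \<in> sphere 0 1" "v \<noteq> 0" "P v = x"
proof -
  note proj_paramD(2)[OF P]
  then obtain w where w: "w \<noteq> 0" "P w = x" using x by (metis ComplD imageE singletonI)
  define v where "v = (1 / norm w) *\<^sub>R w"
  have v: "v \<noteq> 0" "norm v = 1" using w(1) by (simp_all add: v_def)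
  have "wedge v w = 0" by (simp add: v_def)
  then have "P v = P w" using proj_paramD(3)[OF P v(1) w(1)] by simp
  with v w(2) show thesis using that by simp
qed

text \<open>The projective line carries the quotient topology of the compact unit sphere of \<open>\<complex>\<^sup>2\<close>.\<close>

lemma proj_param_map:
  assumes P: "proj_param P" and Q: "proj_param Q"
  obtains \<theta> where "continuous_on S2 \<theta>" "\<And>v. v \<noteq> 0 \<Longrightarrow> \<theta> (P v) = Q v"
proof -
  define \<theta> where "\<theta> = (\<lambda>x. Q (SOME v. v \<noteq> 0 \<and> P v = x))"
  have \<theta>: "\<theta> (P v) = Q v" if v: "v \<noteq> 0" for v
  proof -
    define w where "w = (SOME w. w \<noteq> 0 \<and> P w = P v)"
    have w: "w \<noteq> 0 \<and> P w = P v"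
      unfolding w_def by (rule someI[of _ v]) (simp add: v)
    then have "wedge w v = 0" using proj_paramD(3)[OF P, of w v] v by simp
    then have "Q w = Q v" using proj_paramD(3)[OF Q, of w v] v w by simp
    then show ?thesis unfolding \<theta>_def w_def .
  qed
  note cP = proj_paramD(1)[OF P] and cQ = proj_paramD(1)[OF Q]
  have sub: "sphere (0 :: complex \<times> complex) 1 \<subseteq> - {0}" by auto
  have S2P: "P v \<in> S2" if "v \<noteq> 0" for v
    using proj_paramD(2)[OF P] that by blast
  have "continuous_on S2 \<theta>"
    unfolding continuous_on_closed_vimage[OF closed_sphere]
  proof (intro allI impI)
    fix B :: "(real^3) set" assume B: "closed B"
    have "\<theta> -` B \<inter> S2 = P ` (sphere 0 1 \<inter> Q -` B)"
    proof (intro equalityI subsetI)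
      fix x assume x: "x \<in> \<theta> -` B \<inter> S2"
      then obtain v where v: "v \<in> sphere 0 1" "v \<noteq> 0" "P v = x"
        using proj_param_onto_unit[OF P, of x] by blast
      then have "Q v \<in> B" using x \<theta>[OF v(2)] by simp
      with v show "x \<in> P ` (sphere 0 1 \<inter> Q -` B)" by blast
    next
      fix x assume "x \<in> P ` (sphere 0 1 \<inter> Q -` B)"
      then obtain v where v: "v \<in> sphere 0 1" "Q v \<in> B" "x = P v" by blast
      then have "v \<noteq> 0" using sub by blast
      with v \<theta> S2P show "x \<in> \<theta> -` B \<inter> S2" by simp
    qed
    moreover have "closed (sphere 0 1 \<inter> Q -` B)"
      by (rule continuous_closed_preimage[OF continuous_on_subset[OF cQ sub] closed_sphere B])
    then have "compact (sphere 0 1 \<inter> (sphere 0 1 \<inter> Q -` B))"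
      by (rule compact_Int_closed[OF compact_sphere])
    then have "compact (sphere 0 1 \<inter> Q -` B)" by simp
    then have "compact (P ` (sphere 0 1 \<inter> Q -` B))"
      by (rule compact_continuous_image[rotated]) (rule continuous_on_subset[OF cP], use sub in blast)
    ultimately show "closed (\<theta> -` B \<inter> S2)" using compact_imp_closed by simp
  qed
  with \<theta> that show thesis by blast
qed

lemma proj_param_homeomorphism:
  assumes P: "proj_param P" and Q: "proj_param Q"
  obtains \<theta> \<theta>' where "homeomorphism S2 S2 \<theta> \<theta>'" "\<And>v. v \<noteq> 0 \<Longrightarrow> \<theta> (P v) = Q v"
proof -
  obtain \<theta> where \<theta>: "continuous_on S2 \<theta>" "\<And>v. v \<noteq> 0 \<Longrightarrow> \<theta> (P v) = Q v"
    using proj_param_map[OF P Q] by blast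
  obtain \<theta>' where \<theta>': "continuous_on S2 \<theta>'" "\<And>v. v \<noteq> 0 \<Longrightarrow> \<theta>' (Q v) = P v"
    using proj_param_map[OF Q P] by blast
  have S2: "P v \<in> S2" "Q v \<in> S2" if "v \<noteq> 0" for v
    using proj_paramD(2)[OF P] proj_paramD(2)[OF Q] that by blast+
  have "homeomorphism S2 S2 \<theta> \<theta>'"
  proof (rule homeomorphismI[OF \<theta>(1) \<theta>'(1) image_subsetI image_subsetI])
    fix x assume x: "x \<in> S2"
    obtain v where v: "v \<noteq> 0" "P v = x" by (rule proj_param_onto_unit[OF P x])
    have "\<theta> x = Q v" "\<theta>' (\<theta> x) = x" unfolding v(2)[symmetric] using \<theta>(2) \<theta>'(2) v(1) by simp_all
    then show "\<theta> x \<in> S2" "\<theta>' (\<theta> x) = x" using S2(2)[OF v(1)] by simp_all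
    obtain v where v: "v \<noteq> 0" "Q v = x" by (rule proj_param_onto_unit[OF Q x])
    have "\<theta>' x = P v" "\<theta> (\<theta>' x) = x" unfolding v(2)[symmetric] using \<theta>(2) \<theta>'(2) v(1) by simp_all
    then show "\<theta>' x \<in> S2" "\<theta> (\<theta>' x) = x" using S2(1)[OF v(1)] by simp_all
  qed
  with \<theta>(2) that show thesis by blast
qed

section \<open>Orientation and comparison of two surfaces\<close>

definition comb :: "complex \<times> complex \<Rightarrow> complex \<times> complex \<Rightarrow> complex \<times> complex \<Rightarrow> complex \<times> complex" where
  "comb e1 e2 v = (fst v * fst e1 + snd v * fst e2, fst v * snd e1 + snd v * snd e2)"

lemma wedge_comb: "wedge (comb e1 e2 v) (comb e1 e2 w) = wedge v w * wedge e1 e2"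
  by (simp add: comb_def algebra_simps)

lemma comb_onto:
  assumes "wedge e1 e2 = 1"
  shows "comb e1 e2 (wedge v e2, wedge e1 v) = v"
proof -
  have "comb e1 e2 (wedge v e2, wedge e1 v) = (fst v * wedge e1 e2, snd v * wedge e1 e2)"
    by (simp add: comb_def algebra_simps)
  then show ?thesis using assms by simp
qed

lemma cyl_curve_comb: "cyl_curve e1 e2 w = comb e1 e2 (exp (w / 2), exp (- w / 2))"
  by (simp add: cyl_curve_def comb_def)

text \<open>Similarity asks for a rotation, whereas \<open>B\<close> may reverse orientation. In
  that case \<open>cylinder_rep_reflect\<close> supplies a further reflection, at the price of
  conjugating the parameter.\<close>

lemma cylinder_rep_oriented:
  assumes P: "proj_param P" and e: "wedge e1 e2 = 1" and B: "orthogonal_matrix B"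
    and c: "cylinder_rep (\<lambda>w. B *v f (P (cyl_curve e1 e2 w))) m n U"
  obtains C S m' n' where "rotation_matrix C" "proj_param S"
    "cylinder_rep (\<lambda>w. C *v f (S (exp (w / 2), exp (- w / 2)))) m' n' U"
proof (cases "det B = 1")
  case True
  have "proj_param (\<lambda>v. P (comb e1 e2 v))"
  proof (rule proj_param_compose[OF P])
    show "continuous_on UNIV (comb e1 e2)" unfolding comb_def by (intro continuous_intros)
    show "\<exists>w. w \<noteq> 0 \<and> comb e1 e2 w = v" if "v \<noteq> 0" for v
    proof (intro exI conjI)
      show *: "comb e1 e2 (wedge v e2, wedge e1 v) = v" by (rule comb_onto[OF e])
      have "comb e1 e2 0 = 0" by (simp add: comb_def zero_prod_def)
      with * that show "(wedge v e2, wedge e1 v) \<noteq> 0" by metis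
    qed
    show "wedge (comb e1 e2 v) (comb e1 e2 w) = 0 \<longleftrightarrow> wedge v w = 0" for v w
      unfolding wedge_comb e by simp
  qed
  moreover have "rotation_matrix B" using B True by (simp add: rotation_matrix_def)
  ultimately show thesis using that c unfolding cyl_curve_comb by blast
next
  case False
  then have dB: "det B = - 1" using det_orthogonal_matrix[OF B] by simp
  define T where "T = (\<lambda>v. comb e1 e2 (cnj (fst v), cnj (snd v)))"
  have "proj_param (\<lambda>v. P (T v))"
  proof (rule proj_param_compose[OF P])
    show "continuous_on UNIV T" unfolding T_def comb_def by (intro continuous_intros)
    show "\<exists>w. w \<noteq> 0 \<and> T w = v" if "v \<noteq> 0" for v
    proof (intro exI conjI)
      show *: "T (cnj (wedge v e2), cnj (wedge e1 v)) = v"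
        using comb_onto[OF e, of v] by (simp add: T_def)
      have "T 0 = 0" by (simp add: T_def comb_def zero_prod_def)
      with * that show "(cnj (wedge v e2), cnj (wedge e1 v)) \<noteq> 0" by metis
    qed
    have "cnj a * cnj d - cnj b * cnj c = cnj (a * d - b * c)" for a b c d by simp
    then show "wedge (T v) (T w) = 0 \<longleftrightarrow> wedge v w = 0" for v w
      unfolding T_def wedge_comb e fst_conv snd_conv by (metis complex_cnj_zero_iff mult_1_right)
  qed
  moreover obtain S :: "real^3^3" where S: "orthogonal_matrix S" "det S = - 1"
    "\<And>Y m n U. cylinder_rep Y m n U \<Longrightarrow> \<exists>m' n'. cylinder_rep (\<lambda>w. S *v Y (cnj w)) m' n' U"
    using cylinder_rep_reflect by blast
  have "rotation_matrix (S ** B)"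
    using S B dB orthogonal_matrix_mul by (simp add: rotation_matrix_def det_mul)
  moreover have "cyl_curve e1 e2 (cnj w) = T (exp (w / 2), exp (- w / 2))" for w
    unfolding cyl_curve_comb T_def by (simp add: exp_cnj)
  then have "\<exists>m' n'. cylinder_rep (\<lambda>w. (S ** B) *v f (P (T (exp (w / 2), exp (- w / 2))))) m' n' U"
    using S(3)[OF c] by (simp add: matrix_vector_mul_assoc)
  ultimately show thesis using that by blast
qed

lemma proj_param_exp:
  assumes v: "fst v \<noteq> 0" "snd v \<noteq> 0"
  obtains w where "\<And>P. proj_param P \<Longrightarrow> P v = P (exp (w / 2), exp (- w / 2))"
proof -
  define w where "w = Ln (fst v / snd v)"
  have w: "exp w = fst v / snd v" using v by (simp add: w_def)
  have "exp (w / 2) = exp w * exp (- w / 2)" by (simp flip: exp_add)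
  then have "wedge v (exp (w / 2), exp (- w / 2)) = 0" using v unfolding w by simp
  moreover have "v \<noteq> 0" "(exp (w / 2), exp (- w / 2)) \<noteq> 0" using v by (auto simp: zero_prod_def)
  ultimately have "P v = P (exp (w / 2), exp (- w / 2))" if "proj_param P" for P
    using proj_paramD(3)[OF that] by simp
  with that show thesis by blast
qed

text \<open>The comparison in \<open>cylinder_rep_unique\<close> reaches only the points over the
  cylinder; continuity adds the two ends, and \<open>proj_param_homeomorphism\<close> turns the
  common parameter into a map between the spheres.\<close>

lemma cylinder_rep_similar:
  assumes f: "continuous_on S2 f" and g: "continuous_on S2 g"
    and P: "proj_param P" and Q: "proj_param Q" and A: "rotation_matrix A" and B: "rotation_matrix B"
    and c: "cylinder_rep (\<lambda>w. A *v f (P (exp (w / 2), exp (- w / 2)))) m n U"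
    and c': "cylinder_rep (\<lambda>w. B *v g (Q (exp (w / 2), exp (- w / 2)))) m' n' U"
  shows "similar_spheres f g"
proof -
  obtain s R b where s: "0 < s" and R: "rotation_matrix R"
    and eq: "\<And>w. B *v g (Q (exp (w / 2), exp (- w / 2))) = s *\<^sub>R (R *v (A *v f (P (exp (w / 2), exp (- w / 2))))) + b"
    using cylinder_rep_unique[OF c c'] by blast
  have BB: "transpose B *v (B *v x) = x" for x
    using B unfolding matrix_vector_mul_assoc rotation_matrix_def orthogonal_matrix_def by simp
  define C where "C = transpose B ** R ** A"
  have "orthogonal_matrix (transpose B)" "det (transpose B) = 1"
    using B by (simp_all add: rotation_matrix_def orthogonal_matrix_transpose)
  with A R have C: "rotation_matrix C"
    unfolding C_def rotation_matrix_def by (simp add: det_mul orthogonal_matrix_mul)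
  have eq': "g (Q (exp (w / 2), exp (- w / 2))) = s *\<^sub>R (C *v f (P (exp (w / 2), exp (- w / 2)))) + transpose B *v b" for w
  proof -
    have "g (Q (exp (w / 2), exp (- w / 2))) = transpose B *v (s *\<^sub>R (R *v (A *v f (P (exp (w / 2), exp (- w / 2))))) + b)"
      by (subst BB[symmetric]) (simp only: eq)
    also have "\<dots> = s *\<^sub>R (C *v f (P (exp (w / 2), exp (- w / 2)))) + transpose B *v b"
      unfolding C_def matrix_vector_right_distrib matrix_vector_mult_scaleR matrix_vector_mul_assoc matrix_mul_assoc ..
    finally show ?thesis .
  qed
  note cP = proj_paramD(1,2)[OF P] and cQ = proj_paramD(1,2)[OF Q]
  have eq2: "g (Q v) = s *\<^sub>R (C *v f (P v)) + transpose B *v b" if "v \<noteq> 0" for v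
  proof (rule punctured_agree[of "\<lambda>v. g (Q v)" "\<lambda>v. s *\<^sub>R (C *v f (P v)) + transpose B *v b", OF _ _ _ that])
    show "continuous_on (- {0}) (\<lambda>v. g (Q v))"
      by (rule continuous_on_compose2[OF g cQ(1)]) (simp add: cQ(2))
    have "continuous_on (- {0}) (\<lambda>v. f (P v))"
      by (rule continuous_on_compose2[OF f cP(1)]) (simp add: cP(2))
    then have "continuous_on (- {0}) (\<lambda>v. C *v f (P v))"
      using continuous_on_compose2[OF linear_continuous_on[OF matrix_vector_mul_bounded_linear, of UNIV C]] by auto
    then show "continuous_on (- {0}) (\<lambda>v. s *\<^sub>R (C *v f (P v)) + transpose B *v b)"
      by (intro continuous_intros)
    fix v :: "complex \<times> complex" assume "fst v \<noteq> 0" "snd v \<noteq> 0"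
    then obtain w where "\<And>P. proj_param P \<Longrightarrow> P v = P (exp (w / 2), exp (- w / 2))"
      using proj_param_exp by blast
    then show "g (Q v) = s *\<^sub>R (C *v f (P v)) + transpose B *v b"
      using eq' P Q by metis
  qed
  obtain \<theta> \<theta>' where \<theta>: "homeomorphism S2 S2 \<theta> \<theta>'" "\<And>v. v \<noteq> 0 \<Longrightarrow> \<theta> (P v) = Q v"
    using proj_param_homeomorphism[OF P Q] by blast
  have "g (\<theta> p) = s *\<^sub>R (C *v f p) + transpose B *v b" if "p \<in> S2" for p
  proof -
    obtain v where "v \<noteq> 0" "P v = p" using proj_param_onto_unit[OF P \<open>p \<in> S2\<close>] by blast
    with eq2 \<theta>(2) show ?thesis by metis
  qed
  with s C \<theta>(1) show ?thesis unfolding similar_spheres_def by blast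
qed

lemma elliptic_scale: "elliptic c s x y z (k * p, k * q) = (k * fst (elliptic c s x y z (p, q)), k * snd (elliptic c s x y z (p, q)))"
  by (simp add: elliptic_def trace_free_act_def algebra_simps)

lemma elliptic_comb: "elliptic c s x y z (comb e1 e2 v) = comb (elliptic c s x y z e1) (elliptic c s x y z e2) v"
  by (simp add: elliptic_def trace_free_act_def comb_def algebra_simps)

lemma rotational_reps_similar:
  assumes f: "continuous_on S2 f" and g: "continuous_on S2 g"
    and A: "orthogonal_matrix A" and B: "orthogonal_matrix B" and P: "proj_param P" and Q: "proj_param Q"
    and 1: "rotational_rep (\<lambda>v. A *v f (P v)) m n u a d" and 2: "rotational_rep (\<lambda>v. B *v g (Q v)) m' n' u a' d'"
  shows "similar_spheres f g"
proof -
  interpret R1: rotational_rep "\<lambda>v. A *v f (P v)" m n u a d by (rule 1)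
  interpret R2: rotational_rep "\<lambda>v. B *v g (Q v)" m' n' u a' d' by (rule 2)
  obtain x y z where F: "x\<^sup>2 + y * z = - 1"
    and XF: "\<And>p q. (p, q) \<noteq> 0 \<Longrightarrow> R1.Xi (p, q) = (y * q\<^sup>2 + 2 * x * p * q - z * p\<^sup>2) / 2"
    by (rule R1.Xi_quadratic) (rule that; simp)
  obtain x' y' z' where G: "x'\<^sup>2 + y' * z' = - 1"
    and XG: "\<And>p q. (p, q) \<noteq> 0 \<Longrightarrow> R2.Xi (p, q) = (y' * q\<^sup>2 + 2 * x' * p * q - z' * p\<^sup>2) / 2"
    by (rule R2.Xi_quadratic) (rule that; simp)
  have uF: "u (elliptic c s x y z v) = u v" if "c\<^sup>2 + s\<^sup>2 = 1" "v \<noteq> 0" for c s v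
    by (rule R1.potential_elliptic[OF F XF that])
  have uG: "u (elliptic c s x' y' z' v) = u v" if "c\<^sup>2 + s\<^sup>2 = 1" "v \<noteq> 0" for c s v
    by (rule R2.potential_elliptic[OF G XG that])
  \<comment> \<open>The trace of \<open>F G\<close>. Both factors are the group elements with
    \<open>c = 0\<close> and \<open>s = 1\<close>, so the product is a symmetry of the potential
    with determinant 1.\<close>
  define \<tau> where "\<tau> = (x * x' + y * z') + (z * y' + x * x')"
  have "Im \<tau> = 0"
    unfolding \<tau>_def
  proof (rule R1.symmetry_trace_real[where ?k12.0 = "x * y' - y * x'" and ?k21.0 = "z * x' - x * z'"])
    have "(x * x' + y * z') * (z * y' + x * x') - (x * y' - y * x') * (z * x' - x * z') = (x\<^sup>2 + y * z) * (x'\<^sup>2 + y' * z')"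
      by (simp add: power2_eq_square algebra_simps)
    then show "(x * x' + y * z') * (z * y' + x * x') - (x * y' - y * x') * (z * x' - x * z') = 1"
      unfolding F G by simp
    fix p q :: complex assume pq: "(p, q) \<noteq> 0"
    have "((x * x' + y * z') * p + (x * y' - y * x') * q, (z * x' - x * z') * p + (z * y' + x * x') * q)
      = elliptic 0 1 x y z (elliptic 0 1 x' y' z' (p, q))"
      by (simp add: elliptic_def trace_free_act_def algebra_simps)
    also have "u \<dots> = u (p, q)"
      using uF[of 0 1, OF _ elliptic_nonzero[OF G _ pq, of 0 1]] uG[of 0 1, OF _ pq] by simp
    finally show "u ((x * x' + y * z') * p + (x * y' - y * x') * q, (z * x' - x * z') * p + (z * y' + x * x') * q) = u (p, q)" .
  qed
  then have \<tau>: "\<tau> = of_real (Re \<tau>)" by (simp add: complex_eq_iff)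
  \<comment> \<open>Reversing the generator \<open>G\<close> if necessary makes the trace
    \<open>- 2 * c\<close> with \<open>c \<ge> 0\<close>, so that the square roots below are
    real.\<close>
  define e :: real where "e = (if Re \<tau> \<le> 0 then 1 else - 1)"
  define c where "c = \<bar>Re \<tau>\<bar> / 2"
  have e: "e = 1 \<or> e = - 1" by (simp add: e_def)
  have ce: "complex_of_real e = 1 \<or> complex_of_real e = - 1" using e by auto
  have ee: "complex_of_real e * of_real e = 1" using e by auto
  have c0: "0 \<le> c" by (simp add: c_def)
  have "e * Re \<tau> = - 2 * c" unfolding e_def c_def by simp
  then have tr: "of_real e * \<tau> = - 2 * of_real c"
    by (subst \<tau>) (metis of_real_minus of_real_mult of_real_numeral)
  define x2 y2 z2 where "x2 = of_real e * x'" and "y2 = of_real e * y'" and "z2 = of_real e * z'"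
  have "x2\<^sup>2 + y2 * z2 = (of_real e * of_real e) * (x'\<^sup>2 + y' * z')"
    by (simp add: x2_def y2_def z2_def power2_eq_square algebra_simps)
  then have G2: "x2\<^sup>2 + y2 * z2 = - 1" unfolding ee G by simp
  have tr2: "2 * x * x2 + y * z2 + z * y2 = - 2 * of_real c"
    unfolding tr[symmetric] \<tau>_def x2_def y2_def z2_def by (simp add: algebra_simps)
  \<comment> \<open>The positive solution of
    \<open>\<gamma>\<^sup>2 = (2 * c + 1) * s\<^sup>2\<close> and
    \<open>\<gamma>\<^sup>2 + s\<^sup>2 = 1\<close>: the first is the condition of
    \<open>braid_conjugates\<close>, the second puts both factors of \<open>M\<close> into the
    symmetry groups.\<close>
  define s \<gamma> where "s = 1 / sqrt (2 * c + 2)" and "\<gamma> = sqrt (2 * c + 1) / sqrt (2 * c + 2)"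
  have s2: "s\<^sup>2 = 1 / (2 * c + 2)" and g2: "\<gamma>\<^sup>2 = (2 * c + 1) / (2 * c + 2)"
    using c0 by (simp_all add: s_def \<gamma>_def power_divide)
  have gs: "\<gamma>\<^sup>2 = (2 * c + 1) * s\<^sup>2" unfolding s2 g2 by simp
  have gs1: "\<gamma>\<^sup>2 + s\<^sup>2 = 1" unfolding s2 g2 using c0 by (simp add: field_simps)
  define M where "M = (\<lambda>v. elliptic \<gamma> s x y z (elliptic \<gamma> s x2 y2 z2 v))"
  have braid: "trace_free_act x2 y2 z2 (M v) = M (trace_free_act x y z v)" for v
    unfolding M_def by (rule braid_conjugates[OF F G2 tr2 gs])
  have uM: "u (M v) = u v" if v: "v \<noteq> 0" for v
  proof -
    have "elliptic \<gamma> s x2 y2 z2 v = elliptic \<gamma> (s * e) x' y' z' v"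
      by (simp add: elliptic_def trace_free_act_def x2_def y2_def z2_def algebra_simps)
    moreover have "\<gamma>\<^sup>2 + (s * e)\<^sup>2 = 1" using gs1 e by auto
    ultimately have "u (elliptic \<gamma> s x2 y2 z2 v) = u v" using uG v by simp
    then show ?thesis unfolding M_def using uF[OF gs1 elliptic_nonzero[OF G2 gs1 v]] by simp
  qed
  obtain e1 e2 where ev: "wedge e1 e2 = 1"
    "trace_free_act x y z e1 = (\<i> * fst e1, \<i> * snd e1)" "trace_free_act x y z e2 = (- \<i> * fst e2, - \<i> * snd e2)"
    by (rule trace_free_eigenvectors[OF F]) (rule that)
  have F12: "x * fst e1 + y * snd e1 = 1 * \<i> * fst e1" "z * fst e1 - x * snd e1 = 1 * \<i> * snd e1"
    "x * fst e2 + y * snd e2 = - 1 * \<i> * fst e2" "z * fst e2 - x * snd e2 = - 1 * \<i> * snd e2"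
    using ev(2,3) by (simp_all add: trace_free_act_def)
  \<comment> \<open>By \<open>braid\<close>, \<open>M\<close> carries the eigenvectors of
    \<open>F\<close> to those of \<open>e\<close> times \<open>G\<close>; being a symmetry, it gives
    both cylinders the same potential.\<close>
  define h1 h2 where "h1 = M e1" and "h2 = M e2"
  have wh: "wedge h1 h2 = 1"
    unfolding h1_def h2_def M_def wedge_elliptic[OF F gs1] wedge_elliptic[OF G2 gs1] by (rule ev(1))
  have Mscale: "M (k * p, k * q) = (k * fst (M (p, q)), k * snd (M (p, q)))" for k p q
    unfolding M_def elliptic_scale by (simp add: elliptic_scale)
  have "trace_free_act x2 y2 z2 h1 = (\<i> * fst h1, \<i> * snd h1)" "trace_free_act x2 y2 z2 h2 = (- \<i> * fst h2, - \<i> * snd h2)"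
    unfolding h1_def h2_def braid ev(2,3) Mscale by simp_all
  then have h: "of_real e * (x' * fst h1 + y' * snd h1) = \<i> * fst h1" "of_real e * (z' * fst h1 - x' * snd h1) = \<i> * snd h1"
    "of_real e * (x' * fst h2 + y' * snd h2) = - \<i> * fst h2" "of_real e * (z' * fst h2 - x' * snd h2) = - \<i> * snd h2"
    by (simp_all add: trace_free_act_def x2_def y2_def z2_def algebra_simps)
  have mult_e: "a = of_real e * b" if "of_real e * a = b" for a b :: complex
  proof -
    have "a = (of_real e * of_real e) * a" unfolding ee by simp
    then show ?thesis unfolding mult.assoc that .
  qed
  have G12: "x' * fst h1 + y' * snd h1 = of_real e * \<i> * fst h1" "z' * fst h1 - x' * snd h1 = of_real e * \<i> * snd h1"
    "x' * fst h2 + y' * snd h2 = - of_real e * \<i> * fst h2" "z' * fst h2 - x' * snd h2 = - of_real e * \<i> * snd h2"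
    using mult_e[OF h(1)] mult_e[OF h(2)] mult_e[OF h(3)] mult_e[OF h(4)] by simp_all
  have curve: "u (cyl_curve h1 h2 w) = u (cyl_curve e1 e2 w)" for w
  proof -
    have "cyl_curve h1 h2 w = M (cyl_curve e1 e2 w)"
      unfolding cyl_curve_comb M_def h1_def h2_def elliptic_comb ..
    then show ?thesis using uM[OF cyl_curve_nonzero[OF ev(1)]] by simp
  qed
  obtain A1 :: "real^3^3" and m1 n1 where A1: "orthogonal_matrix A1"
    and c1: "cylinder_rep (\<lambda>w. A1 *v (A *v f (P (cyl_curve e1 e2 w)))) m1 n1 (\<lambda>w. u (cyl_curve e1 e2 w))"
    by (rule R1.cylinder_rep_exists[where e = 1, OF XF ev(1) F12 disjI1[OF refl]]) (assumption, rule that)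
  obtain B1 :: "real^3^3" and m2 n2 where B1: "orthogonal_matrix B1"
    and c2: "cylinder_rep (\<lambda>w. B1 *v (B *v g (Q (cyl_curve h1 h2 w)))) m2 n2 (\<lambda>w. u (cyl_curve h1 h2 w))"
    by (rule R2.cylinder_rep_exists[where e = "of_real e", OF XG wh G12 ce]) (assumption, rule that)
  obtain C S m3 n3 where C: "rotation_matrix C" "proj_param S"
    "cylinder_rep (\<lambda>w. C *v f (S (exp (w / 2), exp (- w / 2)))) m3 n3 (\<lambda>w. u (cyl_curve e1 e2 w))"
    by (rule cylinder_rep_oriented[OF P ev(1) orthogonal_matrix_mul[OF A1 A] c1[unfolded matrix_vector_mul_assoc]]) (rule that)
  obtain D T m4 n4 where D: "rotation_matrix D" "proj_param T"
    "cylinder_rep (\<lambda>w. D *v g (T (exp (w / 2), exp (- w / 2)))) m4 n4 (\<lambda>w. u (cyl_curve e1 e2 w))"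
    by (rule cylinder_rep_oriented[OF Q wh orthogonal_matrix_mul[OF B1 B] c2[unfolded matrix_vector_mul_assoc curve]]) (rule that)
  show ?thesis
    by (rule cylinder_rep_similar[OF f g C(2) D(2) C(1) D(1) C(3) D(3)])
qed

lemma plane_representations_similar:
  assumes f: "sphere_of_revolution f" and g: "sphere_of_revolution g"
    and F: "plane_representation f \<sigma> \<tau> U V \<psi> \<phi>" and G: "plane_representation g \<sigma>' \<tau>' U' V' \<psi>' \<phi>'"
    and U: "\<And>z. z \<noteq> 0 \<Longrightarrow> U z = U' z"
  shows "similar_spheres f g"
proof -
  have cont: "continuous_on S2 f" if "sphere_of_revolution f" for f
  proof -
    have "continuous_on (- {0}) (radial_extension f)"
      using that unfolding sphere_of_revolution_def immersed_sphere_def smooth_on_def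
      by (meson Ck_on.simps(1))
    then have "continuous_on S2 (radial_extension f)" by (rule continuous_on_subset) auto
    then show ?thesis by (rule continuous_on_eq) (simp add: radial_extension_def)
  qed
  obtain A P m n u a d where A: "orthogonal_matrix A" "proj_param P" "rotational_rep (\<lambda>v. A *v f (P v)) m n u a d"
    and u: "\<And>z. u (z, 1) = U z" by (rule plane_representation_rotational_rep[OF f F]) (rule that)
  obtain B Q m' n' u' a' d' where B: "orthogonal_matrix B" "proj_param Q" "rotational_rep (\<lambda>v. B *v g (Q v)) m' n' u' a' d'"
    and u': "\<And>z. u' (z, 1) = U' z" by (rule plane_representation_rotational_rep[OF g G]) (rule that)
  have "u = u'"
    by (rule homogeneous_rep_potential_eq[OF rotational_rep.axioms(1)[OF A(3)] rotational_rep.axioms(1)[OF B(3)]]) (simp add: u u' U)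
  then show ?thesis
    using rotational_reps_similar[OF cont[OF f] cont[OF g] A(1) B(1) A(2) B(2) A(3)] B(3) by simp
qed

theorem theorem5:
  fixes f g :: "real^3 \<Rightarrow> real^3"
  assumes "sphere_of_revolution f" and "sphere_of_revolution g"
    and "(\<exists>U. plane_potential f U \<and> plane_potential g U) \<or>
         (\<exists>W. cylindric_potential f W \<and> cylindric_potential g W)"
  shows "similar_spheres f g"
  using assms(3)
proof
  assume "\<exists>U. plane_potential f U \<and> plane_potential g U"
  then show ?thesis
    unfolding plane_potential_def using plane_representations_similar[OF assms(1,2)] by blast
next
  assume "\<exists>W. cylindric_potential f W \<and> cylindric_potential g W"
  then obtain W where W: "cylindric_potential f W" "cylindric_potential g W" by blast
  have rep: "\<exists>\<sigma> \<tau> U V \<psi> \<phi>. plane_representation f \<sigma> \<tau> U V \<psi> \<phi> \<and> (\<forall>w. W w = norm (exp w) * U (exp w))"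
    if W: "cylindric_potential f W" for f
  proof -
    obtain \<sigma> \<tau> \<eta> where "cylindric_representation f \<sigma> \<tau> W \<eta>"
      using W unfolding cylindric_potential_def by blast
    then have "\<exists>U V \<psi> \<phi>. plane_representation f \<sigma> \<tau> U V \<psi> \<phi> \<and>
        (\<forall>w. W w = norm (exp w) * U (exp w) \<and>
             \<eta> w $ 1 = exp (w / 2) * \<psi> (exp w) $ 1 \<and>
             \<eta> w $ 2 = cnj (exp (w / 2)) * \<psi> (exp w) $ 2)"
      unfolding cylindric_representation_def by (rule conjunct1)
    then show ?thesis by blast
  qed
  obtain \<sigma> \<tau> U V \<psi> \<phi> where F: "plane_representation f \<sigma> \<tau> U V \<psi> \<phi>" "\<forall>w. W w = norm (exp w) * U (exp w)"
    using rep[OF W(1)] by (elim exE conjE) (rule that)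
  obtain \<sigma>' \<tau>' U' V' \<psi>' \<phi>' where G: "plane_representation g \<sigma>' \<tau>' U' V' \<psi>' \<phi>'" "\<forall>w. W w = norm (exp w) * U' (exp w)"
    using rep[OF W(2)] by (elim exE conjE) (rule that)
  show ?thesis
  proof (rule plane_representations_similar[OF assms(1,2) F(1) G(1)])
    fix z :: complex assume "z \<noteq> 0"
    then have z: "exp (Ln z) = z" by (rule exp_Ln)
    \<comment> \<open>Every nonzero \<open>z\<close> is an exponential, so the cylindric potential
      determines the plane one off the origin.\<close>
    have "norm z * U z = norm z * U' z" using F(2)[rule_format, of "Ln z"] G(2)[rule_format, of "Ln z"] unfolding z by metis
    with \<open>z \<noteq> 0\<close> show "U z = U' z" by simp
  qed
qed

end
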